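(* Let $\Omega\subset\mathbb{R}^3$ be a bounded connected $C^2$ domain, $\kappa_m>0$, and let $\{\phi_k\}_{k\ge1}$ be an $L^2(\Omega)$-orthonormal basis of eigenfunctions of $-\kappa_m\Delta$ with homogeneous Neumann boundary conditions, ordered by increasing eigenvalue. Fix $M\in\mathbb{N}$ and consider $$F:\Omega^M\to\mathbb{R},\qquad F(x_1,\dots,x_M):=\det\big(\phi_k(x_j)\big)_{j,k=1}^M .$$ Then: (a) $F$ is a real-analytic function on $\Omega^M$. (b) $F$ is not identically zero. (c) The zero set $\mathcal Z_M:=\{(x_1,\dots,x_M)\in\Omega^M: F(x_1,\dots,x_M)=0\}$ has Lebesgue measure zero in $\Omega^M$. In particular, for almost every choice of $(x_1,\dots,x_M)\in\Omega^M$ (Lebesgue measure), for every $N\le M$ the $N\times M$ matrix $\big(\phi_k(x_j)\big)_{1\le k\le N,\,1\le j\le M}$ has full row rank $N$.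
   Context: The Neumann operator is $\kappa_m\Delta$ with domain $\{y\in H^2(\Omega):\partial_\nu y=0\text{ on }\partial\Omega\}$. *)

theory Defs
  imports "HOL-Analysis.Analysis"
begin

section \<open>Functions of class C^k and real-analytic functions\<close>

text \<open>Meant for open sets \<open>S\<close>: all partial derivatives up to order \<open>k\<close> exist and are continuous.\<close>

primrec Ck_on :: "nat \<Rightarrow> 'a::euclidean_space set \<Rightarrow> ('a \<Rightarrow> real) \<Rightarrow> bool" where
  "Ck_on 0 S f \<longleftrightarrow> continuous_on S f"
| "Ck_on (Suc k) S f \<longleftrightarrow>
     (\<forall>x\<in>S. f differentiable (at x)) \<and>
     (\<forall>b\<in>Basis. Ck_on k S (\<lambda>x. frechet_derivative f (at x) b))"

text \<open>Every point has a ball on which \<open>f\<close> is the sum of a power series in the coordinates of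
  \<open>x - a\<close>. The multi-indices are the functions \<open>Basis \<rightarrow>\<^sub>E UNIV\<close> to the natural numbers, and
  \<^const>\<open>has_sum\<close> is unconditional (hence, over the reals, absolute) summation.\<close>

definition real_analytic_on :: "('a::euclidean_space \<Rightarrow> real) \<Rightarrow> 'a set \<Rightarrow> bool" where
  "real_analytic_on f S \<longleftrightarrow>
     (\<forall>a\<in>S. \<exists>r>0. \<exists>c :: ('a \<Rightarrow> nat) \<Rightarrow> real. ball a r \<subseteq> S \<and>
        (\<forall>x\<in>ball a r.
           ((\<lambda>\<alpha>. c \<alpha> * (\<Prod>b\<in>Basis. ((x - a) \<bullet> b) ^ \<alpha> b)) has_sum f x) (Basis \<rightarrow>\<^sub>E UNIV)))"


section \<open>Square-integrable functions\<close>

definition L2_fun :: "'a measure \<Rightarrow> ('a \<Rightarrow> real) \<Rightarrow> bool" where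
  "L2_fun M f \<longleftrightarrow> f \<in> borel_measurable M \<and> integrable M (\<lambda>x. (f x)\<^sup>2)"

definition L2_inner :: "'a measure \<Rightarrow> ('a \<Rightarrow> real) \<Rightarrow> ('a \<Rightarrow> real) \<Rightarrow> real" where
  "L2_inner M f g = (LINT x|M. f x * g x)"

definition L2_converges :: "'a measure \<Rightarrow> (nat \<Rightarrow> 'a \<Rightarrow> real) \<Rightarrow> ('a \<Rightarrow> real) \<Rightarrow> bool" where
  "L2_converges M f g \<longleftrightarrow> (\<lambda>n. \<integral>\<^sup>+ x. ennreal ((f n x - g x)\<^sup>2) \<partial>M) \<longlonglongrightarrow> 0"

text \<open>The basis is indexed by \<open>k \<ge> 1\<close>; the value at index \<open>0\<close> is irrelevant.\<close>

definition L2_orthonormal_basis :: "'a measure \<Rightarrow> (nat \<Rightarrow> 'a \<Rightarrow> real) \<Rightarrow> bool" where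
  "L2_orthonormal_basis M \<phi> \<longleftrightarrow>
     (\<forall>k\<ge>1. L2_fun M (\<phi> k)) \<and>
     (\<forall>j\<ge>1. \<forall>k\<ge>1. L2_inner M (\<phi> j) (\<phi> k) = (if j = k then 1 else 0)) \<and>
     (\<forall>f. L2_fun M f \<longrightarrow> L2_converges M (\<lambda>n x. \<Sum>k=1..n. L2_inner M f (\<phi> k) * \<phi> k x) f)"


section \<open>Weak derivatives and Sobolev spaces\<close>

definition test_function :: "'a::euclidean_space set \<Rightarrow> ('a \<Rightarrow> real) \<Rightarrow> bool" where
  "test_function \<Omega> \<psi> \<longleftrightarrow>
     (\<forall>k. Ck_on k UNIV \<psi>) \<and> compact (closure {x. \<psi> x \<noteq> 0}) \<and> closure {x. \<psi> x \<noteq> 0} \<subseteq> \<Omega>"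

definition L2_weak_deriv ::
    "'a::euclidean_space set \<Rightarrow> 'a \<Rightarrow> ('a \<Rightarrow> real) \<Rightarrow> ('a \<Rightarrow> real) \<Rightarrow> bool" where
  "L2_weak_deriv \<Omega> b u v \<longleftrightarrow>
     L2_fun (lebesgue_on \<Omega>) u \<and> L2_fun (lebesgue_on \<Omega>) v \<and>
     (\<forall>\<psi>. test_function \<Omega> \<psi> \<longrightarrow>
        (LINT x|lebesgue_on \<Omega>. u x * frechet_derivative \<psi> (at x) b) =
        - (LINT x|lebesgue_on \<Omega>. v x * \<psi> x))"

text \<open>\<open>u\<close> belongs to \<open>H\<^sup>1(\<Omega>)\<close> and has the weak gradient \<open>(g b)\<close>, where \<open>b\<close> ranges over \<open>Basis\<close>.\<close>

definition H1_fun ::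
    "'a::euclidean_space set \<Rightarrow> ('a \<Rightarrow> real) \<Rightarrow> ('a \<Rightarrow> 'a \<Rightarrow> real) \<Rightarrow> bool" where
  "H1_fun \<Omega> u g \<longleftrightarrow> (\<forall>b\<in>Basis. L2_weak_deriv \<Omega> b u (g b))"

text \<open>\<open>u\<close> belongs to \<open>H\<^sup>2(\<Omega>)\<close>, with weak gradient \<open>(g b)\<close> and weak Hessian \<open>(h b c)\<close>.\<close>

definition H2_fun ::
    "'a::euclidean_space set \<Rightarrow> ('a \<Rightarrow> real) \<Rightarrow> ('a \<Rightarrow> 'a \<Rightarrow> real) \<Rightarrow>
     ('a \<Rightarrow> 'a \<Rightarrow> 'a \<Rightarrow> real) \<Rightarrow> bool" where
  "H2_fun \<Omega> u g h \<longleftrightarrow> H1_fun \<Omega> u g \<and> (\<forall>b\<in>Basis. H1_fun \<Omega> (g b) (h b))"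


section \<open>Domains of class C^2, surface measure and traces\<close>

text \<open>Near each boundary point, after an orthogonal change of coordinates, the domain is the set
  of points above the graph of a C^2 function of the first two coordinates.\<close>

definition C2_domain :: "(real^3) set \<Rightarrow> bool" where
  "C2_domain \<Omega> \<longleftrightarrow> open \<Omega> \<and> connected \<Omega> \<and> \<Omega> \<noteq> {} \<and>
     (\<forall>p\<in>frontier \<Omega>. \<exists>r>0. \<exists>Q :: real^3 \<Rightarrow> real^3. \<exists>\<gamma> :: real^2 \<Rightarrow> real.
        orthogonal_transformation Q \<and> Ck_on 2 UNIV \<gamma> \<and>
        \<Omega> \<inter> ball p r = {x \<in> ball p r. Q x $ 3 > \<gamma> (vector [Q x $ 1, Q x $ 2])})"

text \<open>Two-dimensional Hausdorff measure, normalised to agree with surface area. It is a metric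
  outer measure, so it is countably additive on the Borel sets, as \<^const>\<open>measure_of\<close> requires.\<close>

definition hausdorff2_pre :: "real \<Rightarrow> (real^3) set \<Rightarrow> ennreal" where
  "hausdorff2_pre \<delta> A =
     (INF C \<in> {C :: nat \<Rightarrow> (real^3) set. A \<subseteq> (\<Union>i. C i) \<and> (\<forall>i. bounded (C i) \<and> diameter (C i) \<le> \<delta>)}.
        \<Sum>i. ennreal (pi / 4 * (diameter (C i))\<^sup>2))"

definition hausdorff2 :: "(real^3) set \<Rightarrow> ennreal" where
  "hausdorff2 A = (SUP \<delta>\<in>{0<..}. hausdorff2_pre \<delta> A)"

definition surface_measure :: "(real^3) set \<Rightarrow> (real^3) measure" where
  "surface_measure \<Omega> = restrict_space (measure_of UNIV (sets borel) hausdorff2) (frontier \<Omega>)"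

text \<open>The trace operator is the continuous extension to \<open>H\<^sup>1(\<Omega>)\<close>, with values in
  \<open>L\<^sup>2(\<partial>\<Omega>)\<close>, of the restriction to the boundary of functions that are C^1 up to the boundary:
  the trace of \<open>u\<close> is the limit of the boundary values along any sequence of such functions
  converging to \<open>u\<close> in \<open>H\<^sup>1(\<Omega>)\<close>.\<close>

definition has_trace :: "(real^3) set \<Rightarrow> (real^3 \<Rightarrow> real) \<Rightarrow> (real^3 \<Rightarrow> real) \<Rightarrow> bool" where
  "has_trace \<Omega> u t \<longleftrightarrow> L2_fun (surface_measure \<Omega>) t \<and>
     (\<exists>g w. H1_fun \<Omega> u g \<and> (\<forall>n. Ck_on 1 UNIV (w n)) \<and>
        L2_converges (lebesgue_on \<Omega>) w u \<and>
        (\<forall>b\<in>Basis. L2_converges (lebesgue_on \<Omega>)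
           (\<lambda>n x. frechet_derivative (w n) (at x) b) (g b)) \<and>
        L2_converges (surface_measure \<Omega>) w t)"

text \<open>\<open>n\<close> is the outward unit normal at \<open>p\<close>: it is orthogonal to the tangent plane of the
  boundary at \<open>p\<close> and points out of \<open>\<Omega>\<close>.\<close>

definition outward_unit_normal :: "(real^3) set \<Rightarrow> real^3 \<Rightarrow> real^3 \<Rightarrow> bool" where
  "outward_unit_normal \<Omega> p n \<longleftrightarrow> p \<in> frontier \<Omega> \<and> norm n = 1 \<and>
     ((\<lambda>x. ((x - p) \<bullet> n) / norm (x - p)) \<longlongrightarrow> 0) (at p within frontier \<Omega>) \<and>
     (\<forall>\<^sub>F t in at_right 0. p - t *\<^sub>R n \<in> \<Omega> \<and> p + t *\<^sub>R n \<notin> closure \<Omega>)"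

text \<open>The condition \<open>\<partial>\<^sub>\<nu> y = 0\<close> on \<open>\<partial>\<Omega>\<close> for a function \<open>y\<close> in \<open>H\<^sup>2(\<Omega>)\<close> whose weak gradient is
  \<open>(g b)\<close>: the normal derivative is \<open>tr(\<nabla>y) \<bullet> \<nu>\<close>.\<close>

definition normal_derivative_zero :: "(real^3) set \<Rightarrow> (real^3 \<Rightarrow> real^3 \<Rightarrow> real) \<Rightarrow> bool" where
  "normal_derivative_zero \<Omega> g \<longleftrightarrow>
     (\<exists>t. (\<forall>b\<in>Basis. has_trace \<Omega> (g b) (t b)) \<and>
        (AE p in surface_measure \<Omega>.
           \<exists>n. outward_unit_normal \<Omega> p n \<and> (\<Sum>b\<in>Basis. t b p * (n \<bullet> b)) = 0))"


section \<open>The Neumann operator and its eigenfunctions\<close>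

text \<open>\<open>y\<close> lies in the domain of the Neumann operator \<open>\<kappa>\<Delta>\<close>, and \<open>z\<close> represents its image.\<close>

definition neumann_operator ::
    "(real^3) set \<Rightarrow> real \<Rightarrow> (real^3 \<Rightarrow> real) \<Rightarrow> (real^3 \<Rightarrow> real) \<Rightarrow> bool" where
  "neumann_operator \<Omega> \<kappa> y z \<longleftrightarrow>
     (\<exists>g h. H2_fun \<Omega> y g h \<and> normal_derivative_zero \<Omega> g \<and>
        (AE x in lebesgue_on \<Omega>. z x = \<kappa> * (\<Sum>b\<in>Basis. h b b x)))"

definition neumann_eigenfunction ::
    "(real^3) set \<Rightarrow> real \<Rightarrow> real \<Rightarrow> (real^3 \<Rightarrow> real) \<Rightarrow> bool" where
  "neumann_eigenfunction \<Omega> \<kappa> \<mu> y \<longleftrightarrow>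
     neumann_operator \<Omega> \<kappa> y (\<lambda>x. - (\<mu> * y x)) \<and> \<not> (AE x in lebesgue_on \<Omega>. y x = 0)"

text \<open>The point values \<open>\<phi> k x\<close> only make sense for a distinguished representative of the class of
  \<open>\<phi> k\<close> modulo null sets. As usual this is the continuous one, which exists because
  \<open>H\<^sup>2(\<Omega>)\<close> embeds into the continuous functions in dimension three.\<close>

definition neumann_eigenbasis ::
    "(real^3) set \<Rightarrow> real \<Rightarrow> (nat \<Rightarrow> real) \<Rightarrow> (nat \<Rightarrow> real^3 \<Rightarrow> real) \<Rightarrow> bool" where
  "neumann_eigenbasis \<Omega> \<kappa> \<mu> \<phi> \<longleftrightarrow>
     L2_orthonormal_basis (lebesgue_on \<Omega>) \<phi> \<and>
     (\<forall>k\<ge>1. neumann_eigenfunction \<Omega> \<kappa> (\<mu> k) (\<phi> k) \<and> continuous_on \<Omega> (\<phi> k)) \<and>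
     mono_on {1..} \<mu>"


section \<open>Configurations of points and evaluation matrices\<close>

text \<open>A configuration of \<open>M = CARD('m)\<close> points is a vector indexed by \<open>'m\<close>, so that the space of
  configurations is a Euclidean space of dimension \<open>3M\<close>.\<close>

definition config_set :: "(real^3) set \<Rightarrow> (real^3^'m::finite) set" where
  "config_set \<Omega> = {x. \<forall>j. x $ j \<in> \<Omega>}"

text \<open>Both the points and the first \<open>M\<close> basis functions are numbered through the same bijection
  \<open>e\<close> from \<open>'m\<close> to \<open>{1..M}\<close>; the point with number \<open>j\<close> is \<open>x $ i\<close> with \<open>e i = j\<close>.\<close>

definition eval_det ::
    "(nat \<Rightarrow> real^3 \<Rightarrow> real) \<Rightarrow> ('m \<Rightarrow> nat) \<Rightarrow> real^3^'m::finite \<Rightarrow> real" where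
  "eval_det \<phi> e x = det (\<chi> j k. \<phi> (e k) (x $ j))"

definition eval_row :: "(nat \<Rightarrow> real^3 \<Rightarrow> real) \<Rightarrow> real^3^'m::finite \<Rightarrow> nat \<Rightarrow> real^'m" where
  "eval_row \<phi> x k = (\<chi> j. \<phi> k (x $ j))"

text \<open>Rank of the \<open>N \<times> M\<close> matrix with rows \<open>eval_row \<phi> x k\<close> for \<open>1 \<le> k \<le> N\<close>, defined like
  \<^const>\<open>rank\<close> as the dimension of the set of rows, since \<open>N\<close> is not the size of a type here.\<close>

definition eval_rank :: "(nat \<Rightarrow> real^3 \<Rightarrow> real) \<Rightarrow> real^3^'m::finite \<Rightarrow> nat \<Rightarrow> nat" where
  "eval_rank \<phi> x N = dim (eval_row \<phi> x ` {1..N})"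

end

theory Submission
  imports Defs "HOL-Complex_Analysis.Cauchy_Integral_Formula"
begin

text \<open>Inside \<open>\<Omega>\<close> an eigenfunction is a continuous weak solution of \<open>\<Delta> u + \<lambda> u = 0\<close> with
  \<open>\<lambda> = \<mu> / \<kappa>\<close>. With \<open>e'' = \<lambda> e\<close> and \<open>e 0 = 1\<close> the function \<open>u x * e t\<close> is weakly harmonic in
  one dimension more, hence equal to its averages against every smooth radial kernel: the derivative
  of such an average with respect to the radius is the integral of the function against the
  Laplacian of a radial test function. Differentiating the kernel bounds the gradient by \<open>C / r\<close>
  times the supremum over a ball of radius \<open>r\<close>; the partial derivatives have the mean value property
  again, so \<open>n\<close> steps with radius proportional to \<open>1 / n\<close> give bounds of order \<open>n! C^n\<close> on the
  derivatives of order \<open>n\<close>, and the Taylor series converges. Setting \<open>t = 0\<close> shows that \<open>u\<close> is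
  analytic.

  The determinant is a polynomial in the values of the eigenfunctions, hence analytic, and it is not
  identically zero because the eigenfunctions are linearly independent. A nonzero analytic function
  on a connected open set has nonzero values in every ball, and the rays from a point where it does
  not vanish meet its zero set in countable sets, so the zero set is null.\<close>


section \<open>Power series at a point\<close>

text \<open>Solutions of the Helmholtz equation also have a mean value property, but with a factor
  that depends on \<open>lam\<close> and on the radius. The extra variable removes this factor, and
  the property then passes unchanged to derivatives. Only continuity of the solution is known, so no
  derivative is ever placed on it: a change of variables first moves the radius or the centre into
  the smooth kernel. This dictates the kernel: it must be \<open>cutoff 1\<close>, the derivative of
  the profile \<open>cutoff 0\<close> of the test functions, because the mass-preserving rescaling
  of \<open>cutoff 1 (z \<bullet> z)\<close> has a multiple of their Laplacian as its radius
  derivative, in every dimension. The Taylor expansion is indexed by words of directions rather than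
  by multi-indices, which avoids the symmetry of mixed derivatives and all multinomial coefficients;
  unconditional summation regroups the words at the end.\<close>

definition monomial :: "('a::euclidean_space \<Rightarrow> nat) \<Rightarrow> 'a \<Rightarrow> real" where
  "monomial \<alpha> x = (\<Prod>b\<in>Basis. (x \<bullet> b) ^ \<alpha> b)"

text \<open>Localised at one point and written in the increment \<open>v\<close>, so that sums,
  products and substitutions need not carry a common domain.\<close>

definition has_power_series_at :: "('a::euclidean_space \<Rightarrow> real) \<Rightarrow> 'a \<Rightarrow> bool" where
  "has_power_series_at f a \<longleftrightarrow>
     (\<exists>r>0. \<exists>c. \<forall>v. norm v < r \<longrightarrow>
        ((\<lambda>\<alpha>. c \<alpha> * monomial \<alpha> v) has_sum f (a + v)) (Basis \<rightarrow>\<^sub>E UNIV))"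

lemma real_analytic_on_iff:
  assumes "open S"
  shows "real_analytic_on f S \<longleftrightarrow> (\<forall>a\<in>S. has_power_series_at f a)"
proof
  assume *: "real_analytic_on f S"
  show "\<forall>a\<in>S. has_power_series_at f a"
  proof
    fix a assume "a \<in> S"
    with * obtain r c where "r > 0" and rc: "\<forall>x\<in>ball a r.
        ((\<lambda>\<alpha>. c \<alpha> * (\<Prod>b\<in>Basis. ((x - a) \<bullet> b) ^ \<alpha> b)) has_sum f x) (Basis \<rightarrow>\<^sub>E UNIV)"
      unfolding real_analytic_on_def by blast
    have "((\<lambda>\<alpha>. c \<alpha> * monomial \<alpha> v) has_sum f (a + v)) (Basis \<rightarrow>\<^sub>E UNIV)" if "norm v < r" for v
      using rc[rule_format, of "a + v"] that by (simp add: monomial_def dist_norm)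
    with \<open>r > 0\<close> show "has_power_series_at f a"
      unfolding has_power_series_at_def by blast
  qed
next
  assume *: "\<forall>a\<in>S. has_power_series_at f a"
  show "real_analytic_on f S"
    unfolding real_analytic_on_def
  proof
    fix a assume "a \<in> S"
    with * obtain r c where "r > 0" and rc: "\<forall>v. norm v < r \<longrightarrow>
        ((\<lambda>\<alpha>. c \<alpha> * monomial \<alpha> v) has_sum f (a + v)) (Basis \<rightarrow>\<^sub>E UNIV)"
      unfolding has_power_series_at_def by blast
    obtain r' where "r' > 0" "ball a r' \<subseteq> S"
      using assms \<open>a \<in> S\<close> open_contains_ball by blast
    moreover have "((\<lambda>\<alpha>. c \<alpha> * (\<Prod>b\<in>Basis. ((x - a) \<bullet> b) ^ \<alpha> b)) has_sum f x) (Basis \<rightarrow>\<^sub>E UNIV)"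
      if "x \<in> ball a (min r r')" for x
      using rc[rule_format, of "x - a"] that
      by (simp add: monomial_def dist_norm norm_minus_commute)
    ultimately show "\<exists>r>0. \<exists>c. ball a r \<subseteq> S \<and> (\<forall>x\<in>ball a r.
        ((\<lambda>\<alpha>. c \<alpha> * (\<Prod>b\<in>Basis. ((x - a) \<bullet> b) ^ \<alpha> b)) has_sum f x) (Basis \<rightarrow>\<^sub>E UNIV))"
      using \<open>r > 0\<close> by (intro exI[of _ "min r r'"] conjI exI[of _ c]) auto
  qed
qed

text \<open>A short multiple of the diagonal vector has all coordinates equal and non-zero. At such
  a point monomials can be cancelled from a convergent series.\<close>

lemma ex_monomial_nonzero:
  assumes "r > 0"
  obtains x :: "'a::euclidean_space" where "norm x < r" "\<And>\<alpha>. monomial \<alpha> x \<noteq> 0"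
proof -
  define d where "d = r / (2 * norm (\<Sum>b\<in>(Basis::'a set). b))"
  define x :: 'a where "x = d *\<^sub>R (\<Sum>b\<in>Basis. b)"
  have ip: "(\<Sum>b\<in>(Basis::'a set). b) \<bullet> b = 1" if "b \<in> Basis" for b
    using that by (simp add: inner_sum_left inner_Basis if_distrib sum.delta cong: if_cong)
  then have "(\<Sum>b\<in>(Basis::'a set). b) \<noteq> 0"
    using nonempty_Basis by fastforce
  then have "d > 0" "norm x < r"
    using assms by (auto simp: d_def x_def)
  moreover have "monomial \<alpha> x \<noteq> 0" for \<alpha>
    using \<open>d > 0\<close> ip by (simp add: monomial_def x_def)
  ultimately show thesis using that by blast
qed

text \<open>A series of monomials over an arbitrary index set converges unconditionally, so the terms
  with the same multi-index may be collected.\<close>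

lemma has_power_series_atI:
  fixes f :: "'a::euclidean_space \<Rightarrow> real" and \<alpha> :: "'i \<Rightarrow> 'a \<Rightarrow> nat"
  assumes "r > 0"
    and \<alpha>: "\<And>i. i \<in> I \<Longrightarrow> \<alpha> i \<in> Basis \<rightarrow>\<^sub>E UNIV"
    and hs: "\<And>v. norm v < r \<Longrightarrow> ((\<lambda>i. d i * monomial (\<alpha> i) v) has_sum f (a + v)) I"
  shows "has_power_series_at f a"
proof -
  \<comment> \<open>On the fibre over \<open>\<beta>\<close> all terms at \<open>x0\<close> share
    the non-zero factor \<open>monomial \<beta> x0\<close>; cancelling it shows that the
    coefficients themselves are summable there.\<close>
  obtain x0 :: 'a where x0: "norm x0 < r" "\<And>\<alpha>. monomial \<alpha> x0 \<noteq> 0"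
    using ex_monomial_nonzero[OF \<open>r > 0\<close>] by blast
  define fib where "fib \<beta> = {i\<in>I. \<alpha> i = \<beta>}" for \<beta>
  define c where "c \<beta> = infsum d (fib \<beta>)" for \<beta>
  have fib: "(d has_sum c \<beta>) (fib \<beta>)" for \<beta>
  proof -
    have "(\<lambda>i. d i * monomial (\<alpha> i) x0) summable_on fib \<beta>"
      using has_sum_imp_summable[OF hs[OF x0(1)]]
      by (rule summable_on_subset_banach) (auto simp: fib_def)
    then have "(\<lambda>i. d i * monomial \<beta> x0) summable_on fib \<beta>"
      by (rule summable_on_cong[THEN iffD1, rotated]) (auto simp: fib_def)
    then have "d summable_on fib \<beta>"
      using x0(2) by (simp add: summable_on_cmult_left')
    then show ?thesis by (simp add: c_def)
  qed
  have "((\<lambda>\<beta>. c \<beta> * monomial \<beta> v) has_sum f (a + v)) (Basis \<rightarrow>\<^sub>E UNIV)" if v: "norm v < r" for v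
  proof (rule has_sum_SigmaD)
    have "bij_betw snd (Sigma (Basis \<rightarrow>\<^sub>E UNIV) fib) I"
      by (rule bij_betwI[where g = "\<lambda>i. (\<alpha> i, i)"]) (use \<alpha> in \<open>auto simp: fib_def\<close>)
    then have "((\<lambda>p. d (snd p) * monomial (\<alpha> (snd p)) v) has_sum f (a + v)) (Sigma (Basis \<rightarrow>\<^sub>E UNIV) fib)"
      using hs[OF v] by (subst has_sum_reindex_bij_betw)
    then show "((\<lambda>p. d (snd p) * monomial (fst p) v) has_sum f (a + v)) (Sigma (Basis \<rightarrow>\<^sub>E UNIV) fib)"
      by (rule has_sum_cong[THEN iffD1, rotated]) (auto simp: fib_def)
    show "((\<lambda>y. d (snd (\<beta>, y)) * monomial (fst (\<beta>, y)) v) has_sum c \<beta> * monomial \<beta> v) (fib \<beta>)" for \<beta>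
      using has_sum_cmult_left[OF fib] by simp
  qed
  with \<open>r > 0\<close> show ?thesis
    unfolding has_power_series_at_def by blast
qed

lemma has_power_series_at_cong:
  assumes "has_power_series_at f a" and "\<forall>\<^sub>F x in nhds a. f x = g x"
  shows "has_power_series_at g a"
proof -
  obtain r c where "r > 0" and rc: "\<forall>v. norm v < r \<longrightarrow>
        ((\<lambda>\<alpha>. c \<alpha> * monomial \<alpha> v) has_sum f (a + v)) (Basis \<rightarrow>\<^sub>E UNIV)"
    using assms(1) unfolding has_power_series_at_def by blast
  obtain r' where "r' > 0" and r': "\<And>x. dist x a < r' \<Longrightarrow> f x = g x"
    using assms(2) unfolding eventually_nhds_metric by blast
  show ?thesis
    unfolding has_power_series_at_def
  proof (intro exI conjI allI impI)
    show "min r r' > 0" using \<open>r > 0\<close> \<open>r' > 0\<close> by simp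
    fix v :: 'a assume "norm v < min r r'"
    then show "((\<lambda>\<alpha>. c \<alpha> * monomial \<alpha> v) has_sum g (a + v)) (Basis \<rightarrow>\<^sub>E UNIV)"
      using rc[rule_format, of v] r'[of "a + v"] by (simp add: dist_norm)
  qed
qed

lemma has_power_series_at_const: "has_power_series_at (\<lambda>x. k) a"
proof (rule has_power_series_atI)
  show "((\<lambda>i. k * monomial (restrict (\<lambda>_. 0) Basis) v) has_sum k) {()}" for v :: 'a
    by (rule has_sum_finiteI) (auto simp: monomial_def)
qed (auto intro: zero_less_one)

lemma has_power_series_at_add:
  assumes "has_power_series_at f a" "has_power_series_at g a"
  shows "has_power_series_at (\<lambda>x. f x + g x) a"
proof -
  obtain r c where "r > 0" and rc: "\<forall>v. norm v < r \<longrightarrow>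
        ((\<lambda>\<alpha>. c \<alpha> * monomial \<alpha> v) has_sum f (a + v)) (Basis \<rightarrow>\<^sub>E UNIV)"
    using assms(1) unfolding has_power_series_at_def by blast
  obtain r' c' where "r' > 0" and rc': "\<forall>v. norm v < r' \<longrightarrow>
        ((\<lambda>\<alpha>. c' \<alpha> * monomial \<alpha> v) has_sum g (a + v)) (Basis \<rightarrow>\<^sub>E UNIV)"
    using assms(2) unfolding has_power_series_at_def by blast
  show ?thesis
  proof (rule has_power_series_atI)
    show "min r r' > 0" using \<open>r > 0\<close> \<open>r' > 0\<close> by simp
    fix v :: 'a assume "norm v < min r r'"
    then have "((\<lambda>\<alpha>. c \<alpha> * monomial \<alpha> v + c' \<alpha> * monomial \<alpha> v) has_sum f (a + v) + g (a + v)) (Basis \<rightarrow>\<^sub>E UNIV)"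
      using rc rc' by (intro has_sum_add) auto
    then show "((\<lambda>\<alpha>. (c \<alpha> + c' \<alpha>) * monomial \<alpha> v) has_sum f (a + v) + g (a + v)) (Basis \<rightarrow>\<^sub>E UNIV)"
      by (simp add: distrib_right)
  qed auto
qed

text \<open>Unconditional summability of reals is absolute, which makes the product family summable;
  summing first over \<open>B\<close> and then over \<open>A\<close> identifies the value.\<close>

lemma has_sum_mult_Times:
  fixes f g :: "_ \<Rightarrow> real"
  assumes f: "(f has_sum a) A" and g: "(g has_sum b) B"
  shows "((\<lambda>(x, y). f x * g y) has_sum a * b) (A \<times> B)"
proof -
  have fa: "(\<lambda>x. norm (f x)) summable_on A" and ga: "(\<lambda>x. norm (g x)) summable_on B"
    using has_sum_imp_summable[OF f] has_sum_imp_summable[OF g]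
    by (blast intro: summable_on_iff_abs_summable_on_real[THEN iffD1])+
  have "(\<lambda>p. norm (f (fst p) * g (snd p))) summable_on (A \<times> B)"
    by (rule Infinite_Sum.abs_summable_on_Sigma_iff[THEN iffD2])
      (use fa ga in \<open>auto simp: abs_mult infsum_cmult_right' intro!: summable_on_cmult_right summable_on_cmult_left\<close>)
  then have sm: "(\<lambda>p. f (fst p) * g (snd p)) summable_on (A \<times> B)"
    by (rule abs_summable_summable)
  have "((\<lambda>p. f (fst p) * g (snd p)) has_sum a * b) (A \<times> B)"
  proof (rule has_sum_SigmaI[OF _ _ sm])
    show "((\<lambda>y. f (fst (x, y)) * g (snd (x, y))) has_sum f x * b) B" for x
      using has_sum_cmult_right[OF g] by simp
    show "((\<lambda>x. f x * b) has_sum a * b) A"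
      using has_sum_cmult_left[OF f] by simp
  qed
  then show ?thesis by (simp add: case_prod_unfold)
qed

text \<open>The product series stays indexed by pairs of multi-indices.
  \<open>has_power_series_atI\<close> collects equal exponents, so no Cauchy product has to be
  written down.\<close>

lemma has_power_series_at_mult:
  fixes f :: "'a::euclidean_space \<Rightarrow> real"
  assumes "has_power_series_at f a" "has_power_series_at g a"
  shows "has_power_series_at (\<lambda>x. f x * g x) a"
proof -
  obtain r c where "r > 0" and rc: "\<forall>v. norm v < r \<longrightarrow>
        ((\<lambda>\<alpha>. c \<alpha> * monomial \<alpha> v) has_sum f (a + v)) (Basis \<rightarrow>\<^sub>E UNIV)"
    using assms(1) unfolding has_power_series_at_def by blast
  obtain r' c' where "r' > 0" and rc': "\<forall>v. norm v < r' \<longrightarrow>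
        ((\<lambda>\<alpha>. c' \<alpha> * monomial \<alpha> v) has_sum g (a + v)) (Basis \<rightarrow>\<^sub>E UNIV)"
    using assms(2) unfolding has_power_series_at_def by blast
  show ?thesis
  proof (rule has_power_series_atI)
    show "min r r' > 0" using \<open>r > 0\<close> \<open>r' > 0\<close> by simp
    fix v :: 'a assume "norm v < min r r'"
    then have "((\<lambda>(\<alpha>, \<beta>). (c \<alpha> * monomial \<alpha> v) * (c' \<beta> * monomial \<beta> v)) has_sum f (a + v) * g (a + v))
        ((Basis \<rightarrow>\<^sub>E UNIV) \<times> (Basis \<rightarrow>\<^sub>E UNIV))"
      using rc rc' by (intro has_sum_mult_Times) auto
    moreover have "(c \<alpha> * monomial \<alpha> v) * (c' \<beta> * monomial \<beta> v) =
        (c \<alpha> * c' \<beta>) * monomial (restrict (\<lambda>b. \<alpha> b + \<beta> b) Basis) v" for \<alpha> \<beta>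
      by (simp add: monomial_def power_add prod.distrib)
    ultimately show "((\<lambda>p. (c (fst p) * c' (snd p)) *
         monomial (restrict (\<lambda>b. fst p b + snd p b) Basis) v) has_sum f (a + v) * g (a + v))
        ((Basis \<rightarrow>\<^sub>E UNIV) \<times> (Basis \<rightarrow>\<^sub>E UNIV))"
      by (simp add: case_prod_unfold)
  qed auto
qed

lemma has_power_series_at_sum:
  "(\<And>i. i \<in> A \<Longrightarrow> has_power_series_at (f i) a) \<Longrightarrow> has_power_series_at (\<lambda>x. \<Sum>i\<in>A. f i x) a"
  by (induction A rule: infinite_finite_induct)
    (auto intro: has_power_series_at_const has_power_series_at_add)

lemma has_power_series_at_prod:
  "(\<And>i. i \<in> A \<Longrightarrow> has_power_series_at (f i) a) \<Longrightarrow> has_power_series_at (\<lambda>x. \<Prod>i\<in>A. f i x) a"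
  by (induction A rule: infinite_finite_induct)
    (auto intro: has_power_series_at_const has_power_series_at_mult)

text \<open>Affine substitutions whose linear part sends every coordinate to a multiple of a single
  coordinate, so that monomials remain monomials.\<close>

lemma has_power_series_at_subst:
  fixes L :: "'b::euclidean_space \<Rightarrow> 'a::euclidean_space"
  assumes f: "has_power_series_at f (p + L a)" and "bounded_linear L"
    and L: "\<And>x b. b \<in> Basis \<Longrightarrow> L x \<bullet> b = \<gamma> b * (x \<bullet> \<sigma> b)"
    and \<sigma>: "\<And>b. b \<in> Basis \<Longrightarrow> \<sigma> b \<in> Basis"
  shows "has_power_series_at (\<lambda>x. f (p + L x)) a"
proof -
  interpret L: bounded_linear L by fact
  obtain r c where "r > 0" and rc: "\<forall>v. norm v < r \<longrightarrow>
        ((\<lambda>\<alpha>. c \<alpha> * monomial \<alpha> v) has_sum f (p + L a + v)) (Basis \<rightarrow>\<^sub>E UNIV)"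
    using f unfolding has_power_series_at_def by blast
  obtain K where "K > 0" and K: "\<And>x. norm (L x) \<le> norm x * K"
    using L.pos_bounded by blast
  \<comment> \<open>The coordinates that \<open>\<sigma>\<close> sends to \<open>b'\<close> all
    become multiples of the same coordinate, so their exponents add up.\<close>
  define \<tau> where "\<tau> \<alpha> = restrict (\<lambda>b'. \<Sum>b\<in>{b\<in>Basis. \<sigma> b = b'}. \<alpha> b) Basis" for \<alpha> :: "'a \<Rightarrow> nat"
  have mono: "monomial \<alpha> (L v) = (\<Prod>b\<in>Basis. \<gamma> b ^ \<alpha> b) * monomial (\<tau> \<alpha>) v" for \<alpha> v
  proof -
    have "monomial (\<tau> \<alpha>) v = (\<Prod>b'\<in>Basis. \<Prod>b\<in>{b\<in>Basis. \<sigma> b = b'}. (v \<bullet> \<sigma> b) ^ \<alpha> b)"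
      unfolding monomial_def \<tau>_def by (auto simp: power_sum intro!: prod.cong)
    also have "\<dots> = (\<Prod>b\<in>Basis. (v \<bullet> \<sigma> b) ^ \<alpha> b)"
      by (rule prod.group) (auto simp: \<sigma>)
    finally show ?thesis
      by (simp add: monomial_def L power_mult_distrib prod.distrib)
  qed
  show ?thesis
  proof (rule has_power_series_atI)
    show "r / K > 0" using \<open>r > 0\<close> \<open>K > 0\<close> by simp
    fix v :: 'b assume "norm v < r / K"
    then have "norm (L v) < r"
      using K[of v] \<open>K > 0\<close> by (simp add: field_simps)
    then have "((\<lambda>\<alpha>. c \<alpha> * monomial \<alpha> (L v)) has_sum f (p + L (a + v))) (Basis \<rightarrow>\<^sub>E UNIV)"
      using rc by (simp add: L.add add.assoc)
    then show "((\<lambda>\<alpha>. (c \<alpha> * (\<Prod>b\<in>Basis. \<gamma> b ^ \<alpha> b)) * monomial (\<tau> \<alpha>) v) has_sum f (p + L (a + v)))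
        (Basis \<rightarrow>\<^sub>E UNIV)"
      by (simp add: mono mult.assoc)
  qed (auto simp: \<tau>_def)
qed

section \<open>Zero sets of real-analytic functions\<close>

lemma open_Collect_eventually_nhds: "open {a. eventually P (nhds a)}"
proof (subst open_subopen, intro ballI)
  fix x assume "x \<in> {a. eventually P (nhds a)}"
  then obtain B where "open B" "x \<in> B" "\<forall>y\<in>B. P y"
    unfolding eventually_nhds by blast
  then show "\<exists>T. open T \<and> x \<in> T \<and> T \<subseteq> {a. eventually P (nhds a)}"
    unfolding eventually_nhds by blast
qed

lemma has_power_series_at_real_zeros:
  fixes g :: "real \<Rightarrow> real"
  assumes "has_power_series_at g t"
  shows "(\<forall>\<^sub>F x in nhds t. g x = 0) \<or> (\<forall>\<^sub>F x in at t. g x \<noteq> 0)"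
proof -
  obtain r c where "r > 0" and rc: "\<forall>v. norm v < r \<longrightarrow>
        ((\<lambda>\<alpha>. c \<alpha> * monomial \<alpha> v) has_sum g (t + v)) (Basis \<rightarrow>\<^sub>E UNIV)"
    using assms unfolding has_power_series_at_def by blast
  \<comment> \<open>The only basis vector of the reals is \<open>1\<close>, so multi-indices are
    natural numbers and the series is an ordinary power series.\<close>
  define \<alpha> :: "nat \<Rightarrow> real \<Rightarrow> nat" where "\<alpha> n = restrict (\<lambda>_. n) {1}" for n
  define d where "d n = c (\<alpha> n)" for n
  have bij: "bij_betw \<alpha> UNIV (Basis \<rightarrow>\<^sub>E UNIV)"
    by (rule bij_betwI[where g = "\<lambda>\<beta>. \<beta> 1"])
      (auto simp: \<alpha>_def fun_eq_iff PiE_def extensional_def restrict_def)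
  have sums: "(\<lambda>n. d n * v ^ n) sums g (t + v)" if "norm v < r" for v
  proof -
    have "((\<lambda>n. c (\<alpha> n) * monomial (\<alpha> n) v) has_sum g (t + v)) UNIV"
      using rc that by (subst has_sum_reindex_bij_betw[OF bij]) auto
    then show ?thesis
      by (simp add: has_sum_imp_sums monomial_def d_def \<alpha>_def)
  qed
  show ?thesis
  proof (cases "\<exists>m. d m \<noteq> 0")
    case False
    then have "g x = 0" if "dist x t < r" for x
      using sums[of "x - t"] that sums_unique2[OF sums_zero, of "g x"] by (simp add: dist_norm)
    then have "\<forall>\<^sub>F x in nhds t. g x = 0"
      using \<open>r > 0\<close> unfolding eventually_nhds_metric by blast
    then show ?thesis ..
  next
    case True
    then obtain m where m: "d m \<noteq> 0" by blast
    txt \<open>The factor \<open>x - t\<close> makes the function vanish at \<open>t\<close>.\<close>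
    define a where "a n = (case n of 0 \<Rightarrow> 0 | Suc k \<Rightarrow> d k)" for n
    have a_sums: "(\<lambda>n. a n * (x - t) ^ n) sums ((x - t) * g x)" if "norm (x - t) < r" for x
    proof -
      have "(\<lambda>n. (x - t) * (d n * (x - t) ^ n)) sums ((x - t) * g x)"
        using sums_mult[OF sums[OF that], of "x - t"] by simp
      then have "(\<lambda>n. a (Suc n) * (x - t) ^ Suc n) sums ((x - t) * g x)"
        by (simp add: a_def mult_ac)
      then show ?thesis
        using sums_Suc_iff[of "\<lambda>n. a n * (x - t) ^ n" "(x - t) * g x"] by (simp add: a_def)
    qed
    obtain s where "0 < s" and s: "\<And>z. z \<in> cball t s - {t} \<Longrightarrow> (z - t) * g z \<noteq> 0"
      by (rule powser_0_nonzero[OF \<open>r > 0\<close> a_sums, where m = "Suc m"]) (auto simp: a_def m)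
    have "g x \<noteq> 0" if "x \<noteq> t" "dist x t < s" for x
      using s[of x] that by (auto simp: dist_commute)
    then show ?thesis
      unfolding eventually_at using \<open>s > 0\<close> by blast
  qed
qed

text \<open>The points near which \<open>g\<close> vanishes and the points with a zero-free
  punctured neighbourhood form two disjoint open sets that cover \<open>I\<close>; connectedness
  leaves only one of them.\<close>

lemma power_series_zeros_sparse:
  fixes g :: "real \<Rightarrow> real"
  assumes "open I" "connected I" and g: "\<And>t. t \<in> I \<Longrightarrow> has_power_series_at g t"
  shows "(\<forall>t\<in>I. g t = 0) \<or> {t. g t = 0} sparse_in I"
proof -
  define U where "U = {t\<in>I. \<forall>\<^sub>F x in nhds t. g x = 0}"
  define V where "V = {t\<in>I. \<forall>\<^sub>F x in at t. g x \<noteq> 0}"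
  have "U = I \<inter> {t. \<forall>\<^sub>F x in nhds t. g x = 0}" by (auto simp: U_def)
  also have "open \<dots>"
    using \<open>open I\<close> by (intro open_Int open_Collect_eventually_nhds)
  finally have "open U" .
  \<comment> \<open>In a neighbourhood \<open>B\<close> of \<open>t\<close> without zeros other than
    possibly \<open>t\<close>, every other point has the zero-free neighbourhood
    \<open>B - {t}\<close>. This gives both the openness of \<open>V\<close> and the neighbourhoods
    that sparseness asks for.\<close>
  have V_nbhd: "\<exists>B. open B \<and> t \<in> B \<and> (\<forall>y\<in>B. \<forall>\<^sub>F x in at y. g x \<noteq> 0)" if "t \<in> V" for t
  proof -
    from that obtain B where B: "open B" "t \<in> B" "\<And>x. x \<in> B \<Longrightarrow> x \<noteq> t \<Longrightarrow> g x \<noteq> 0"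
      unfolding V_def eventually_at_topological by blast
    have "\<forall>\<^sub>F x in at y. g x \<noteq> 0" if "y \<in> B" for y
    proof (cases "y = t")
      case True
      with B show ?thesis unfolding eventually_at_topological by blast
    next
      case False
      have "open (B - {t})" "y \<in> B - {t}" using B(1) False that by auto
      with B(3) show ?thesis unfolding eventually_at_topological by blast
    qed
    with B show ?thesis by blast
  qed
  have "open V"
  proof (subst open_subopen, intro ballI)
    fix t assume "t \<in> V"
    then obtain B where "open B" "t \<in> B" "\<forall>y\<in>B. \<forall>\<^sub>F x in at y. g x \<noteq> 0"
      using V_nbhd by blast
    then show "\<exists>T. open T \<and> t \<in> T \<and> T \<subseteq> V"
      using \<open>t \<in> V\<close> \<open>open I\<close> by (intro exI[of _ "B \<inter> I"]) (auto simp: V_def)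
  qed
  have "I \<subseteq> U \<union> V"
    using has_power_series_at_real_zeros[OF g] by (auto simp: U_def V_def)
  moreover have "U \<inter> V \<inter> I = {}"
  proof -
    have False if "\<forall>\<^sub>F x in nhds t. g x = 0" "\<forall>\<^sub>F x in at t. g x \<noteq> 0" for t
    proof -
      have "\<forall>\<^sub>F x in at t. g x = 0"
        using that(1) by (simp add: eventually_at_filter eventually_mono)
      with that(2) have "\<forall>\<^sub>F x in at t. False"
        by eventually_elim simp
      then show False by simp
    qed
    then show ?thesis by (auto simp: U_def V_def)
  qed
  ultimately have "U \<inter> I = {} \<or> V \<inter> I = {}"
    using connectedD[OF \<open>connected I\<close> \<open>open U\<close> \<open>open V\<close>] by blast
  then show ?thesis
  proof
    assume "V \<inter> I = {}"
    then have "I \<subseteq> U" using \<open>I \<subseteq> U \<union> V\<close> by blast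
    then show ?thesis by (auto simp: U_def dest: eventually_nhds_x_imp_x)
  next
    assume "U \<inter> I = {}"
    then have "I \<subseteq> V" using \<open>I \<subseteq> U \<union> V\<close> by blast
    have "{t. g t = 0} sparse_in I"
      unfolding sparse_in_def
    proof
      fix x assume "x \<in> I"
      then obtain B where "open B" "x \<in> B" "\<forall>y\<in>B. \<forall>\<^sub>F x in at y. g x \<noteq> 0"
        using V_nbhd \<open>I \<subseteq> V\<close> by blast
      then show "\<exists>B. x \<in> B \<and> open B \<and> (\<forall>y\<in>B. \<not> y islimpt {t. g t = 0})"
        by (intro exI[of _ B]) (auto simp: islimpt_iff_eventually)
    qed
    then show ?thesis ..
  qed
qed

lemma has_power_series_at_line:
  assumes "has_power_series_at f (p + t *\<^sub>R v)"
  shows "has_power_series_at (\<lambda>t. f (p + t *\<^sub>R v)) t"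
proof (rule has_power_series_at_subst[where L = "\<lambda>t. t *\<^sub>R v" and \<gamma> = "\<lambda>b. v \<bullet> b" and \<sigma> = "\<lambda>_. 1"])
  show "bounded_linear (\<lambda>t. t *\<^sub>R v)" by (rule bounded_linear_scaleR_left)
qed (use assms in simp_all)

lemma line_preimage_open_convex:
  fixes p v :: "'a::real_normed_vector"
  assumes "open S" "convex S"
  shows "open {t. p + t *\<^sub>R v \<in> S}" "connected {t. p + t *\<^sub>R v \<in> S}"
proof -
  have "continuous_on UNIV (\<lambda>t. p + t *\<^sub>R v)"
    by (intro continuous_intros)
  with \<open>open S\<close> show "open {t. p + t *\<^sub>R v \<in> S}"
    by (auto simp: continuous_on_open_vimage vimage_def)
  have "convex {t. p + t *\<^sub>R v \<in> S}"
  proof (rule convexI)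
    fix x y u w :: real
    assume xy: "x \<in> {t. p + t *\<^sub>R v \<in> S}" "y \<in> {t. p + t *\<^sub>R v \<in> S}" and uw: "0 \<le> u" "0 \<le> w" "u + w = 1"
    then have "u *\<^sub>R (p + x *\<^sub>R v) + w *\<^sub>R (p + y *\<^sub>R v) \<in> S"
      using \<open>convex S\<close> by (auto simp: convex_def)
    also have "u *\<^sub>R (p + x *\<^sub>R v) + w *\<^sub>R (p + y *\<^sub>R v) = (u + w) *\<^sub>R p + (u * x + w * y) *\<^sub>R v"
      by (simp add: algebra_simps)
    finally show "u *\<^sub>R x + w *\<^sub>R y \<in> {t. p + t *\<^sub>R v \<in> S}"
      using uw by simp
  qed
  then show "connected {t. p + t *\<^sub>R v \<in> S}" by (rule convex_connected)
qed

text \<open>Every ray from \<open>p\<close> meets the zero set in countably many points, so the zero set is null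
  by Fubini's theorem on \<open>\<real> \<times> T\<close>, applied to the points \<open>(t, y)\<close> with \<open>f (p + t y) = 0\<close>.\<close>

lemma negligible_zeros_convex:
  fixes f :: "'a::euclidean_space \<Rightarrow> real"
  assumes "open S" "convex S" and cont: "continuous_on S f"
    and ps: "\<And>x. x \<in> S \<Longrightarrow> has_power_series_at f x" and "p \<in> S" "f p \<noteq> 0"
  shows "negligible {x\<in>S. f x = 0}"
proof -
  define T where "T = {y. p + y \<in> S}"
  define Z where "Z = {y\<in>T. f (p + y) = 0}"
  have "T = (\<lambda>y. p + y) -` S" by (auto simp: T_def)
  then have "open T"
    using \<open>open S\<close> by (auto intro!: continuous_open_vimage continuous_intros)
  have "continuous_on T (\<lambda>y. f (p + y))"
    by (rule continuous_on_compose2[OF cont]) (auto simp: T_def intro!: continuous_intros)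
  then have "closedin (top_of_set T) Z"
    unfolding Z_def by (intro continuous_closedin_preimage_constant)
  then obtain C where "closed C" "Z = C \<inter> T"
    by (metis Int_commute closedin_closed)
  then have [measurable]: "Z \<in> sets borel" "T \<in> sets borel"
    using \<open>open T\<close> by auto
  define h :: "real \<times> 'a \<Rightarrow> ennreal" where
    "h = (\<lambda>(t, y). indicator {0<..<1} t * (indicator T y * indicator Z (t *\<^sub>R y)))"
  have [measurable]: "h \<in> borel_measurable (borel \<Otimes>\<^sub>M borel)"
    unfolding h_def by measurable
  have null: "(\<integral>\<^sup>+ t. h (t, y) \<partial>lborel) = 0" for y
  proof (cases "y \<in> T")
    case False
    then show ?thesis by (simp add: h_def)
  next
    case True
    define I where "I = {t. p + t *\<^sub>R y \<in> S}"
    \<comment> \<open>The parameter \<open>0\<close> corresponds to \<open>p\<close>, where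
      \<open>f\<close> does not vanish; this excludes the first alternative on every line through
      \<open>p\<close>.\<close>
    have "\<not> (\<forall>t\<in>I. f (p + t *\<^sub>R y) = 0)"
      using \<open>f p \<noteq> 0\<close> \<open>p \<in> S\<close> by (auto simp: I_def intro!: exI[of _ 0])
    moreover have I: "open I" "connected I"
      using line_preimage_open_convex[OF \<open>open S\<close> \<open>convex S\<close>] by (auto simp: I_def)
    ultimately have "{t. f (p + t *\<^sub>R y) = 0} sparse_in I"
      using power_series_zeros_sparse[of I "\<lambda>t. f (p + t *\<^sub>R y)"] ps
      by (auto simp: I_def intro: has_power_series_at_line)
    then have "countable (I \<inter> {t. f (p + t *\<^sub>R y) = 0})"
      by (rule sparse_imp_countable[OF I(1)])
    then have "AE t in lborel. t \<notin> I \<inter> {t. f (p + t *\<^sub>R y) = 0}"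
      by (intro AE_not_in countable_imp_null_set_lborel)
    then have "AE t in lborel. h (t, y) = 0"
      by eventually_elim (auto simp: h_def I_def Z_def T_def indicator_def)
    then show ?thesis
      by (subst nn_integral_0_iff_AE) auto
  qed
  have "(\<integral>\<^sup>+ t. (\<integral>\<^sup>+ y. h (t, y) \<partial>lborel) \<partial>lborel) = (\<integral>\<^sup>+ y. (\<integral>\<^sup>+ t. h (t, y) \<partial>lborel) \<partial>lborel)"
    by (rule lborel_pair.Fubini') auto
  then have "(\<integral>\<^sup>+ t. (\<integral>\<^sup>+ y. h (t, y) \<partial>lborel) \<partial>lborel) = 0"
    by (simp add: null)
  then have "AE t in lborel. (\<integral>\<^sup>+ y. h (t, y) \<partial>lborel) = 0"
    by (subst (asm) nn_integral_0_iff_AE) auto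
  then have AE: "AE t in lborel. 0 < t \<and> t < 1 \<longrightarrow> negligible {y\<in>T. t *\<^sub>R y \<in> Z}"
  proof eventually_elim
    fix t :: real assume *: "(\<integral>\<^sup>+ y. h (t, y) \<partial>lborel) = 0"
    show "0 < t \<and> t < 1 \<longrightarrow> negligible {y\<in>T. t *\<^sub>R y \<in> Z}"
    proof
      assume t: "0 < t \<and> t < 1"
      have "AE y in lborel. h (t, y) = 0"
        using * by (subst (asm) nn_integral_0_iff_AE) auto
      then have "AE y in lborel. y \<notin> {y\<in>T. t *\<^sub>R y \<in> Z}"
        by eventually_elim (use t in \<open>auto simp: h_def indicator_def split: if_splits\<close>)
      moreover have "{y\<in>T. t *\<^sub>R y \<in> Z} \<in> sets lborel"
        by measurable
      ultimately have "{y\<in>T. t *\<^sub>R y \<in> Z} \<in> null_sets lborel"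
        by (simp add: AE_iff_null_sets)
      then show "negligible {y\<in>T. t *\<^sub>R y \<in> Z}"
        by (simp add: negligible_iff_null_sets null_sets_completionI)
    qed
  qed
  \<comment> \<open>Fubini controls \<open>{y\<in>T. t *\<^sub>R y \<in> Z}\<close> only for almost
    every \<open>t\<close>. The dilation by \<open>t\<close> maps this set onto the part of
    \<open>Z\<close> inside the dilated copy of \<open>T\<close>, and since \<open>T\<close> is open
    that copy contains a given \<open>z\<close> once \<open>t\<close> is close enough to 1. Hence
    \<open>Z\<close> is locally null.\<close>
  have "negligible Z"
  proof (rule locally_negligible_alt[THEN iffD2], rule ballI)
    fix z assume "z \<in> Z"
    then have "z \<in> T" by (simp add: Z_def)
    have "((\<lambda>t. inverse t *\<^sub>R z) \<longlongrightarrow> inverse 1 *\<^sub>R z) (at_left 1)"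
      by (intro tendsto_scaleR tendsto_inverse tendsto_const tendsto_ident_at) simp
    then have "\<forall>\<^sub>F t in at_left (1::real). inverse t *\<^sub>R z \<in> T"
      using topological_tendstoD[OF _ \<open>open T\<close>] \<open>z \<in> T\<close> by (simp only: inverse_1 scaleR_one)
    then obtain b where b: "b < 1" "\<And>t. b < t \<Longrightarrow> t < 1 \<Longrightarrow> inverse t *\<^sub>R z \<in> T"
      unfolding eventually_at_left_field by blast
    define b' where "b' = max b 0"
    have "\<exists>t\<in>{b'<..<1}. 0 < t \<and> t < 1 \<longrightarrow> negligible {y\<in>T. t *\<^sub>R y \<in> Z}"
    proof (rule ccontr)
      assume "\<not> ?thesis"
      with AE have "AE t in lborel. t \<notin> {b'<..<1}"
        by (auto elim: eventually_mono)
      then have "{b'<..<1} \<in> null_sets lborel"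
        by (simp add: AE_iff_null_sets)
      then show False using \<open>b < 1\<close> by (auto simp: null_sets_def b'_def)
    qed
    then obtain t where t: "b < t" "0 < t" "t < 1" and neg: "negligible {y\<in>T. t *\<^sub>R y \<in> Z}"
      by (auto simp: b'_def)
    have eq: "(\<lambda>y. t *\<^sub>R y) ` {y\<in>T. t *\<^sub>R y \<in> Z} = Z \<inter> (\<lambda>z. inverse t *\<^sub>R z) -` T"
    proof (intro set_eqI iffI)
      fix x assume "x \<in> Z \<inter> (\<lambda>z. inverse t *\<^sub>R z) -` T"
      then have "x = t *\<^sub>R (inverse t *\<^sub>R x)" "inverse t *\<^sub>R x \<in> {y\<in>T. t *\<^sub>R y \<in> Z}"
        using t by auto
      then show "x \<in> (\<lambda>y. t *\<^sub>R y) ` {y\<in>T. t *\<^sub>R y \<in> Z}" by (rule image_eqI)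
    qed (use t in auto)
    have "negligible ((\<lambda>y. t *\<^sub>R y) ` {y\<in>T. t *\<^sub>R y \<in> Z})"
      by (rule negligible_differentiable_image_negligible[OF order_refl neg])
        (auto simp: differentiable_on_def)
    moreover have "open ((\<lambda>z. inverse t *\<^sub>R z) -` T)"
      using \<open>open T\<close> by (auto intro!: continuous_open_vimage continuous_intros)
    ultimately show "\<exists>U. openin (top_of_set Z) U \<and> z \<in> U \<and> negligible U"
      using \<open>z \<in> Z\<close> b(2)[OF t(1,3)] eq by (intro exI[of _ "Z \<inter> (\<lambda>z. inverse t *\<^sub>R z) -` T"]) auto
  qed
  then have "negligible ((+) p ` Z)"
    by (rule negligible_translation)
  also have "(+) p ` Z = {x\<in>S. f x = 0}"
  proof (intro set_eqI iffI)
    fix x assume "x \<in> {x\<in>S. f x = 0}"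
    then have "x = p + (x - p)" "x - p \<in> Z" by (auto simp: Z_def T_def)
    then show "x \<in> (+) p ` Z" by (rule image_eqI)
  qed (auto simp: Z_def T_def)
  finally show ?thesis .
qed

text \<open>The interior \<open>N\<close> of the zero set is also relatively closed: a ball inside
  \<open>S\<close> that meets \<open>N\<close> lies in \<open>N\<close>. So \<open>N\<close> is
  empty, every small ball contains a point where \<open>f\<close> is non-zero, and the convex case
  applies locally.\<close>

lemma negligible_zeros:
  fixes f :: "'a::euclidean_space \<Rightarrow> real"
  assumes "open S" "connected S" and cont: "continuous_on S f"
    and ps: "\<And>x. x \<in> S \<Longrightarrow> has_power_series_at f x" and "p \<in> S" "f p \<noteq> 0"
  shows "negligible {x\<in>S. f x = 0}"
proof -
  define N where "N = {a\<in>S. \<forall>\<^sub>F x in nhds a. f x = 0}"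
  have "N = S \<inter> {a. \<forall>\<^sub>F x in nhds a. f x = 0}" by (auto simp: N_def)
  also have "open \<dots>"
    using \<open>open S\<close> by (intro open_Int open_Collect_eventually_nhds)
  finally have "open N" .
  \<comment> \<open>Vanishing near \<open>q\<close> spreads along the line from \<open>q\<close> to
    \<open>y\<close>: the parameter \<open>0\<close> is a limit point of zeros, which contradicts
    sparseness.\<close>
  have ball_zero: "f y = 0" if "ball a r \<subseteq> S" "q \<in> ball a r" "q \<in> N" "y \<in> ball a r" for a r q y
  proof -
    define I where "I = {t. q + t *\<^sub>R (y - q) \<in> ball a r}"
    have I: "open I" "connected I"
      using line_preimage_open_convex[OF open_ball convex_ball] by (auto simp: I_def)
    have "0 \<in> I" "1 \<in> I" using that by (auto simp: I_def)
    have "((\<lambda>t. q + t *\<^sub>R (y - q)) \<longlongrightarrow> q + 0 *\<^sub>R (y - q)) (at 0)"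
      by (intro tendsto_intros)
    then have "filterlim (\<lambda>t. q + t *\<^sub>R (y - q)) (nhds q) (at 0)"
      by simp
    moreover have "\<forall>\<^sub>F x in nhds q. f x = 0" using that by (simp add: N_def)
    ultimately have "\<forall>\<^sub>F t in at 0. f (q + t *\<^sub>R (y - q)) = 0"
      using eventually_compose_filterlim by blast
    then have "\<exists>\<^sub>F t in at 0. f (q + t *\<^sub>R (y - q)) = 0"
      by (intro eventually_frequently) simp
    then have "0 islimpt {t. f (q + t *\<^sub>R (y - q)) = 0}"
      by (simp add: islimpt_iff_eventually frequently_def)
    then have "\<not> {t. f (q + t *\<^sub>R (y - q)) = 0} sparse_in I"
      using \<open>0 \<in> I\<close> by (auto simp: sparse_in_def)
    moreover have "has_power_series_at (\<lambda>t. f (q + t *\<^sub>R (y - q))) t" if "t \<in> I" for t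
      using that \<open>ball a r \<subseteq> S\<close> by (intro has_power_series_at_line ps) (auto simp: I_def)
    ultimately have "\<forall>t\<in>I. f (q + t *\<^sub>R (y - q)) = 0"
      using power_series_zeros_sparse[OF I, of "\<lambda>t. f (q + t *\<^sub>R (y - q))"] by blast
    from bspec[OF this \<open>1 \<in> I\<close>] show ?thesis by simp
  qed
  have N_ball: "ball a r \<subseteq> N" if "ball a r \<subseteq> S" "ball a r \<inter> N \<noteq> {}" for a r
  proof
    fix x assume x: "x \<in> ball a r"
    have "\<forall>\<^sub>F x in nhds x. x \<in> ball a r"
      using x by (intro eventually_nhds_in_open) auto
    then have "\<forall>\<^sub>F x in nhds x. f x = 0"
      using that ball_zero by (auto elim!: eventually_mono)
    with x that show "x \<in> N" by (auto simp: N_def)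
  qed
  have "open (S - N)"
    unfolding open_contains_ball
  proof
    fix a assume a: "a \<in> S - N"
    then obtain r where "r > 0" "ball a r \<subseteq> S"
      using \<open>open S\<close> open_contains_ball by blast
    moreover have "a \<in> ball a r" using \<open>r > 0\<close> by simp
    ultimately show "\<exists>r>0. ball a r \<subseteq> S - N"
      using N_ball[of a r] a by blast
  qed
  moreover have "p \<notin> N"
    using \<open>f p \<noteq> 0\<close> by (auto simp: N_def dest: eventually_nhds_x_imp_x)
  ultimately have "N = {}"
    using connectedD[OF \<open>connected S\<close> \<open>open N\<close>, of "S - N"] \<open>p \<in> S\<close> by (auto simp: N_def)
  show ?thesis
  proof (rule locally_negligible_alt[THEN iffD2], rule ballI)
    fix a assume a: "a \<in> {x\<in>S. f x = 0}"
    then obtain r where r: "r > 0" "ball a r \<subseteq> S"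
      using \<open>open S\<close> open_contains_ball by blast
    have "\<exists>q\<in>ball a r. f q \<noteq> 0"
    proof (rule ccontr)
      assume "\<not> ?thesis"
      moreover have "\<forall>\<^sub>F x in nhds a. x \<in> ball a r"
        using r by (intro eventually_nhds_in_open) auto
      ultimately have "a \<in> N"
        using a by (auto simp: N_def elim: eventually_mono)
      with \<open>N = {}\<close> show False by simp
    qed
    then obtain q where "q \<in> ball a r" "f q \<noteq> 0" by blast
    with r have "negligible {x\<in>ball a r. f x = 0}"
      by (intro negligible_zeros_convex[where p = q]) (auto intro: continuous_on_subset[OF cont] ps)
    moreover have "{x\<in>ball a r. f x = 0} = {x\<in>S. f x = 0} \<inter> ball a r"
      using r by auto
    ultimately show "\<exists>U. openin (top_of_set {x\<in>S. f x = 0}) U \<and> a \<in> U \<and> negligible U"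
      using a r by (intro exI[of _ "{x\<in>S. f x = 0} \<inter> ball a r"]) auto
  qed
qed

section \<open>Smooth radial cutoffs\<close>

text \<open>The derivatives of \<open>exp (- 1 / x)\<close>, extended by zero to the left, all have
  this form; the polynomial parameter makes the family closed under differentiation.\<close>

definition flat_exp :: "real poly \<Rightarrow> real \<Rightarrow> real" where
  "flat_exp q x = (if x \<le> 0 then 0 else poly q (1 / x) * exp (- (1 / x)))"

lemma tendsto_poly_exp_neg: "((\<lambda>y. poly q y * exp (- y)) \<longlongrightarrow> (0::real)) at_top"
proof -
  have "((\<lambda>y. \<Sum>i\<le>degree q. coeff q i * (y ^ i / exp y)) \<longlongrightarrow> (\<Sum>i\<le>degree q. coeff q i * 0)) at_top"
    by (intro tendsto_intros tendsto_power_div_exp_0)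
  moreover have "(\<lambda>y. \<Sum>i\<le>degree q. coeff q i * (y ^ i / exp y)) = (\<lambda>y. poly q y * exp (- y))"
    by (simp add: fun_eq_iff poly_altdef sum_distrib_right exp_minus divide_inverse mult.assoc)
  ultimately show ?thesis by simp
qed

text \<open>With \<open>y = 1 / x\<close>, differentiation in \<open>x\<close> is
  \<open>- y\<^sup>2\<close> times differentiation in \<open>y\<close>, which turns \<open>q\<close>
  into \<open>y\<^sup>2 * (q - q')\<close>; the polynomial \<open>[:0, 0, 1:]\<close> is
  \<open>y\<^sup>2\<close>. At the origin exponential decay beats every polynomial in
  \<open>y\<close>.\<close>

lemma DERIV_flat_exp:
  "(flat_exp q has_real_derivative flat_exp ([:0, 0, 1:] * (q - pderiv q)) x) (at x)"
proof (cases x "0::real" rule: linorder_cases)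
  case less
  have "(flat_exp q has_real_derivative 0) (at x) \<longleftrightarrow> ((\<lambda>_. 0) has_real_derivative 0) (at x)"
  proof (rule DERIV_cong_ev)
    have "\<forall>\<^sub>F y in nhds x. y \<in> {..<0}"
      using less by (intro eventually_nhds_in_open) auto
    then show "\<forall>\<^sub>F y in nhds x. flat_exp q y = 0"
      by eventually_elim (simp add: flat_exp_def)
  qed auto
  with less show ?thesis by (simp add: flat_exp_def)
next
  case greater
  have "((\<lambda>x. poly q (1 / x) * exp (- (1 / x))) has_real_derivative
      flat_exp ([:0, 0, 1:] * (q - pderiv q)) x) (at x)"
    using greater
    by (auto intro!: derivative_eq_intros simp: flat_exp_def field_simps power2_eq_square)
  moreover have "(flat_exp q has_real_derivative D) (at x) \<longleftrightarrow>
      ((\<lambda>x. poly q (1 / x) * exp (- (1 / x))) has_real_derivative D) (at x)" for D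
  proof (rule DERIV_cong_ev)
    have "\<forall>\<^sub>F y in nhds x. y \<in> {0<..}"
      using greater by (intro eventually_nhds_in_open) auto
    then show "\<forall>\<^sub>F y in nhds x. flat_exp q y = poly q (1 / y) * exp (- (1 / y))"
      by eventually_elim (simp add: flat_exp_def)
  qed auto
  ultimately show ?thesis by simp
next
  case equal
  have "((\<lambda>h. poly ([:0, 1:] * q) (inverse h) * exp (- inverse h)) \<longlongrightarrow> 0) (at_right 0)"
    by (rule filterlim_compose[OF tendsto_poly_exp_neg filterlim_inverse_at_top_right])
  then have "((\<lambda>h. (flat_exp q (0 + h) - flat_exp q 0) / h) \<longlongrightarrow> 0) (at_right 0)"
  proof (rule Lim_transform_eventually)
    show "\<forall>\<^sub>F h in at_right 0. poly ([:0, 1:] * q) (inverse h) * exp (- inverse h) =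
        (flat_exp q (0 + h) - flat_exp q 0) / h"
      using eventually_at_right_less[of "0::real"]
      by eventually_elim (simp add: flat_exp_def field_simps)
  qed
  moreover have "((\<lambda>h. (flat_exp q (0 + h) - flat_exp q 0) / h) \<longlongrightarrow> 0) (at_left 0)"
  proof (rule tendsto_eventually)
    show "\<forall>\<^sub>F h in at_left 0. (flat_exp q (0 + h) - flat_exp q 0) / h = 0"
      using eventually_at_left_field[of _ "0::real"]
      by (auto simp: flat_exp_def intro!: exI[of _ "-1"])
  qed
  ultimately have "((\<lambda>h. (flat_exp q (0 + h) - flat_exp q 0) / h) \<longlongrightarrow> 0) (at 0)"
    by (simp add: filterlim_split_at)
  with equal show ?thesis by (simp add: DERIV_def flat_exp_def)
qed

text \<open>\<open>cutoff n\<close> is the \<open>n\<close>-th derivative of the function \<open>exp (- 1 / (1 - s))\<close> cut off at \<open>s \<ge> 1\<close>.\<close>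

definition cutoff :: "nat \<Rightarrow> real \<Rightarrow> real" where
  "cutoff n s = (-1) ^ n * flat_exp (((\<lambda>q. [:0, 0, 1:] * (q - pderiv q)) ^^ n) 1) (1 - s)"

lemma DERIV_cutoff: "(cutoff n has_real_derivative cutoff (Suc n) s) (at s)"
proof -
  have "((\<lambda>s. (-1) ^ n * flat_exp q (1 - s)) has_real_derivative
      (-1) ^ n * (flat_exp ([:0, 0, 1:] * (q - pderiv q)) (1 - s) * (0 - 1))) (at s)" for q
    by (intro DERIV_cmult DERIV_chain2[OF DERIV_flat_exp] DERIV_diff DERIV_const DERIV_ident)
  from this[of "((\<lambda>q. [:0, 0, 1:] * (q - pderiv q)) ^^ n) 1"]
  show ?thesis by (simp add: cutoff_def[abs_def] del: mult_pCons_left)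
qed

lemma cutoff_eq_0: "1 \<le> s \<Longrightarrow> cutoff n s = 0"
  by (simp add: cutoff_def flat_exp_def)

text \<open>The strict sign is what later gives the averaging kernel a non-zero mass.\<close>

lemma cutoff_1_neg: "s < 1 \<Longrightarrow> cutoff 1 s < 0"
  by (simp add: cutoff_def flat_exp_def)

lemma continuous_on_cutoff [continuous_intros]:
  "continuous_on S f \<Longrightarrow> continuous_on S (\<lambda>x. cutoff n (f x))"
  by (rule continuous_on_compose2[of UNIV "cutoff n"])
    (auto intro: DERIV_isCont[OF DERIV_cutoff] continuous_at_imp_continuous_on)

text \<open>An algebra of functions that contains the radial cutoffs and is closed under partial
  derivatives; its members are therefore smooth.\<close>

inductive_set cutoff_algebra :: "real \<Rightarrow> real \<Rightarrow> 'a::euclidean_space \<Rightarrow> ('a \<Rightarrow> real) set"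
  for c d x where
  const: "(\<lambda>_. k) \<in> cutoff_algebra c d x"
| coord: "(\<lambda>y. (y - x) \<bullet> b) \<in> cutoff_algebra c d x"
| radial: "(\<lambda>y. cutoff n (c + d * ((y - x) \<bullet> (y - x)))) \<in> cutoff_algebra c d x"
| add: "f \<in> cutoff_algebra c d x \<Longrightarrow> g \<in> cutoff_algebra c d x \<Longrightarrow> (\<lambda>y. f y + g y) \<in> cutoff_algebra c d x"
| mult: "f \<in> cutoff_algebra c d x \<Longrightarrow> g \<in> cutoff_algebra c d x \<Longrightarrow> (\<lambda>y. f y * g y) \<in> cutoff_algebra c d x"

lemma has_derivative_radial_cutoff:
  "((\<lambda>y. cutoff n (c + d * ((y - x) \<bullet> (y - x)))) has_derivative
     (\<lambda>v. cutoff (Suc n) (c + d * ((y - x) \<bullet> (y - x))) * (2 * d * ((y - x) \<bullet> v)))) (at y)"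
proof -
  have "((\<lambda>y. c + d * ((y - x) \<bullet> (y - x))) has_derivative (\<lambda>v. 2 * d * ((y - x) \<bullet> v))) (at y)"
    by (auto intro!: derivative_eq_intros simp: fun_eq_iff inner_commute)
  from has_derivative_compose[OF this DERIV_cutoff[unfolded has_field_derivative_def]]
  show ?thesis by simp
qed

lemma cutoff_algebra_derivative:
  assumes "f \<in> cutoff_algebra c d x"
  shows "\<exists>f'. (\<forall>y. (f has_derivative f' y) (at y)) \<and> (\<forall>b. (\<lambda>y. f' y b) \<in> cutoff_algebra c d x)"
  using assms
proof induction
  case (const k)
  show ?case
    by (rule exI[of _ "\<lambda>_ _. 0"]) (auto intro: cutoff_algebra.const)
next
  case (coord b)
  show ?case
    by (rule exI[of _ "\<lambda>_ v. v \<bullet> b"]) (auto intro!: derivative_eq_intros cutoff_algebra.const)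
next
  case (radial n)
  show ?case
    by (rule exI[of _ "\<lambda>y v. cutoff (Suc n) (c + d * ((y - x) \<bullet> (y - x))) * (2 * d * ((y - x) \<bullet> v))"])
      (auto intro!: has_derivative_radial_cutoff cutoff_algebra.intros)
next
  case (add f g)
  then obtain f' g' where "\<forall>y. (f has_derivative f' y) (at y)" "\<forall>b. (\<lambda>y. f' y b) \<in> cutoff_algebra c d x"
    "\<forall>y. (g has_derivative g' y) (at y)" "\<forall>b. (\<lambda>y. g' y b) \<in> cutoff_algebra c d x"
    by blast
  then show ?case
    by (intro exI[of _ "\<lambda>y v. f' y v + g' y v"]) (auto intro!: has_derivative_add cutoff_algebra.add)
next
  case (mult f g)
  then obtain f' g' where "\<forall>y. (f has_derivative f' y) (at y)" "\<forall>b. (\<lambda>y. f' y b) \<in> cutoff_algebra c d x"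
    "\<forall>y. (g has_derivative g' y) (at y)" "\<forall>b. (\<lambda>y. g' y b) \<in> cutoff_algebra c d x"
    by blast
  with mult.hyps show ?case
    by (intro exI[of _ "\<lambda>y v. f y * g' y v + f' y v * g y"])
      (auto intro!: has_derivative_mult cutoff_algebra.add cutoff_algebra.mult)
qed

lemma Ck_on_cutoff_algebra: "f \<in> cutoff_algebra c d x \<Longrightarrow> Ck_on k UNIV f"
proof (induction k arbitrary: f)
  case 0
  from cutoff_algebra_derivative[OF this] show ?case
    by (auto intro!: continuous_at_imp_continuous_on dest: has_derivative_continuous)
next
  case (Suc k)
  from cutoff_algebra_derivative[OF Suc.prems] obtain f' where
    f': "\<And>y. (f has_derivative f' y) (at y)" "\<And>b. (\<lambda>y. f' y b) \<in> cutoff_algebra c d x" by blast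
  have "frechet_derivative f (at y) = f' y" for y
    using frechet_derivative_at[OF f'(1)] by simp
  with f' Suc.IH show ?case
    by (auto simp: differentiable_def)
qed

lemma test_functionI:
  assumes "\<And>k. Ck_on k UNIV \<psi>" "\<And>y. y \<notin> cball x r \<Longrightarrow> \<psi> y = 0" "cball x r \<subseteq> \<Omega>"
  shows "test_function \<Omega> \<psi>"
proof -
  have sub: "{y. \<psi> y \<noteq> 0} \<subseteq> cball x r"
    using assms(2) by blast
  have "bounded {y. \<psi> y \<noteq> 0}" "closure {y. \<psi> y \<noteq> 0} \<subseteq> cball x r"
    by (rule bounded_subset[OF bounded_cball sub], rule closure_minimal[OF sub closed_cball])
  with assms(1,3) show ?thesis
    by (auto simp: test_function_def compact_closure)
qed

text \<open>The summand \<open>c\<close> is there because the slices at constant last coordinate of a radial function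
  in one dimension more are of this form.\<close>

definition radial_test :: "real \<Rightarrow> real \<Rightarrow> 'a::euclidean_space \<Rightarrow> 'a \<Rightarrow> real" where
  "radial_test c d x y = cutoff 0 (c + d * ((y - x) \<bullet> (y - x)))"

definition radial_test' :: "real \<Rightarrow> real \<Rightarrow> 'a::euclidean_space \<Rightarrow> 'a \<Rightarrow> 'a \<Rightarrow> real" where
  "radial_test' c d x b y = cutoff 1 (c + d * ((y - x) \<bullet> (y - x))) * (2 * d * ((y - x) \<bullet> b))"

text \<open>Written out rather than as an iterated Frechet derivative, so that continuity in the
  offset and the point, and the behaviour on slices of a product space, can be read off from the
  formula.\<close>

definition radial_test'' :: "real \<Rightarrow> real \<Rightarrow> 'a::euclidean_space \<Rightarrow> 'a \<Rightarrow> 'a \<Rightarrow> real" where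
  "radial_test'' c d x b y =
     cutoff 2 (c + d * ((y - x) \<bullet> (y - x))) * (2 * d * ((y - x) \<bullet> b))\<^sup>2 +
     cutoff 1 (c + d * ((y - x) \<bullet> (y - x))) * (2 * d * (b \<bullet> b))"

lemma frechet_derivative_radial_test:
  "frechet_derivative (radial_test c d x) (at y) b = radial_test' c d x b y"
  using frechet_derivative_at[OF has_derivative_radial_cutoff[of 0 c d x y]]
  by (simp add: radial_test_def[abs_def] radial_test'_def fun_eq_iff)

lemma frechet_derivative_radial_test':
  "frechet_derivative (radial_test' c d x b) (at y) b = radial_test'' c d x b y"
proof -
  have "(radial_test' c d x b has_derivative (\<lambda>v.
      cutoff 1 (c + d * ((y - x) \<bullet> (y - x))) * (2 * d * (v \<bullet> b)) +
      cutoff (Suc 1) (c + d * ((y - x) \<bullet> (y - x))) * (2 * d * ((y - x) \<bullet> v)) * (2 * d * ((y - x) \<bullet> b)))) (at y)"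
    unfolding radial_test'_def[abs_def]
    by (rule has_derivative_mult[OF has_derivative_radial_cutoff]) (auto intro!: derivative_eq_intros)
  from frechet_derivative_at[OF this, symmetric] show ?thesis
    by (simp add: radial_test''_def power2_eq_square numeral_2_eq_2)
qed

text \<open>Since \<open>c \<ge> 0\<close>, the argument of the profile is at least 1 outside the
  ball. Both functions are needed because the weak gradient and the weak Hessian are used in two
  successive integrations by parts.\<close>

lemma test_function_radial_test:
  assumes "0 \<le> c" "0 < r" "cball x r \<subseteq> \<Omega>"
  shows "test_function \<Omega> (radial_test c (1 / r\<^sup>2) x)" "test_function \<Omega> (radial_test' c (1 / r\<^sup>2) x b)"
proof -
  have ge1: "c + 1 / r\<^sup>2 * ((y - x) \<bullet> (y - x)) \<ge> 1" if "y \<notin> cball x r" for y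
  proof -
    have "r\<^sup>2 \<le> (norm (y - x))\<^sup>2"
      using that \<open>0 < r\<close> by (intro power_mono) (auto simp: dist_norm norm_minus_commute)
    then show ?thesis
      using \<open>0 \<le> c\<close> \<open>0 < r\<close> by (auto simp: power2_norm_eq_inner field_simps intro: add_increasing)
  qed
  show "test_function \<Omega> (radial_test c (1 / r\<^sup>2) x)"
  proof (rule test_functionI[OF _ _ assms(3)])
    show "Ck_on k UNIV (radial_test c (1 / r\<^sup>2) x)" for k
      unfolding radial_test_def[abs_def]
      by (intro Ck_on_cutoff_algebra[of _ c "1 / r\<^sup>2" x] cutoff_algebra.intros)
    show "radial_test c (1 / r\<^sup>2) x y = 0" if "y \<notin> cball x r" for y
      using cutoff_eq_0[OF ge1[OF that], of 0] by (simp add: radial_test_def)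
  qed
  show "test_function \<Omega> (radial_test' c (1 / r\<^sup>2) x b)"
  proof (rule test_functionI[OF _ _ assms(3)])
    show "Ck_on k UNIV (radial_test' c (1 / r\<^sup>2) x b)" for k
      unfolding radial_test'_def[abs_def]
      by (intro Ck_on_cutoff_algebra[of _ c "1 / r\<^sup>2" x] cutoff_algebra.intros)
    show "radial_test' c (1 / r\<^sup>2) x b y = 0" if "y \<notin> cball x r" for y
      using cutoff_eq_0[OF ge1[OF that], of 1] by (simp add: radial_test'_def)
  qed
qed

section \<open>Averages over balls and the mean value property\<close>

lemma lborel_integral_affine_euclidean:
  fixes F :: "'a::euclidean_space \<Rightarrow> real"
  assumes [measurable]: "F \<in> borel_measurable borel" and "r \<noteq> 0"
  shows "(LINT y|lborel. F y) = \<bar>r\<bar> ^ DIM('a) * (LINT z|lborel. F (c + r *\<^sub>R z))"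
proof -
  have "(LINT y|lborel. F y) =
      (LINT y|density (distr lborel borel (\<lambda>z. c + r *\<^sub>R z)) (\<lambda>_. ennreal (\<bar>r\<bar> ^ DIM('a))). F y)"
    using lborel_affine[OF \<open>r \<noteq> 0\<close>, of c] by (simp add: ennreal_power)
  also have "\<dots> = (LINT z|lborel. \<bar>r\<bar> ^ DIM('a) * F (c + r *\<^sub>R z))"
    by (subst integral_density) (auto simp: integral_distr)
  finally show ?thesis by simp
qed

lemma lborel_integral_eq_integral_cbox:
  fixes f :: "'a::euclidean_space \<Rightarrow> real"
  assumes "continuous_on UNIV f" "\<And>x. x \<notin> cbox a b \<Longrightarrow> f x = 0"
  shows "integrable lborel f" "(LINT x|lborel. f x) = integral (cbox a b) f"
proof -
  have "set_integrable lborel (cbox a b) f"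
    unfolding set_integrable_def
    by (rule borel_integrable_compact) (auto intro: continuous_on_subset[OF assms(1)])
  moreover have "(\<lambda>x. indicator (cbox a b) x *\<^sub>R f x) = f"
    using assms(2) by (auto simp: fun_eq_iff indicator_def)
  ultimately show "integrable lborel f" "(LINT x|lborel. f x) = integral (cbox a b) f"
    using set_borel_integral_eq_integral(2)[of "cbox a b" f]
    by (auto simp: set_integrable_def set_lebesgue_integral_def)
qed

lemma cball_subset_cbox_One:
  assumes "0 \<le> R"
  shows "cball (0::'a::euclidean_space) R \<subseteq> cbox (- R *\<^sub>R One) (R *\<^sub>R One)"
proof
  fix z :: 'a assume "z \<in> cball 0 R"
  then have "\<bar>z \<bullet> b\<bar> \<le> R" if "b \<in> Basis" for b
    using Basis_le_norm[OF that, of z] by simp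
  then show "z \<in> cbox (- R *\<^sub>R One) (R *\<^sub>R One)"
    by (force simp: mem_box abs_le_iff)
qed

lemma cball_enlarge:
  fixes x :: "'a::euclidean_space"
  assumes "open U" "cball x r \<subseteq> U" "0 < r"
  obtains \<delta> where "\<delta> > 0" "cball x (r + \<delta>) \<subseteq> U"
proof -
  obtain e where "e > 0" and e: "(\<Union>y\<in>cball x r. ball y e) \<subseteq> U"
    using compact_subset_open_imp_ball_epsilon_subset[OF compact_cball assms(1,2)] by blast
  have "cball x (r + e / 2) \<subseteq> U"
  proof
    fix y assume y: "y \<in> cball x (r + e / 2)"
    \<comment> \<open>The contraction towards \<open>x\<close> by \<open>k\<close> maps the larger
      ball into \<open>cball x r\<close> and moves no point by more than
      \<open>e / 2\<close>.\<close>
    define k where "k = r / (r + e / 2)"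
    define y' where "y' = x + k *\<^sub>R (y - x)"
    have k: "0 < k" "k < 1" "k * (r + e / 2) = r"
      using \<open>0 < r\<close> \<open>e > 0\<close> by (auto simp: k_def field_simps)
    have n: "norm (y - x) \<le> r + e / 2" using y by (simp add: dist_norm norm_minus_commute)
    have "dist x y' = k * norm (y - x)" using k by (simp add: y'_def dist_norm)
    also have "\<dots> \<le> r" using mult_left_mono[OF n, of k] k by simp
    finally have "y' \<in> cball x r" by simp
    moreover have "y - y' = (1 - k) *\<^sub>R (y - x)" by (simp add: y'_def algebra_simps)
    then have "dist y' y = (1 - k) * norm (y - x)"
      using k by (simp add: dist_norm norm_minus_commute[of y' y])
    then have "dist y' y \<le> (1 - k) * (r + e / 2)" using mult_left_mono[OF n, of "1 - k"] k by simp
    then have "dist y' y < e" using k \<open>e > 0\<close> by (simp add: left_diff_distrib)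
    ultimately show "y \<in> U" using e by (meson UN_I mem_ball subsetD)
  qed
  with \<open>e > 0\<close> show thesis by (intro that[of "e / 2"]) auto
qed

text \<open>Averages only see values inside the ball, so by Tietze the function may be replaced by
  one that is continuous everywhere; integrals over boxes then need no care at the boundary of
  \<open>U\<close>.\<close>

lemma continuous_extension_cball:
  fixes u :: "'a::euclidean_space \<Rightarrow> real"
  assumes "continuous_on U u" "cball x R \<subseteq> U"
  obtains g where "continuous_on UNIV g" "\<And>y. y \<in> cball x R \<Longrightarrow> g y = u y"
proof -
  have c: "continuous_on (cball x R) u" using assms by (rule continuous_on_subset)
  obtain B where "\<And>y. y \<in> cball x R \<Longrightarrow> norm (u y) \<le> B" "0 \<le> B"
    using compact_imp_bounded[OF compact_continuous_image[OF c compact_cball]]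
    unfolding bounded_pos by (metis imageI less_imp_le)
  then show thesis
    using Tietze[OF c, of UNIV B] that by (metis UNIV_I closed_cball closed_closedin subtopology_UNIV)
qed

text \<open>Global continuity and vanishing from the unit sphere outwards allow an integral over the
  ball to be replaced by one over any larger box or over the whole space.\<close>

definition ball_kernel :: "('a::euclidean_space \<Rightarrow> real) \<Rightarrow> bool" where
  "ball_kernel \<eta> \<longleftrightarrow> continuous_on UNIV \<eta> \<and> (\<forall>z. 1 \<le> norm z \<longrightarrow> \<eta> z = 0)"

text \<open>The kernel is kept on the unit ball and the function is rescaled, so radius 0 makes
  sense and returns \<open>u x\<close> times the mass of the kernel. There is no normalisation,
  because kernels need not be positive.\<close>

definition avg :: "('a::euclidean_space \<Rightarrow> real) \<Rightarrow> ('a \<Rightarrow> real) \<Rightarrow> 'a \<Rightarrow> real \<Rightarrow> real" where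
  "avg \<eta> u x r = integral (cball 0 1) (\<lambda>z. u (x + r *\<^sub>R z) * \<eta> z)"

lemma avg_cong:
  assumes "0 \<le> r" "\<And>y. y \<in> cball x r \<Longrightarrow> u y = v y"
  shows "avg \<eta> u x r = avg \<eta> v x r"
  unfolding avg_def
proof (rule integral_cong)
  fix z :: 'a assume "z \<in> cball 0 1"
  then have "x + r *\<^sub>R z \<in> cball x r"
    using \<open>0 \<le> r\<close> mult_left_le[of "norm z" r] by (simp add: dist_norm)
  with assms(2) show "u (x + r *\<^sub>R z) * \<eta> z = v (x + r *\<^sub>R z) * \<eta> z" by simp
qed

lemma avg_cbox:
  assumes "ball_kernel \<eta>" "cball 0 1 \<subseteq> cbox a b"
  shows "avg \<eta> u x r = integral (cbox a b) (\<lambda>z. u (x + r *\<^sub>R z) * \<eta> z)"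
proof -
  have "integral (cbox a b) (\<lambda>z. u (x + r *\<^sub>R z) * \<eta> z) =
      integral (cbox a b) (\<lambda>z. if z \<in> cball 0 1 then u (x + r *\<^sub>R z) * \<eta> z else 0)"
    using assms(1) by (intro integral_cong) (auto simp: ball_kernel_def)
  also have "\<dots> = avg \<eta> u x r"
    using assms(2) by (simp only: Henstock_Kurzweil_Integration.integral_restrict_Int avg_def inf.absorb1)
  finally show ?thesis ..
qed

abbreviation unit_cbox :: "'a::euclidean_space set" where
  "unit_cbox \<equiv> cbox (- One) One"

lemma cball_subset_unit_cbox: "cball 0 1 \<subseteq> unit_cbox"
  using cball_subset_cbox_One[of 1] by simp

lemmas avg_unit_cbox = avg_cbox[OF _ cball_subset_unit_cbox]

lemma avg_integrand_integrable:
  assumes "continuous_on UNIV g" "ball_kernel \<eta>"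
  shows "(\<lambda>z. g (x + r *\<^sub>R z) * \<eta> z) integrable_on cbox a b"
proof -
  have "continuous_on UNIV \<eta>" using assms by (simp add: ball_kernel_def)
  then show ?thesis
    by (intro integrable_continuous continuous_intros continuous_on_compose2[OF assms(1)]) 
      (auto intro: continuous_on_subset)
qed

lemma avg_lborel:
  assumes "continuous_on UNIV g" "ball_kernel \<eta>"
  shows "avg \<eta> g x r = (LINT z|lborel. g (x + r *\<^sub>R z) * \<eta> z)"
proof -
  have *: "continuous_on UNIV \<eta>" and 0: "\<And>z. 1 \<le> norm z \<Longrightarrow> \<eta> z = 0"
    using assms by (auto simp: ball_kernel_def)
  have "\<eta> z = 0" if "z \<notin> unit_cbox" for z
    using cball_subset_unit_cbox that by (intro 0) (force simp: subset_iff)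
  then have "(LINT z|lborel. g (x + r *\<^sub>R z) * \<eta> z) = integral unit_cbox (\<lambda>z. g (x + r *\<^sub>R z) * \<eta> z)"
    by (intro lborel_integral_eq_integral_cbox)
      (auto intro!: continuous_intros continuous_on_compose2[OF assms(1)] *)
  with avg_unit_cbox[OF assms(2)] show ?thesis by simp
qed

lemma avg_add:
  assumes "continuous_on U u" "ball_kernel \<eta>" "ball_kernel \<theta>" "cball x r \<subseteq> U" "0 \<le> r"
  shows "avg (\<lambda>z. a * \<eta> z + c * \<theta> z) u x r = a * avg \<eta> u x r + c * avg \<theta> u x r"
proof -
  obtain g where g: "continuous_on UNIV g" "\<And>y. y \<in> cball x r \<Longrightarrow> g y = u y"
    using continuous_extension_cball[OF assms(1,4)] by blast
  have bk: "ball_kernel (\<lambda>z. a * \<eta> z + c * \<theta> z)"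
    using assms(2,3) by (auto simp: ball_kernel_def intro!: continuous_intros)
  have hi: "((\<lambda>z. g (x + r *\<^sub>R z) * \<zeta> z) has_integral avg \<zeta> g x r) unit_cbox" if "ball_kernel \<zeta>" for \<zeta>
    using integrable_integral[OF avg_integrand_integrable[OF g(1) that]] by (simp add: avg_unit_cbox[OF that])
  have "((\<lambda>z. a * (g (x + r *\<^sub>R z) * \<eta> z) + c * (g (x + r *\<^sub>R z) * \<theta> z)) has_integral
      a * avg \<eta> g x r + c * avg \<theta> g x r) unit_cbox"
    by (intro has_integral_add has_integral_mult_right hi assms(2,3))
  then have "((\<lambda>z. g (x + r *\<^sub>R z) * (a * \<eta> z + c * \<theta> z)) has_integral
      a * avg \<eta> g x r + c * avg \<theta> g x r) unit_cbox"
    by (simp add: algebra_simps)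
  from has_integral_unique[OF hi[OF bk] this]
  have "avg (\<lambda>z. a * \<eta> z + c * \<theta> z) g x r = a * avg \<eta> g x r + c * avg \<theta> g x r" .
  moreover have "avg \<zeta> g x r = avg \<zeta> u x r" for \<zeta>
    using g(2) assms(5) by (intro avg_cong) auto
  ultimately show ?thesis by simp
qed

lemma continuous_on_avg:
  fixes g :: "'a::euclidean_space \<Rightarrow> real"
  assumes "continuous_on UNIV g" "ball_kernel \<eta>"
  shows "continuous_on UNIV (\<lambda>p. avg \<eta> g (fst p) (snd p))"
proof -
  have "continuous_on UNIV \<eta>" using assms by (simp add: ball_kernel_def)
  then have "continuous_on UNIV (\<lambda>p. integral unit_cbox (\<lambda>z. g (fst p + snd p *\<^sub>R z) * \<eta> z))"
    by (intro integral_continuous_on_param)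
      (auto simp: case_prod_unfold intro!: continuous_intros continuous_on_compose2[OF assms(1)]
        continuous_on_compose2[OF \<open>continuous_on UNIV \<eta>\<close>])
  then show ?thesis unfolding avg_unit_cbox[OF assms(2)] .
qed

lemma avg_bound:
  assumes "continuous_on U u" "ball_kernel \<eta>" "cball x r \<subseteq> U" "0 \<le> r"
    and M: "\<And>y. y \<in> cball x r \<Longrightarrow> \<bar>u y\<bar> \<le> M"
  shows "\<bar>avg \<eta> u x r\<bar> \<le> M * integral (cball 0 1) (\<lambda>z. \<bar>\<eta> z\<bar>)"
proof -
  obtain g where g: "continuous_on UNIV g" "\<And>y. y \<in> cball x r \<Longrightarrow> g y = u y"
    using continuous_extension_cball[OF assms(1,3)] by blast
  have bk: "ball_kernel (\<lambda>z. M * \<bar>\<eta> z\<bar>)"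
    using assms(2) by (auto simp: ball_kernel_def intro!: continuous_intros)
  have "\<bar>integral unit_cbox (\<lambda>z. g (x + r *\<^sub>R z) * \<eta> z)\<bar> \<le> integral unit_cbox (\<lambda>z. M * \<bar>\<eta> z\<bar>)"
    unfolding real_norm_def[symmetric]
  proof (rule integral_norm_bound_integral)
    show "(\<lambda>z. g (x + r *\<^sub>R z) * \<eta> z) integrable_on unit_cbox"
      by (rule avg_integrand_integrable[OF g(1) assms(2)])
    show "(\<lambda>z. M * norm (\<eta> z)) integrable_on unit_cbox"
      using avg_integrand_integrable[OF continuous_on_const bk, of 1] by simp
    fix z :: 'a
    show "norm (g (x + r *\<^sub>R z) * \<eta> z) \<le> M * norm (\<eta> z)"
    proof (cases "norm z \<le> 1")
      case True
      then have "x + r *\<^sub>R z \<in> cball x r"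
        using \<open>0 \<le> r\<close> mult_left_le[of "norm z" r] by (simp add: dist_norm)
      with M g(2) show ?thesis by (auto simp: abs_mult intro!: mult_right_mono)
    next
      case False
      then show ?thesis using assms(2) by (simp add: ball_kernel_def)
    qed
  qed
  also have "integral unit_cbox (\<lambda>z. M * \<bar>\<eta> z\<bar>) = avg (\<lambda>z. M * \<bar>\<eta> z\<bar>) (\<lambda>_. 1) 0 0"
    by (simp add: avg_unit_cbox[OF bk])
  also have "\<dots> = M * integral (cball 0 1) (\<lambda>z. \<bar>\<eta> z\<bar>)"
    by (simp add: avg_def)
  also have "integral unit_cbox (\<lambda>z. g (x + r *\<^sub>R z) * \<eta> z) = avg \<eta> u x r"
    using avg_cong[OF assms(4) g(2), where \<eta> = \<eta>] by (simp add: avg_unit_cbox[OF assms(2)])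
  finally show ?thesis .
qed

text \<open>Derivative of the profile of \<open>radial_test\<close>, chosen so that
  \<open>DERIV_scaled_bump\<close> holds. It is negative inside the ball, which is harmless since
  its mass is always divided out.\<close>

definition bump :: "'a::euclidean_space \<Rightarrow> real" where
  "bump z = cutoff 1 (z \<bullet> z)"

text \<open>Half of the derivative of \<open>bump\<close> along \<open>v\<close>; the missing factor
  appears in the constant \<open>- 2 / r\<close> of the gradient formula.\<close>

definition bump' :: "'a::euclidean_space \<Rightarrow> 'a \<Rightarrow> real" where
  "bump' v z = (z \<bullet> v) * cutoff 2 (z \<bullet> z)"

definition bump_mass :: "'a::euclidean_space itself \<Rightarrow> real" where
  "bump_mass _ = integral (cball 0 1) (bump :: 'a \<Rightarrow> real)"

lemma one_le_inner_self: "1 \<le> norm z \<Longrightarrow> 1 \<le> z \<bullet> z"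
  by (simp add: one_le_power flip: power2_norm_eq_inner)

lemma ball_kernel_bump: "ball_kernel bump"
  by (auto simp: ball_kernel_def bump_def[abs_def] cutoff_eq_0 one_le_inner_self intro!: continuous_intros)

lemma ball_kernel_bump': "ball_kernel (bump' v)"
  by (auto simp: ball_kernel_def bump'_def[abs_def] cutoff_eq_0 one_le_inner_self intro!: continuous_intros)

text \<open>The function \<open>- bump\<close> is continuous, non-negative and positive at the
  centre, so its integral cannot be zero.\<close>

lemma bump_mass_nonzero: "bump_mass TYPE('a::euclidean_space) \<noteq> 0"
proof
  assume 0: "bump_mass TYPE('a) = 0"
  have bk: "ball_kernel (\<lambda>z::'a. - bump z)"
    using ball_kernel_bump[where 'a='a] by (auto simp: ball_kernel_def intro!: continuous_intros)
  have "integral unit_cbox (\<lambda>z::'a. - bump z) = 0"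
    using avg_unit_cbox[OF bk, of "\<lambda>_. 1" 0 0] 0 by (simp add: avg_def bump_mass_def)
  moreover have "(\<lambda>z::'a. - bump z) integrable_on unit_cbox"
    using avg_integrand_integrable[OF continuous_on_const bk, of 1] by simp
  ultimately have hi: "((\<lambda>z::'a. - bump z) has_integral 0) unit_cbox"
    by (metis integrable_integral)
  have "0 \<le> - bump z" for z :: 'a
    using cutoff_1_neg[of "z \<bullet> z"] cutoff_eq_0[of "z \<bullet> z" 1] by (cases "z \<bullet> z < 1") (auto simp: bump_def)
  then have "- bump (0::'a) = 0"
    by (intro has_integral_0_cbox_imp_0[OF _ _ hi])
      (use bk in \<open>auto simp: ball_kernel_def box_ne_empty mem_box intro: continuous_on_subset\<close>)
  then show False using cutoff_1_neg[of 0] by (simp add: bump_def)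
qed

text \<open>One smooth kernel takes the place of the uniform average over balls or spheres, so that
  a derivative can fall on the kernel.\<close>

definition mean_value_on :: "'a::euclidean_space set \<Rightarrow> ('a \<Rightarrow> real) \<Rightarrow> bool" where
  "mean_value_on U u \<longleftrightarrow> continuous_on U u \<and>
     (\<forall>x r. 0 < r \<longrightarrow> cball x r \<subseteq> U \<longrightarrow> avg bump u x r = u x * bump_mass TYPE('a))"

section \<open>Derivatives of functions with the mean value property\<close>

lemma DERIV_bump_shift:
  assumes "r \<noteq> 0"
  shows "((\<lambda>t. bump (z - (t / r) *\<^sub>R v)) has_real_derivative
     - 2 / r * bump' v (z - (t / r) *\<^sub>R v)) (at t within A)"
proof -
  have "((\<lambda>t. z \<bullet> z - 2 * (t / r) * (z \<bullet> v) + (t / r)\<^sup>2 * (v \<bullet> v)) has_real_derivative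
      - 2 / r * ((z - (t / r) *\<^sub>R v) \<bullet> v)) (at t within A)"
    using assms
    by (auto intro!: derivative_eq_intros simp: inner_diff_left power2_eq_square field_simps)
  moreover have "(\<lambda>t. z \<bullet> z - 2 * (t / r) * (z \<bullet> v) + (t / r)\<^sup>2 * (v \<bullet> v)) =
      (\<lambda>t. (z - (t / r) *\<^sub>R v) \<bullet> (z - (t / r) *\<^sub>R v))"
    by (simp add: fun_eq_iff inner_diff_left inner_diff_right inner_commute power2_eq_square algebra_simps)
  ultimately have "((\<lambda>t. (z - (t / r) *\<^sub>R v) \<bullet> (z - (t / r) *\<^sub>R v)) has_real_derivative
      - 2 / r * ((z - (t / r) *\<^sub>R v) \<bullet> v)) (at t within A)"
    by simp
  from DERIV_chain2[OF DERIV_cutoff this] show ?thesis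
    by (simp add: bump_def[abs_def] bump'_def mult_ac numeral_2_eq_2)
qed

text \<open>Moving the centre by \<open>t *\<^sub>R v\<close> is the same as shifting the kernel by
  \<open>(t / r) *\<^sub>R v\<close>, so the dependence on \<open>t\<close> leaves the merely
  continuous \<open>g\<close>. The shift has norm at most 1, hence a fixed box of half-width 2
  contains all supports.\<close>

lemma avg_bump_shift:
  fixes g :: "'a::euclidean_space \<Rightarrow> real"
  assumes g: "continuous_on UNIV g" and "r > 0" and t: "norm ((t / r) *\<^sub>R v) \<le> 1"
  shows "avg bump g (x + t *\<^sub>R v) r =
    integral (cbox (- 2 *\<^sub>R One) (2 *\<^sub>R One)) (\<lambda>z. g (x + r *\<^sub>R z) * bump (z - (t / r) *\<^sub>R v))"
proof -
  define F where "F z = g (x + r *\<^sub>R z) * bump (z - (t / r) *\<^sub>R v)" for z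
  have cont: "continuous_on UNIV F"
    unfolding F_def bump_def by (intro continuous_intros continuous_on_compose2[OF g]) auto
  have "F z = 0" if "z \<notin> cbox (- 2 *\<^sub>R One) (2 *\<^sub>R One)" for z
  proof -
    have "norm z > 2"
      using that cball_subset_cbox_One[of 2, where 'a='a] by (force simp: subset_iff)
    then have "1 \<le> norm (z - (t / r) *\<^sub>R v)"
      using t norm_triangle_ineq2[of z "(t / r) *\<^sub>R v"] by linarith
    then show ?thesis using ball_kernel_bump[where 'a='a] by (simp add: F_def ball_kernel_def)
  qed
  then have "(LINT z|lborel. F z) = integral (cbox (- 2 *\<^sub>R One) (2 *\<^sub>R One)) F"
    by (intro lborel_integral_eq_integral_cbox cont)
  moreover have "(LINT z|lborel. F z) = (LINT z|lborel. F ((t / r) *\<^sub>R v + z))"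
    using lborel_integral_affine_euclidean[OF borel_measurable_continuous_onI[OF cont], of 1 "(t / r) *\<^sub>R v"]
    by simp
  moreover have "(\<lambda>z. F ((t / r) *\<^sub>R v + z)) = (\<lambda>z. g (x + t *\<^sub>R v + r *\<^sub>R z) * bump z)"
    using \<open>r > 0\<close> by (simp add: fun_eq_iff F_def scaleR_add_right add.assoc)
  ultimately show ?thesis
    using avg_lborel[OF g ball_kernel_bump, of "x + t *\<^sub>R v" r] by (simp only: F_def[abs_def])
qed

text \<open>Near \<open>x\<close> the function equals its averages of fixed radius \<open>r\<close>,
  and these are differentiated under the integral through the shifted kernel. The moving ball leaves
  \<open>cball x r\<close>, which is why that ball is enlarged first.\<close>

lemma mean_value_on_DERIV:
  fixes u :: "'a::euclidean_space \<Rightarrow> real"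
  assumes "open U" and mv: "mean_value_on U u" and "r > 0" and sub: "cball x r \<subseteq> U"
  shows "((\<lambda>t. u (x + t *\<^sub>R v)) has_real_derivative
    - 2 / r * avg (bump' v) u x r / bump_mass TYPE('a)) (at 0)"
proof -
  have u: "continuous_on U u" using mv by (simp add: mean_value_on_def)
  obtain \<delta> where "\<delta> > 0" and \<delta>: "cball x (r + \<delta>) \<subseteq> U"
    using cball_enlarge[OF \<open>open U\<close> sub \<open>r > 0\<close>] by blast
  obtain g where g: "continuous_on UNIV g" "\<And>y. y \<in> cball x (r + \<delta>) \<Longrightarrow> g y = u y"
    using continuous_extension_cball[OF u \<delta>] by blast
  \<comment> \<open>The bound by \<open>\<delta>\<close> keeps the moved ball inside the enlarged
    one, and the bound by \<open>r\<close> keeps the shift of the kernel within norm 1. The summand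
    1 covers \<open>v = 0\<close>.\<close>
  define \<epsilon> where "\<epsilon> = min \<delta> r / (norm v + 1)"
  have "\<epsilon> > 0" using \<open>\<delta> > 0\<close> \<open>r > 0\<close> by (simp add: \<epsilon>_def add_nonneg_pos)
  have small: "\<bar>t\<bar> * norm v \<le> \<delta>" "\<bar>t\<bar> * norm v \<le> r" if "\<bar>t\<bar> < \<epsilon>" for t
  proof -
    have "\<bar>t\<bar> * norm v \<le> \<epsilon> * (norm v + 1)"
      using that by (intro mult_mono) auto
    also have "\<dots> = min \<delta> r" by (simp add: \<epsilon>_def add_nonneg_eq_0_iff)
    finally show "\<bar>t\<bar> * norm v \<le> \<delta>" "\<bar>t\<bar> * norm v \<le> r" by auto
  qed
  define I where "I t = integral (cbox (- 2 *\<^sub>R One) (2 *\<^sub>R One)) (\<lambda>z. g (x + r *\<^sub>R z) * bump (z - (t / r) *\<^sub>R v))" for t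
  have eq: "u (x + t *\<^sub>R v) = I t / bump_mass TYPE('a)" if "\<bar>t\<bar> < \<epsilon>" for t
  proof -
    have sub': "cball (x + t *\<^sub>R v) r \<subseteq> cball x (r + \<delta>)"
      using small[OF that] by (auto simp: cball_subset_cball_iff dist_norm)
    then have "u (x + t *\<^sub>R v) * bump_mass TYPE('a) = avg bump u (x + t *\<^sub>R v) r"
      using mv \<delta> \<open>r > 0\<close> unfolding mean_value_on_def by auto
    also have "\<dots> = avg bump g (x + t *\<^sub>R v) r"
      using \<open>r > 0\<close> g(2) sub' by (intro avg_cong) auto
    also have "\<dots> = I t"
      unfolding I_def using small[OF that] \<open>r > 0\<close> by (intro avg_bump_shift g(1)) (auto simp: field_simps)
    finally show ?thesis using bump_mass_nonzero[where 'a='a] by (simp add: field_simps)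
  qed
  have "(I has_real_derivative integral (cbox (- 2 *\<^sub>R One) (2 *\<^sub>R One))
      (\<lambda>z. g (x + r *\<^sub>R z) * (- 2 / r * bump' v (z - (0 / r) *\<^sub>R v)))) (at 0 within UNIV)"
    unfolding I_def
  proof (rule leibniz_rule_field_derivative)
    show "((\<lambda>t. g (x + r *\<^sub>R z) * bump (z - (t / r) *\<^sub>R v)) has_real_derivative
        g (x + r *\<^sub>R z) * (- 2 / r * bump' v (z - (t / r) *\<^sub>R v))) (at t within UNIV)" for t z
      using \<open>r > 0\<close> by (intro DERIV_cmult DERIV_bump_shift) simp
    show "(\<lambda>z. g (x + r *\<^sub>R z) * bump (z - (t / r) *\<^sub>R v)) integrable_on cbox (- 2 *\<^sub>R One) (2 *\<^sub>R One)" for t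
      unfolding bump_def
      by (intro integrable_continuous continuous_intros continuous_on_compose2[OF g(1)]) auto
    show "continuous_on (UNIV \<times> cbox (- 2 *\<^sub>R One) (2 *\<^sub>R One))
       (\<lambda>(t, z). g (x + r *\<^sub>R z) * (- 2 / r * bump' v (z - (t / r) *\<^sub>R v)))"
      unfolding bump'_def case_prod_unfold using \<open>r > 0\<close>
      by (intro continuous_intros continuous_on_compose2[OF g(1)]) auto
  qed auto
  moreover have "integral (cbox (- 2 *\<^sub>R One) (2 *\<^sub>R One))
      (\<lambda>z. g (x + r *\<^sub>R z) * (- 2 / r * bump' v (z - (0 / r) *\<^sub>R v))) =
      - 2 / r * avg (bump' v) u x r"
  proof -
    have "cball (0::'a) 1 \<subseteq> cball 0 2" by (auto simp: cball_subset_cball_iff)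
    also have "\<dots> \<subseteq> cbox (- 2 *\<^sub>R One) (2 *\<^sub>R One)" using cball_subset_cbox_One[of 2] by simp
    finally have "avg (bump' v) g x r = integral (cbox (- 2 *\<^sub>R One) (2 *\<^sub>R One)) (\<lambda>z. g (x + r *\<^sub>R z) * bump' v z)"
      by (intro avg_cbox ball_kernel_bump')
    moreover have "avg (bump' v) g x r = avg (bump' v) u x r"
      using \<open>r > 0\<close> \<open>\<delta> > 0\<close> g(2) by (intro avg_cong) auto
    moreover have "(\<lambda>z. g (x + r *\<^sub>R z) * (- 2 / r * bump' v (z - (0 / r) *\<^sub>R v))) =
        (\<lambda>z. - 2 / r * (g (x + r *\<^sub>R z) * bump' v z))"
      by auto
    ultimately show ?thesis by (simp only: Henstock_Kurzweil_Integration.integral_mult_right)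
  qed
  ultimately have "(I has_real_derivative - 2 / r * avg (bump' v) u x r) (at 0)"
    by (simp only:)
  then have "((\<lambda>t. I t / bump_mass TYPE('a)) has_real_derivative
      - 2 / r * avg (bump' v) u x r / bump_mass TYPE('a)) (at 0)"
    by (rule DERIV_cdivide)
  moreover have ev: "\<forall>\<^sub>F t in nhds 0. u (x + t *\<^sub>R v) = I t / bump_mass TYPE('a)"
    unfolding eventually_nhds_metric using \<open>\<epsilon> > 0\<close> eq by (auto simp: dist_norm)
  ultimately show ?thesis
    by (simp only: DERIV_cong_ev[OF refl ev refl])
qed

text \<open>Total in \<open>u\<close>, so that \<open>fold\<close> can iterate it along a list of
  directions.\<close>

definition pderivative :: "'a::euclidean_space \<Rightarrow> ('a \<Rightarrow> real) \<Rightarrow> 'a \<Rightarrow> real" where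
  "pderivative b u x = deriv (\<lambda>t. u (x + t *\<^sub>R b)) 0"

lemma pderivative_eq_avg:
  fixes u :: "'a::euclidean_space \<Rightarrow> real"
  assumes "open U" "mean_value_on U u" "r > 0" "cball x r \<subseteq> U"
  shows "pderivative b u x = - 2 / r * avg (bump' b) u x r / bump_mass TYPE('a)"
  unfolding pderivative_def by (rule DERIV_imp_deriv[OF mean_value_on_DERIV[OF assms]])

lemma bump'_linear: "bump' v z = (\<Sum>b\<in>Basis. (v \<bullet> b) * bump' b z)"
proof -
  have "z \<bullet> v = (\<Sum>b\<in>Basis. (v \<bullet> b) * (z \<bullet> b))"
    by (subst euclidean_inner) (simp add: mult.commute)
  then show ?thesis by (simp add: bump'_def sum_distrib_right mult.assoc)
qed

lemma avg_sum:
  assumes "continuous_on U u" "cball x r \<subseteq> U" "0 \<le> r" "finite B" "\<And>b. b \<in> B \<Longrightarrow> ball_kernel (\<eta> b)"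
  shows "ball_kernel (\<lambda>z. \<Sum>b\<in>B. c b * \<eta> b z) \<and>
    avg (\<lambda>z. \<Sum>b\<in>B. c b * \<eta> b z) u x r = (\<Sum>b\<in>B. c b * avg (\<eta> b) u x r)"
  using assms(4,5)
proof (induction B)
  case empty
  show ?case by (simp add: ball_kernel_def avg_def)
next
  case (insert b B)
  then have bk: "ball_kernel (\<eta> b)" "ball_kernel (\<lambda>z. \<Sum>b\<in>B. c b * \<eta> b z)" by auto
  have "ball_kernel (\<lambda>z. c b * \<eta> b z + (\<Sum>b\<in>B. c b * \<eta> b z))"
    using bk by (auto simp: ball_kernel_def intro!: continuous_intros)
  with insert avg_add[OF assms(1) bk assms(2,3), of "c b" 1] show ?case by simp
qed

lemma mean_value_on_directional:
  fixes u :: "'a::euclidean_space \<Rightarrow> real"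
  assumes "open U" and mv: "mean_value_on U u" and "x \<in> U"
  shows "((\<lambda>t. u (x + t *\<^sub>R v)) has_real_derivative (\<Sum>b\<in>Basis. (v \<bullet> b) * pderivative b u x)) (at 0)"
proof -
  obtain r where r: "r > 0" "cball x r \<subseteq> U"
    using \<open>open U\<close> \<open>x \<in> U\<close> open_contains_cball by blast
  have u: "continuous_on U u" using mv by (simp add: mean_value_on_def)
  have "avg (bump' v) u x r = (\<Sum>b\<in>Basis. (v \<bullet> b) * avg (bump' b) u x r)"
    using avg_sum[OF u r(2), of Basis bump' "\<lambda>b. v \<bullet> b"] r(1)
    by (simp add: ball_kernel_bump' flip: bump'_linear)
  then have "- 2 / r * avg (bump' v) u x r / bump_mass TYPE('a) = (\<Sum>b\<in>Basis. (v \<bullet> b) * pderivative b u x)"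
    by (simp add: pderivative_eq_avg[OF assms(1,2) r] sum_distrib_left sum_divide_distrib mult_ac)
  with mean_value_on_DERIV[OF assms(1,2) r, of v] show ?thesis by simp
qed

text \<open>One radius serves all centres near \<open>x0\<close>, so there the partial derivative is
  a kernel average of a continuous function with moving centre.\<close>

lemma continuous_on_pderivative:
  fixes u :: "'a::euclidean_space \<Rightarrow> real"
  assumes "open U" and mv: "mean_value_on U u"
  shows "continuous_on U (pderivative b u)"
proof (rule continuous_at_imp_continuous_on, rule ballI)
  fix x0 assume "x0 \<in> U"
  then obtain R where R: "R > 0" "cball x0 R \<subseteq> U"
    using \<open>open U\<close> open_contains_cball by blast
  define r where "r = R / 2"
  have r: "r > 0" "cball x0 (2 * r) \<subseteq> U" using R by (auto simp: r_def)
  have u: "continuous_on U u" using mv by (simp add: mean_value_on_def)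
  obtain g where g: "continuous_on UNIV g" "\<And>y. y \<in> cball x0 (2 * r) \<Longrightarrow> g y = u y"
    using continuous_extension_cball[OF u r(2)] by blast
  have eq: "pderivative b u x = - 2 / r * avg (bump' b) g x r / bump_mass TYPE('a)" if "x \<in> ball x0 r" for x
  proof -
    have sub: "cball x r \<subseteq> cball x0 (2 * r)"
      using that by (auto simp: cball_subset_cball_iff dist_commute)
    then have "avg (bump' b) g x r = avg (bump' b) u x r"
      using r(1) g(2) by (intro avg_cong) auto
    with pderivative_eq_avg[OF assms r(1), of x b] sub r(2) show ?thesis by auto
  qed
  have "continuous_on UNIV (\<lambda>x. avg (bump' b) g x r)"
  proof -
    have "continuous_on UNIV (\<lambda>x::'a. (x, r))" by (intro continuous_intros)
    from continuous_on_compose2[OF continuous_on_avg[OF g(1) ball_kernel_bump'[of b]] this]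
    show ?thesis by simp
  qed
  then have "continuous_on (ball x0 r) (\<lambda>x. - 2 / r * avg (bump' b) g x r / bump_mass TYPE('a))"
    by (rule continuous_on_subset[OF continuous_on_divide[OF continuous_on_mult_left continuous_on_const]])
      (auto simp: bump_mass_nonzero)
  then have "continuous_on (ball x0 r) (pderivative b u)"
    by (rule continuous_on_eq) (simp only: eq)
  then show "isCont (pderivative b u) x0"
    by (rule continuous_on_interior) (simp add: r(1))
qed

text \<open>The partial derivative is itself an average with kernel \<open>bump'\<close>. The
  averages over radii \<open>\<rho>\<close> and \<open>r\<close> commute by Fubini, and the inner
  one reproduces \<open>u\<close>.\<close>

lemma mean_value_on_pderivative:
  fixes u :: "'a::euclidean_space \<Rightarrow> real"
  assumes "open U" and mv: "mean_value_on U u"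
  shows "mean_value_on U (pderivative b u)"
  unfolding mean_value_on_def
proof (intro conjI allI impI)
  show "continuous_on U (pderivative b u)" using assms by (rule continuous_on_pderivative)
  fix x :: 'a and \<rho> :: real assume \<rho>: "0 < \<rho>" "cball x \<rho> \<subseteq> U"
  have u: "continuous_on U u" using mv by (simp add: mean_value_on_def)
  obtain r where r: "r > 0" "cball x (\<rho> + r) \<subseteq> U"
    using cball_enlarge[OF \<open>open U\<close> \<rho>(2,1)] by blast
  obtain g where g: "continuous_on UNIV g" "\<And>y. y \<in> cball x (\<rho> + r) \<Longrightarrow> g y = u y"
    using continuous_extension_cball[OF u r(2)] by blast
  define c where "c = - 2 / r / bump_mass TYPE('a)"
  have sub1: "cball (x + \<rho> *\<^sub>R z) r \<subseteq> cball x (\<rho> + r)" if "norm z \<le> 1" for z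
    using that \<rho>(1) mult_left_le[of "norm z" \<rho>] by (auto simp: cball_subset_cball_iff dist_norm)
  have sub2: "cball (x + r *\<^sub>R z) \<rho> \<subseteq> cball x (\<rho> + r)" if "norm z \<le> 1" for z
    using that r(1) mult_left_le[of "norm z" r] by (auto simp: cball_subset_cball_iff dist_norm)
  have D: "pderivative b u (x + \<rho> *\<^sub>R z) = c * avg (bump' b) g (x + \<rho> *\<^sub>R z) r" if "norm z \<le> 1" for z
  proof -
    have "avg (bump' b) u (x + \<rho> *\<^sub>R z) r = avg (bump' b) g (x + \<rho> *\<^sub>R z) r"
      using r(1) g(2) sub1[OF that] by (intro avg_cong) auto
    with pderivative_eq_avg[OF assms r(1), of "x + \<rho> *\<^sub>R z" b] sub1[OF that] r(2) show ?thesis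
      by (auto simp: c_def)
  qed
  have inner: "avg bump g (x + r *\<^sub>R w) \<rho> = bump_mass TYPE('a) * g (x + r *\<^sub>R w)" if "norm w \<le> 1" for w
  proof -
    have "avg bump g (x + r *\<^sub>R w) \<rho> = avg bump u (x + r *\<^sub>R w) \<rho>"
      using \<rho>(1) g(2) sub2[OF that] by (intro avg_cong) auto
    also have "\<dots> = u (x + r *\<^sub>R w) * bump_mass TYPE('a)"
      using mv \<rho>(1) sub2[OF that] r(2) unfolding mean_value_on_def by auto
    also have "u (x + r *\<^sub>R w) = g (x + r *\<^sub>R w)"
      using g(2) sub2[OF that] \<rho>(1) by (metis centre_in_cball less_imp_le subsetD)
    finally show ?thesis by simp
  qed
  define G where "G z w = g (x + \<rho> *\<^sub>R z + r *\<^sub>R w) * bump' b w * bump z" for z w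
  have contG: "continuous_on (cbox (- One, - One) (One, One)) (\<lambda>(z, w). G z w)"
    unfolding G_def bump_def bump'_def case_prod_unfold
    by (intro continuous_intros continuous_on_compose2[OF g(1)]) auto
  have "avg bump (pderivative b u) x \<rho> = integral unit_cbox (\<lambda>z. pderivative b u (x + \<rho> *\<^sub>R z) * bump z)"
    by (rule avg_unit_cbox[OF ball_kernel_bump])
  also have "\<dots> = integral unit_cbox (\<lambda>z. c * integral unit_cbox (\<lambda>w. G z w))"
  proof (rule integral_cong)
    fix z :: 'a
    show "pderivative b u (x + \<rho> *\<^sub>R z) * bump z = c * integral unit_cbox (\<lambda>w. G z w)"
    proof (cases "norm z \<le> 1")
      case True
      show ?thesis
        unfolding D[OF True] avg_unit_cbox[OF ball_kernel_bump'] G_def by simp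
    next
      case False
      then have "bump z = 0" using ball_kernel_bump[where 'a='a] by (simp add: ball_kernel_def)
      then show ?thesis by (simp add: G_def)
    qed
  qed
  also have "\<dots> = c * integral unit_cbox (\<lambda>z. integral unit_cbox (\<lambda>w. G z w))"
    by simp
  also have "integral unit_cbox (\<lambda>z. integral unit_cbox (\<lambda>w. G z w)) =
      integral unit_cbox (\<lambda>w. integral unit_cbox (\<lambda>z. G z w))"
    by (rule integral_swap_continuous[OF contG])
  also have "\<dots> = integral unit_cbox (\<lambda>w. bump_mass TYPE('a) * (g (x + r *\<^sub>R w) * bump' b w))"
  proof (rule integral_cong)
    fix w :: 'a
    show "integral unit_cbox (\<lambda>z. G z w) = bump_mass TYPE('a) * (g (x + r *\<^sub>R w) * bump' b w)"
    proof (cases "norm w \<le> 1")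
      case True
      have "(\<lambda>z. G z w) = (\<lambda>z. (g (x + r *\<^sub>R w + \<rho> *\<^sub>R z) * bump z) * bump' b w)"
        by (simp add: G_def fun_eq_iff algebra_simps)
      then have "integral unit_cbox (\<lambda>z. G z w) = avg bump g (x + r *\<^sub>R w) \<rho> * bump' b w"
        unfolding avg_unit_cbox[OF ball_kernel_bump] by simp
      with inner[OF True] show ?thesis by simp
    next
      case False
      then have "bump' b w = 0" using ball_kernel_bump'[of b] by (simp add: ball_kernel_def)
      then show ?thesis by (simp add: G_def)
    qed
  qed
  also have "\<dots> = bump_mass TYPE('a) * avg (bump' b) g x r"
    unfolding avg_unit_cbox[OF ball_kernel_bump'] by simp
  also have "c * (bump_mass TYPE('a) * avg (bump' b) g x r) = pderivative b u x * bump_mass TYPE('a)"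
    using D[of 0] by simp
  finally show "avg bump (pderivative b u) x \<rho> = pderivative b u x * bump_mass TYPE('a)" .
qed

text \<open>Summing over the basis gives one constant for all directions; the added 1 makes it
  positive.\<close>

definition gradient_const :: "'a::euclidean_space itself \<Rightarrow> real" where
  "gradient_const _ =
     2 * (\<Sum>b\<in>Basis. integral (cball 0 1) (\<lambda>z::'a. \<bar>bump' b z\<bar>)) / \<bar>bump_mass TYPE('a)\<bar> + 1"

lemma integral_abs_bump'_nonneg: "0 \<le> integral (cball 0 1) (\<lambda>z::'a::euclidean_space. \<bar>bump' b z\<bar>)"
proof -
  have "0 \<le> integral (cball 0 1) (\<lambda>z::'a. norm (bump' b z))"
    by (cases "(\<lambda>z::'a. norm (bump' b z)) integrable_on cball 0 1")
      (auto intro: Henstock_Kurzweil_Integration.integral_nonneg simp: not_integrable_integral)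
  then show ?thesis by simp
qed

lemma gradient_const_pos: "gradient_const TYPE('a::euclidean_space) > 0"
  unfolding gradient_const_def using integral_abs_bump'_nonneg[where 'a='a]
  by (auto intro!: add_nonneg_pos divide_nonneg_nonneg sum_nonneg)

lemma pderivative_bound:
  fixes u :: "'a::euclidean_space \<Rightarrow> real"
  assumes "open U" "mean_value_on U u" "b \<in> Basis" "r > 0" "cball x r \<subseteq> U"
    "\<And>y. y \<in> cball x r \<Longrightarrow> \<bar>u y\<bar> \<le> M"
  shows "\<bar>pderivative b u x\<bar> \<le> gradient_const TYPE('a) / r * M"
proof -
  define N where "N b = integral (cball 0 1) (\<lambda>z::'a. \<bar>bump' b z\<bar>)" for b
  have "0 \<le> M" using assms(6)[of x] \<open>r > 0\<close> by (auto intro: order_trans[OF abs_ge_zero])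
  have "\<bar>avg (bump' b) u x r\<bar> \<le> M * N b"
    unfolding N_def using assms by (intro avg_bound[of U]) (auto simp: mean_value_on_def ball_kernel_bump')
  also have "\<dots> \<le> M * (\<Sum>b\<in>Basis. N b)"
    using \<open>0 \<le> M\<close> \<open>b \<in> Basis\<close> integral_abs_bump'_nonneg
    by (intro mult_left_mono member_le_sum) (auto simp: N_def)
  finally have "\<bar>avg (bump' b) u x r\<bar> * (2 / \<bar>bump_mass TYPE('a)\<bar>) \<le>
      M * (\<Sum>b\<in>Basis. N b) * (2 / \<bar>bump_mass TYPE('a)\<bar>)"
    by (intro mult_right_mono) auto
  also have "\<dots> \<le> gradient_const TYPE('a) * M"
    using \<open>0 \<le> M\<close> by (simp add: gradient_const_def N_def algebra_simps)
  finally show ?thesis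
    using \<open>r > 0\<close> unfolding pderivative_eq_avg[OF assms(1,2,4,5)]
    by (simp add: abs_mult field_simps)
qed

section \<open>Analyticity from the mean value property\<close>

lemma mean_value_on_fold_pderivative:
  "open U \<Longrightarrow> mean_value_on U u \<Longrightarrow> mean_value_on U (fold pderivative w u)"
  by (induction w arbitrary: u) (auto intro: mean_value_on_pderivative)

text \<open>Each of the \<open>length w\<close> derivatives costs a factor \<open>C / \<rho>\<close> and a layer of width \<open>\<rho>\<close>.\<close>

lemma fold_pderivative_bound:
  fixes a :: "'a::euclidean_space" and \<rho> :: real
  assumes "\<rho> > 0" "open U" "mean_value_on U u" "set w \<subseteq> Basis" "cball a R \<subseteq> U"
    and "\<And>y. y \<in> cball a R \<Longrightarrow> \<bar>u y\<bar> \<le> M" "y \<in> cball a (R - length w * \<rho>)"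
  shows "\<bar>fold pderivative w u y\<bar> \<le> (gradient_const TYPE('a) / \<rho>) ^ length w * M"
  using assms(3-)
proof (induction w arbitrary: u R M)
  case Nil
  then show ?case by simp
next
  case (Cons b w)
  have sub: "cball z \<rho> \<subseteq> cball a R" if "z \<in> cball a (R - \<rho>)" for z
    using that by (auto simp: cball_subset_cball_iff dist_commute)
  have "\<bar>fold pderivative w (pderivative b u) y\<bar> \<le> (gradient_const TYPE('a) / \<rho>) ^ length w * (gradient_const TYPE('a) / \<rho> * M)"
  proof (rule Cons.IH)
    show "mean_value_on U (pderivative b u)"
      using \<open>open U\<close> Cons.prems(1) by (rule mean_value_on_pderivative)
    show "set w \<subseteq> Basis" using Cons.prems by simp
    show "cball a (R - \<rho>) \<subseteq> U"
      using Cons.prems(3) \<open>\<rho> > 0\<close> by (auto intro: order_trans[OF subset_cball])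
    show "y \<in> cball a (R - \<rho> - length w * \<rho>)"
      using Cons.prems(5) by (simp add: algebra_simps)
    show "\<bar>pderivative b u z\<bar> \<le> gradient_const TYPE('a) / \<rho> * M" if "z \<in> cball a (R - \<rho>)" for z
      using sub[OF that] Cons.prems \<open>open U\<close> \<open>\<rho> > 0\<close> by (intro pderivative_bound[where U = U]) auto
  qed
  then show ?case by (simp add: mult_ac)
qed

text \<open>The left side divided by \<open>fact n\<close> is a single term of the series of
  \<open>exp n\<close>. This converts the \<open>n ^ n\<close> caused by radii proportional to
  \<open>1 / n\<close> into a factorial.\<close>

lemma power_self_le_exp_fact: "real n ^ n \<le> exp 1 ^ n * fact n"
proof -
  have "real n ^ n /\<^sub>R fact n \<le> (\<Sum>k. real n ^ k /\<^sub>R fact k)"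
    using sum_le_suminf[OF summable_exp_generic, of "{n}" "real n"] by simp
  also have "\<dots> = exp (real n)" by (simp add: exp_def)
  also have "\<dots> = exp 1 ^ n" using exp_of_nat_mult[of n "1::real"] by simp
  finally show ?thesis by (simp add: field_simps)
qed

section \<open>Taylor expansion along segments, indexed by words of directions\<close>

lemma mean_value_on_line_DERIV:
  fixes u :: "'a::euclidean_space \<Rightarrow> real"
  assumes "open U" "mean_value_on U u" "a + t *\<^sub>R v \<in> U"
  shows "((\<lambda>t. u (a + t *\<^sub>R v)) has_real_derivative
    (\<Sum>b\<in>Basis. (v \<bullet> b) * pderivative b u (a + t *\<^sub>R v))) (at t)"
proof -
  have "((\<lambda>s. u (a + (s + t) *\<^sub>R v)) has_real_derivative
    (\<Sum>b\<in>Basis. (v \<bullet> b) * pderivative b u (a + t *\<^sub>R v))) (at 0)"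
    using mean_value_on_directional[OF assms, of v] by (simp add: algebra_simps)
  then show ?thesis
    using DERIV_shift[of "\<lambda>t. u (a + t *\<^sub>R v)" _ 0 t] by simp
qed

text \<open>A word records the order of differentiation. Differentiating a sum over all words of
  length \<open>n\<close> along a line yields the sum over all words of length \<open>n + 1\<close>,
  without coefficients.\<close>

definition words :: "nat \<Rightarrow> 'a::euclidean_space list set" where
  "words n = {w. set w \<subseteq> Basis \<and> length w = n}"

lemma finite_words: "finite (words n)" and card_words: "card (words n :: 'a::euclidean_space list set) = DIM('a) ^ n"
  unfolding words_def by (simp_all add: finite_lists_length_eq card_lists_length_eq)

text \<open>\<open>fold\<close> applies the last letter last, so one more derivative appends a
  letter at the end.\<close>

lemma bij_betw_words_Suc: "bij_betw (\<lambda>(w, b). w @ [b]) (words n \<times> Basis) (words (Suc n))"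
proof (rule bij_betwI[where g = "\<lambda>w. (butlast w, last w)"])
  show "(\<lambda>w. (butlast w, last w)) \<in> words (Suc n) \<rightarrow> words n \<times> Basis"
    by (auto simp: words_def dest: in_set_butlastD) (metis last_in_set length_0_conv nat.distinct(1) subsetD)
qed (auto simp: words_def intro!: append_butlast_last_id)

definition word_monomial :: "'a::euclidean_space list \<Rightarrow> 'a \<Rightarrow> real" where
  "word_monomial w v = prod_list (map (\<lambda>b. v \<bullet> b) w)"

lemma word_monomial_eq:
  "set w \<subseteq> Basis \<Longrightarrow> word_monomial w v = monomial (restrict (count_list w) Basis) v"
proof (induction w)
  case Nil
  then show ?case by (simp add: word_monomial_def monomial_def)
next
  case (Cons b w)
  then have "monomial (restrict (count_list (b # w)) Basis) v =
      (\<Prod>c\<in>Basis. (if c = b then v \<bullet> c else 1) * (v \<bullet> c) ^ count_list w c)"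
    by (auto simp: monomial_def intro!: prod.cong)
  also have "\<dots> = (v \<bullet> b) * monomial (restrict (count_list w) Basis) v"
    using Cons.prems by (simp add: prod.distrib monomial_def prod.delta)
  also have "monomial (restrict (count_list w) Basis) v = word_monomial w v"
    using Cons.IH Cons.prems by (simp only: list.set insert_subset)
  also have "(v \<bullet> b) * word_monomial w v = word_monomial (b # w) v"
    by (simp add: word_monomial_def)
  finally show ?case ..
qed

lemma abs_word_monomial_le: "set w \<subseteq> Basis \<Longrightarrow> \<bar>word_monomial w v\<bar> \<le> norm v ^ length w"
  by (induction w) (auto simp: word_monomial_def abs_mult Basis_le_norm intro!: mult_mono)

lemma mean_value_on_has_power_series_at:
  fixes u :: "'a::euclidean_space \<Rightarrow> real"
  assumes "open U" and mv: "mean_value_on U u" and "a \<in> U"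
  shows "has_power_series_at u a"
proof -
  define C where "C = gradient_const TYPE('a)"
  have "C > 0" unfolding C_def by (rule gradient_const_pos)
  obtain R where R: "R > 0" "cball a R \<subseteq> U"
    using \<open>open U\<close> \<open>a \<in> U\<close> open_contains_cball by blast
  have "continuous_on (cball a R) u"
    using mv R(2) continuous_on_subset unfolding mean_value_on_def by blast
  then have "bounded (u ` cball a R)"
    by (intro compact_imp_bounded compact_continuous_image compact_cball)
  then obtain M where M: "\<And>y. y \<in> cball a R \<Longrightarrow> \<bar>u y\<bar> \<le> M"
    unfolding bounded_iff by (metis imageI real_norm_def)
  have "0 \<le> M" using M[of a] R(1) by (auto intro: order_trans[OF abs_ge_zero])
  have word_bound: "\<bar>fold pderivative w u y\<bar> \<le> (2 * C / R * n) ^ n * M"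
    if w: "w \<in> words n" and y: "y \<in> cball a (R / 2)" for w n y
  proof (cases "n = 0")
    case True
    then show ?thesis using w y M[of y] R(1) by (simp add: words_def)
  next
    case False
    \<comment> \<open>The \<open>n\<close> layers of width \<open>R / (2 * n)\<close> use up half of
      the radius and leave the ball of radius \<open>R / 2\<close>.\<close>
    have "\<bar>fold pderivative w u y\<bar> \<le> (C / (R / (2 * n))) ^ length w * M"
      unfolding C_def using w y False R
      by (intro fold_pderivative_bound[OF _ \<open>open U\<close> mv _ R(2)] M) (auto simp: words_def)
    then show ?thesis using w False by (simp add: words_def field_simps)
  qed
  \<comment> \<open>The first bound keeps the segment in the half ball. There are
    \<open>DIM('a) ^ n\<close> words of length \<open>n\<close>, each contributing at most
    \<open>(norm v * (2 * C / R) * exp 1) ^ n * M\<close>; the second bound turns the total into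
    \<open>(1 / 2) ^ n * M\<close>.\<close>
  define \<delta> where "\<delta> = min (R / 2) (R / (4 * DIM('a) * C * exp 1))"
  have "\<delta> > 0" using R(1) \<open>C > 0\<close> by (simp add: \<delta>_def)
  define d where "d n w = fold pderivative w u a / fact n" for n w
  show ?thesis
  proof (rule has_power_series_atI[where \<alpha> = "\<lambda>(n, w). restrict (count_list w) Basis"
        and d = "\<lambda>(n, w). d n w" and I = "Sigma UNIV words"])
    show "\<delta> > 0" by fact
    fix v :: 'a assume v: "norm v < \<delta>"
    have line: "a + t *\<^sub>R v \<in> cball a (R / 2)" if "0 \<le> t" "t \<le> 1" for t
      using that v mult_left_le_one_le[of "norm v" t] by (simp add: dist_norm \<delta>_def)
    \<comment> \<open>The \<open>n\<close>-th derivative of \<open>u\<close> along the segment, as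
      \<open>F_DERIV\<close> shows.\<close>
    define F where "F n t = (\<Sum>w\<in>words n. word_monomial w v * fold pderivative w u (a + t *\<^sub>R v))" for n t
    have term_bound: "\<bar>word_monomial w v * fold pderivative w u (a + t *\<^sub>R v)\<bar> / fact n \<le>
        (norm v * (2 * C / R) * exp 1) ^ n * M" if "w \<in> words n" "0 \<le> t" "t \<le> 1" for w n t
    proof -
      have "\<bar>word_monomial w v * fold pderivative w u (a + t *\<^sub>R v)\<bar> \<le>
          norm v ^ n * ((2 * C / R * n) ^ n * M)"
        unfolding abs_mult using that line word_bound abs_word_monomial_le[of w v]
        by (intro mult_mono) (auto simp: words_def)
      also have "\<dots> = (norm v * (2 * C / R)) ^ n * M * real n ^ n"
        by (simp only: power_mult_distrib mult_ac)
      also have "\<dots> \<le> (norm v * (2 * C / R)) ^ n * M * (exp 1 ^ n * fact n)"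
        using \<open>0 \<le> M\<close> \<open>C > 0\<close> R(1) by (intro mult_left_mono power_self_le_exp_fact) auto
      finally show ?thesis
        by (simp add: field_simps power_mult_distrib)
    qed
    have sum_bound: "(\<Sum>w\<in>words n. \<bar>word_monomial w v * fold pderivative w u (a + t *\<^sub>R v)\<bar> / fact n) \<le>
        (1 / 2) ^ n * M" if "0 \<le> t" "t \<le> 1" for n t
    proof -
      have "(\<Sum>w\<in>words n. \<bar>word_monomial w v * fold pderivative w u (a + t *\<^sub>R v)\<bar> / fact n) \<le>
          card (words n :: 'a list set) * ((norm v * (2 * C / R) * exp 1) ^ n * M)"
        using term_bound that by (intro sum_bounded_above) auto
      also have "\<dots> = (norm v * (2 * C / R * exp 1 * DIM('a))) ^ n * M"
        by (simp only: card_words of_nat_power power_mult_distrib mult_ac)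
      also have "\<dots> \<le> (1 / 2) ^ n * M"
      proof (intro mult_right_mono power_mono)
        have "norm v * (2 * C / R * exp 1 * DIM('a)) \<le> R / (4 * DIM('a) * C * exp 1) * (2 * C / R * exp 1 * DIM('a))"
          using v \<open>C > 0\<close> R(1) by (intro mult_right_mono) (auto simp: \<delta>_def)
        also have "\<dots> = 1 / 2" using \<open>C > 0\<close> R(1) by (simp add: field_simps)
        finally show "norm v * (2 * C / R * exp 1 * DIM('a)) \<le> 1 / 2" .
      qed (use \<open>0 \<le> M\<close> \<open>C > 0\<close> R(1) in auto)
      finally show ?thesis .
    qed
    have F_bound: "\<bar>F n t / fact n\<bar> \<le> (1 / 2) ^ n * M" if "0 \<le> t" "t \<le> 1" for n t
    proof -
      have "\<bar>F n t / fact n\<bar> \<le> (\<Sum>w\<in>words n. \<bar>word_monomial w v * fold pderivative w u (a + t *\<^sub>R v)\<bar>) / fact n"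
        unfolding F_def by (simp add: divide_right_mono)
      also have "\<dots> \<le> (1 / 2) ^ n * M"
        using sum_bound[OF that, of n] by (simp add: sum_divide_distrib)
      finally show ?thesis .
    qed
    have F_DERIV: "(F n has_real_derivative F (Suc n) t) (at t)" if "0 \<le> t" "t \<le> 1" for n t
    proof -
      have "a + t *\<^sub>R v \<in> U" using line[OF that] R by (auto dest!: subsetD)
      then have "(F n has_real_derivative (\<Sum>w\<in>words n. word_monomial w v *
          (\<Sum>b\<in>Basis. (v \<bullet> b) * pderivative b (fold pderivative w u) (a + t *\<^sub>R v)))) (at t)"
        unfolding F_def
        by (intro DERIV_sum DERIV_cmult mean_value_on_line_DERIV[OF \<open>open U\<close>] mean_value_on_fold_pderivative[OF \<open>open U\<close> mv])
      also have "(\<Sum>w\<in>words n. word_monomial w v *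
          (\<Sum>b\<in>Basis. (v \<bullet> b) * pderivative b (fold pderivative w u) (a + t *\<^sub>R v))) =
          (\<Sum>p\<in>words n \<times> Basis. (\<lambda>w. word_monomial w v * fold pderivative w u (a + t *\<^sub>R v)) ((\<lambda>(w, b). w @ [b]) p))"
        by (simp add: sum_distrib_left sum.cartesian_product case_prod_unfold word_monomial_def mult.assoc)
      also have "\<dots> = F (Suc n) t"
        unfolding F_def by (rule sum.reindex_bij_betw[OF bij_betw_words_Suc])
      finally show ?thesis .
    qed
    have "(\<lambda>n. F n 0 / fact n) sums u (a + v)"
      unfolding sums_def
    proof (rule LIM_zero_cancel, rule tendsto_rabs_zero_cancel, rule tendsto_sandwich[OF _ _ tendsto_const])
      show "(\<lambda>n. (1 / 2) ^ n * M) \<longlonglongrightarrow> 0"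
        by (intro tendsto_mult_left_zero LIMSEQ_realpow_zero) auto
      show "\<forall>\<^sub>F n in sequentially. \<bar>(\<Sum>i<n. F i 0 / fact i) - u (a + v)\<bar> \<le> (1 / 2) ^ n * M"
      proof (rule always_eventually, rule allI)
        fix n
        have "\<exists>t. 0 < t \<and> t \<le> 1 \<and> (\<lambda>t. u (a + t *\<^sub>R v)) 1 = (\<Sum>m<n. F m 0 / fact m * 1 ^ m) + F n t / fact n * 1 ^ n"
        proof (rule Maclaurin2)
          have "words 0 = {[] :: 'a list}" by (auto simp: words_def)
          then show "F 0 = (\<lambda>t. u (a + t *\<^sub>R v))" by (simp add: F_def[abs_def] word_monomial_def)
        qed (use F_DERIV in auto)
        then show "\<bar>(\<Sum>i<n. F i 0 / fact i) - u (a + v)\<bar> \<le> (1 / 2) ^ n * M"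
          using F_bound by auto
      qed
    qed auto
    moreover have "summable (\<lambda>n. norm (F n 0 / fact n))"
      by (rule summable_comparison_test'[where N = 0 and g = "\<lambda>n. (1 / 2) ^ n * M"])
        (use F_bound[of 0] in \<open>auto intro!: summable_mult2 summable_geometric\<close>)
    ultimately have outer: "((\<lambda>n. F n 0 / fact n) has_sum u (a + v)) UNIV"
      by (rule norm_summable_imp_has_sum[rotated])
    have inner: "((\<lambda>w. d n w * word_monomial w v) has_sum F n 0 / fact n) (words n)" for n
      by (rule has_sum_finiteI[OF finite_words]) (simp add: F_def d_def sum_divide_distrib mult.commute)
    have "((\<lambda>(n, w). d n w * word_monomial w v) has_sum u (a + v)) (Sigma UNIV words)"
    proof (rule has_sum_SigmaI[OF _ outer])
      \<comment> \<open>Unconditional summation over all words needs a bound on the sums of absolute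
        values, hence \<open>sum_bound\<close> rather than the weaker
        \<open>F_bound\<close>.\<close>
      have "(\<lambda>p. norm (case p of (n, w) \<Rightarrow> d n w * word_monomial w v)) summable_on Sigma UNIV words"
      proof (rule summable_on_SigmaI)
        show "((\<lambda>w. norm (case (n, w) of (n, w) \<Rightarrow> d n w * word_monomial w v)) has_sum
            (\<Sum>w\<in>words n. \<bar>word_monomial w v * fold pderivative w u (a + 0 *\<^sub>R v)\<bar> / fact n)) (words n)" for n
          by (rule has_sum_finiteI[OF finite_words]) (simp add: d_def abs_mult mult.commute)
        show "(\<lambda>n. \<Sum>w\<in>words n. \<bar>word_monomial w v * fold pderivative w u (a + 0 *\<^sub>R v)\<bar> / fact n) summable_on UNIV"
        proof (rule norm_summable_imp_summable_on, rule summable_comparison_test'[where N = 0 and g = "\<lambda>n. (1 / 2) ^ n * M"])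
          show "summable (\<lambda>n. (1 / 2) ^ n * M)"
            by (intro summable_mult2 summable_geometric) simp
          show "norm (norm (\<Sum>w\<in>words n. \<bar>word_monomial w v * fold pderivative w u (a + 0 *\<^sub>R v)\<bar> / fact n)) \<le>
              (1 / 2) ^ n * M" for n
            using sum_bound[of 0 n] by (simp add: sum_nonneg)
        qed
      qed auto
      then show "(\<lambda>(n, w). d n w * word_monomial w v) summable_on Sigma UNIV words"
        by (rule abs_summable_summable)
    qed (use inner in simp)
    then show "((\<lambda>i. (case i of (n, w) \<Rightarrow> d n w) * monomial (case i of (n, w) \<Rightarrow> restrict (count_list w) Basis) v)
        has_sum u (a + v)) (Sigma UNIV words)"
      by (rule has_sum_cong[THEN iffD1, rotated]) (auto simp: word_monomial_eq words_def)
  qed auto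
qed

section \<open>Reduction of the Helmholtz equation to harmonic functions\<close>

lemma sum_Basis_prod_real:
  "(\<Sum>b\<in>Basis. f (b :: 'a::euclidean_space \<times> real)) = (\<Sum>b\<in>Basis. f (b, 0)) + f (0, 1)"
proof -
  have "(\<Sum>b\<in>Basis. f (b :: 'a \<times> real)) = sum f ((\<lambda>u. (u, 0)) ` Basis) + sum f ((\<lambda>v. (0, v)) ` Basis)"
    unfolding Basis_prod_def by (rule sum.union_disjoint) auto
  also have "sum f ((\<lambda>u. (u, 0)) ` Basis) = (\<Sum>b\<in>Basis. f (b, 0))"
    by (subst sum.reindex) (auto intro: inj_onI)
  finally show ?thesis by simp
qed

text \<open>The squared distance in the product splits into two parts, and on a slice the part of
  the fixed factor becomes the offset. The third identity reads the same function as a slice in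
  either direction.\<close>

lemma radial_test_prod:
  fixes x \<xi> :: "'a::euclidean_space" and t \<tau> :: real
  shows "radial_test'' 0 d (x, t) (b, 0) (\<xi>, \<tau>) = radial_test'' (d * (\<tau> - t)\<^sup>2) d x b \<xi>"
    and "radial_test'' 0 d (x, t) (0, 1) (\<xi>, \<tau>) = radial_test'' (d * ((\<xi> - x) \<bullet> (\<xi> - x))) d t 1 \<tau>"
    and "radial_test (d * (\<tau> - t)\<^sup>2) d x \<xi> = radial_test (d * ((\<xi> - x) \<bullet> (\<xi> - x))) d t \<tau>"
  by (simp_all add: radial_test''_def radial_test_def algebra_simps power2_eq_square)

lemma DERIV_radial_test_real:
  fixes x :: real
  shows "(radial_test c d x has_real_derivative radial_test' c d x 1 y) (at y within A)"
    and "(radial_test' c d x 1 has_real_derivative radial_test'' c d x 1 y) (at y within A)"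
proof -
  have q: "((\<lambda>y. c + d * ((y - x) \<bullet> (y - x))) has_real_derivative 2 * d * ((y - x) \<bullet> 1)) (at y within A)"
    by (auto intro!: derivative_eq_intros)
  from DERIV_chain2[OF DERIV_cutoff this]
  show "(radial_test c d x has_real_derivative radial_test' c d x 1 y) (at y within A)"
    by (simp add: radial_test_def[abs_def] radial_test'_def)
  have "((\<lambda>y. 2 * d * ((y - x) \<bullet> 1)) has_real_derivative 2 * d) (at y within A)"
    by (auto intro!: derivative_eq_intros)
  from DERIV_mult[OF DERIV_chain2[OF DERIV_cutoff q, of 1] this]
  show "(radial_test' c d x 1 has_real_derivative radial_test'' c d x 1 y) (at y within A)"
    unfolding radial_test'_def[abs_def] radial_test''_def
    by (rule DERIV_cong) (simp add: power2_eq_square numeral_2_eq_2 algebra_simps)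
qed

lemma radial_test_eq_0:
  assumes "0 \<le> c" "0 < s" "s \<le> norm (y - x)"
  shows "radial_test c (1 / s\<^sup>2) x y = 0" "radial_test' c (1 / s\<^sup>2) x b y = 0" "radial_test'' c (1 / s\<^sup>2) x b y = 0"
proof -
  have "s\<^sup>2 \<le> (y - x) \<bullet> (y - x)"
    using assms(2,3) by (simp add: power_mono flip: power2_norm_eq_inner)
  then have "1 \<le> 1 / s\<^sup>2 * ((y - x) \<bullet> (y - x))" using \<open>0 < s\<close> by (simp add: field_simps)
  then have "1 \<le> c + 1 / s\<^sup>2 * ((y - x) \<bullet> (y - x))" using \<open>0 \<le> c\<close> by linarith
  from cutoff_eq_0[OF this]
  show "radial_test c (1 / s\<^sup>2) x y = 0" "radial_test' c (1 / s\<^sup>2) x b y = 0" "radial_test'' c (1 / s\<^sup>2) x b y = 0"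
    unfolding radial_test_def radial_test'_def radial_test''_def by simp_all
qed

lemma continuous_on_radial_test [continuous_intros]:
  assumes "continuous_on S c" "continuous_on S f"
  shows "continuous_on S (\<lambda>y. radial_test (c y) d x (f y))" "continuous_on S (\<lambda>y. radial_test'' (c y) d x b (f y))"
  unfolding radial_test_def radial_test''_def by (intro continuous_intros assms)+

text \<open>Two integrations by parts at once: both boundary terms vanish because the test function
  and its derivative are zero at distance \<open>r \<ge> s\<close> from \<open>t\<close>.\<close>

lemma integral_exp_radial_test:
  fixes t :: real
  assumes e: "\<And>t. (e has_real_derivative e' t) (at t)" "\<And>t. (e' has_real_derivative lam * e t) (at t)"
    and "0 \<le> c" "0 < s" "s \<le> r"
  shows "integral {t - r..t + r} (\<lambda>\<tau>. e \<tau> * radial_test'' c (1 / s\<^sup>2) t 1 \<tau>) =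
    lam * integral {t - r..t + r} (\<lambda>\<tau>. e \<tau> * radial_test c (1 / s\<^sup>2) t \<tau>)"
proof -
  define d where "d = 1 / s\<^sup>2"
  \<comment> \<open>In the derivative of this Wronskian the products of first derivatives cancel,
    leaving the difference of the two integrands.\<close>
  define W where "W \<tau> = e \<tau> * radial_test' c d t 1 \<tau> - e' \<tau> * radial_test c d t \<tau>" for \<tau>
  have e_cont: "continuous_on A e" for A
    by (intro continuous_at_imp_continuous_on ballI DERIV_isCont[OF e(1)])
  have "(W has_real_derivative e \<tau> * radial_test'' c d t 1 \<tau> - lam * (e \<tau> * radial_test c d t \<tau>)) (at \<tau> within A)" for \<tau> A
    unfolding W_def
    by (rule derivative_eq_intros has_field_derivative_at_within[OF e(1)] has_field_derivative_at_within[OF e(2)]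
      DERIV_radial_test_real refl)+ (simp add: algebra_simps)
  then have "((\<lambda>\<tau>. e \<tau> * radial_test'' c d t 1 \<tau> - lam * (e \<tau> * radial_test c d t \<tau>)) has_integral
      W (t + r) - W (t - r)) {t - r..t + r}"
    using assms(4,5)
    by (intro fundamental_theorem_of_calculus) (auto simp flip: has_real_derivative_iff_has_vector_derivative)
  moreover have "W (t + r) = 0" "W (t - r) = 0"
    using radial_test_eq_0[OF assms(3,4), of "t + r" t] radial_test_eq_0[OF assms(3,4), of "t - r" t] assms(4,5)
    by (simp_all add: W_def d_def)
  ultimately have "((\<lambda>\<tau>. e \<tau> * radial_test'' c d t 1 \<tau> - lam * (e \<tau> * radial_test c d t \<tau>)) has_integral 0) {t - r..t + r}"
    by simp
  moreover have "(\<lambda>\<tau>. e \<tau> * radial_test'' c d t 1 \<tau>) integrable_on {t - r..t + r}"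
    "(\<lambda>\<tau>. e \<tau> * radial_test c d t \<tau>) integrable_on {t - r..t + r}"
    by (intro integrable_continuous_interval continuous_intros e_cont)+
  then have "((\<lambda>\<tau>. e \<tau> * radial_test'' c d t 1 \<tau> - lam * (e \<tau> * radial_test c d t \<tau>)) has_integral
      integral {t - r..t + r} (\<lambda>\<tau>. e \<tau> * radial_test'' c d t 1 \<tau>) -
      lam * integral {t - r..t + r} (\<lambda>\<tau>. e \<tau> * radial_test c d t \<tau>)) {t - r..t + r}"
    by (intro has_integral_diff has_integral_mult_right integrable_integral)
  ultimately show ?thesis
    unfolding d_def by (metis (no_types, lifting) has_integral_unique eq_iff_diff_eq_0)
qed

text \<open>The weak form of \<open>\<Delta> g + lam g = 0\<close> near \<open>x\<close>, tested with radial functions only.\<close>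

definition weak_helmholtz_at :: "real \<Rightarrow> ('a::euclidean_space \<Rightarrow> real) \<Rightarrow> 'a \<Rightarrow> real \<Rightarrow> bool" where
  "weak_helmholtz_at lam g x r \<longleftrightarrow> (\<forall>c s. 0 \<le> c \<longrightarrow> 0 < s \<longrightarrow> s \<le> r \<longrightarrow>
     integral (cbox (x - r *\<^sub>R One) (x + r *\<^sub>R One)) (\<lambda>y. g y * (\<Sum>b\<in>Basis. radial_test'' c (1 / s\<^sup>2) x b y)) =
     - lam * integral (cbox (x - r *\<^sub>R One) (x + r *\<^sub>R One)) (\<lambda>y. g y * radial_test c (1 / s\<^sup>2) x y))"

text \<open>If \<open>\<Delta> g + lam g = 0\<close> and \<open>e'' = lam e\<close>, then \<open>g x * e t\<close> is harmonic.\<close>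

lemma weak_harmonic_lift:
  fixes g :: "'a::euclidean_space \<Rightarrow> real"
  assumes g: "continuous_on UNIV g" and wh: "weak_helmholtz_at lam g x r"
    and e: "\<And>t. (e has_real_derivative e' t) (at t)" "\<And>t. (e' has_real_derivative lam * e t) (at t)"
    and s: "0 < s" "s \<le> r"
  shows "integral (cbox ((x, t) - r *\<^sub>R One) ((x, t) + r *\<^sub>R One))
     (\<lambda>p. g (fst p) * e (snd p) * (\<Sum>b\<in>Basis. radial_test'' 0 (1 / s\<^sup>2) (x, t) b p)) = 0"
proof -
  define d where "d = 1 / s\<^sup>2"
  have "d \<ge> 0" by (simp add: d_def)
  define X where "X = cbox (x - r *\<^sub>R One) (x + r *\<^sub>R One)"
  define T where "T = cbox (t - r) (t + r)"
  \<comment> \<open>\<open>G1\<close> and \<open>G2\<close> are the shares of the old directions and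
    of the added direction in the Laplacian. Slicing reduces their integrals to \<open>- lam\<close>
    and \<open>lam\<close> times the same double integral of \<open>G\<close>, so they
    cancel.\<close>
  define G where "G \<xi> \<tau> = g \<xi> * e \<tau> * radial_test (d * (\<tau> - t)\<^sup>2) d x \<xi>" for \<xi> \<tau>
  define G1 where "G1 \<xi> \<tau> = g \<xi> * e \<tau> * (\<Sum>b\<in>Basis. radial_test'' (d * (\<tau> - t)\<^sup>2) d x b \<xi>)" for \<xi> \<tau>
  define G2 where "G2 \<xi> \<tau> = g \<xi> * e \<tau> * radial_test'' (d * ((\<xi> - x) \<bullet> (\<xi> - x))) d t 1 \<tau>" for \<xi> \<tau>
  have One: "(One :: 'a \<times> real) = (One, 1)"
    using sum_Basis_prod_real[of "\<lambda>b. b"] by (simp add: sum_prod)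
  have e_cont: "continuous_on A e" for A
    by (intro continuous_at_imp_continuous_on ballI DERIV_isCont[OF e(1)])
  note cont = continuous_intros continuous_on_compose2[OF g] continuous_on_compose2[OF e_cont[of UNIV]]
  have cont_pair: "continuous_on A (\<lambda>(\<xi>, \<tau>). G \<xi> \<tau>)" "continuous_on A (\<lambda>(\<xi>, \<tau>). G1 \<xi> \<tau>)"
    "continuous_on A (\<lambda>(\<xi>, \<tau>). G2 \<xi> \<tau>)" for A
    unfolding G_def G1_def G2_def case_prod_unfold by (intro cont; simp)+
  have cbox: "cbox ((x, t) - r *\<^sub>R One) ((x, t) + r *\<^sub>R One) =
      cbox (x - r *\<^sub>R One, t - r) (x + r *\<^sub>R One, t + r)"
    by (simp add: One)
  have split: "g (fst p) * e (snd p) * (\<Sum>b\<in>Basis. radial_test'' 0 d (x, t) b p) =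
      G1 (fst p) (snd p) + G2 (fst p) (snd p)" for p
    by (cases p) (simp add: sum_Basis_prod_real radial_test_prod G1_def G2_def distrib_left)
  have "integral (cbox (x - r *\<^sub>R One, t - r) (x + r *\<^sub>R One, t + r)) (\<lambda>(\<xi>, \<tau>). G1 \<xi> \<tau>) =
      integral X (\<lambda>\<xi>. integral T (\<lambda>\<tau>. G1 \<xi> \<tau>))"
    unfolding X_def T_def using integral_prod_continuous[OF cont_pair(2)] by simp
  also have "\<dots> = integral T (\<lambda>\<tau>. integral X (\<lambda>\<xi>. G1 \<xi> \<tau>))"
    unfolding X_def T_def by (rule integral_swap_continuous[OF cont_pair(2)])
  also have "\<dots> = integral T (\<lambda>\<tau>. - lam * integral X (\<lambda>\<xi>. G \<xi> \<tau>))"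
  proof (rule integral_cong)
    fix \<tau>
    have "integral X (\<lambda>\<xi>. G1 \<xi> \<tau>) = e \<tau> * integral X (\<lambda>y. g y * (\<Sum>b\<in>Basis. radial_test'' (d * (\<tau> - t)\<^sup>2) d x b y))"
      unfolding G1_def by (subst Henstock_Kurzweil_Integration.integral_mult_right[symmetric]) (simp add: mult_ac)
    also have "\<dots> = e \<tau> * (- lam * integral X (\<lambda>y. g y * radial_test (d * (\<tau> - t)\<^sup>2) d x y))"
      using wh s \<open>d \<ge> 0\<close> unfolding weak_helmholtz_at_def X_def d_def by simp
    also have "\<dots> = - lam * (e \<tau> * integral X (\<lambda>y. g y * radial_test (d * (\<tau> - t)\<^sup>2) d x y))"
      by simp
    also have "e \<tau> * integral X (\<lambda>y. g y * radial_test (d * (\<tau> - t)\<^sup>2) d x y) = integral X (\<lambda>\<xi>. G \<xi> \<tau>)"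
      unfolding G_def by (subst Henstock_Kurzweil_Integration.integral_mult_right[symmetric]) (simp add: mult_ac)
    finally show "integral X (\<lambda>\<xi>. G1 \<xi> \<tau>) = - lam * integral X (\<lambda>\<xi>. G \<xi> \<tau>)" .
  qed
  also have "\<dots> = - lam * integral T (\<lambda>\<tau>. integral X (\<lambda>\<xi>. G \<xi> \<tau>))"
    by (rule Henstock_Kurzweil_Integration.integral_mult_right)
  also have "integral T (\<lambda>\<tau>. integral X (\<lambda>\<xi>. G \<xi> \<tau>)) = integral X (\<lambda>\<xi>. integral T (\<lambda>\<tau>. G \<xi> \<tau>))"
    unfolding X_def T_def by (rule integral_swap_continuous[OF cont_pair(1), symmetric])
  finally have I1: "integral (cbox (x - r *\<^sub>R One, t - r) (x + r *\<^sub>R One, t + r)) (\<lambda>(\<xi>, \<tau>). G1 \<xi> \<tau>) =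
      - lam * integral X (\<lambda>\<xi>. integral T (\<lambda>\<tau>. G \<xi> \<tau>))" .
  have "integral (cbox (x - r *\<^sub>R One, t - r) (x + r *\<^sub>R One, t + r)) (\<lambda>(\<xi>, \<tau>). G2 \<xi> \<tau>) =
      integral X (\<lambda>\<xi>. integral T (\<lambda>\<tau>. G2 \<xi> \<tau>))"
    unfolding X_def T_def using integral_prod_continuous[OF cont_pair(3)] by simp
  also have "\<dots> = integral X (\<lambda>\<xi>. lam * integral T (\<lambda>\<tau>. G \<xi> \<tau>))"
  proof (rule integral_cong)
    fix \<xi>
    have "integral T (\<lambda>\<tau>. G2 \<xi> \<tau>) = g \<xi> * integral T (\<lambda>\<tau>. e \<tau> * radial_test'' (d * ((\<xi> - x) \<bullet> (\<xi> - x))) d t 1 \<tau>)"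
      unfolding G2_def by (subst Henstock_Kurzweil_Integration.integral_mult_right[symmetric]) (simp add: mult_ac)
    also have "\<dots> = g \<xi> * (lam * integral T (\<lambda>\<tau>. e \<tau> * radial_test (d * ((\<xi> - x) \<bullet> (\<xi> - x))) d t \<tau>))"
      using integral_exp_radial_test[OF e, of "d * ((\<xi> - x) \<bullet> (\<xi> - x))" s r t] s \<open>d \<ge> 0\<close>
      by (simp add: T_def d_def cbox_interval)
    also have "\<dots> = lam * (g \<xi> * integral T (\<lambda>\<tau>. e \<tau> * radial_test (d * ((\<xi> - x) \<bullet> (\<xi> - x))) d t \<tau>))"
      by simp
    also have "g \<xi> * integral T (\<lambda>\<tau>. e \<tau> * radial_test (d * ((\<xi> - x) \<bullet> (\<xi> - x))) d t \<tau>) = integral T (\<lambda>\<tau>. G \<xi> \<tau>)"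
      unfolding G_def radial_test_prod(3)
      by (subst Henstock_Kurzweil_Integration.integral_mult_right[symmetric]) (simp add: mult_ac)
    finally show "integral T (\<lambda>\<tau>. G2 \<xi> \<tau>) = lam * integral T (\<lambda>\<tau>. G \<xi> \<tau>)" .
  qed
  also have "\<dots> = lam * integral X (\<lambda>\<xi>. integral T (\<lambda>\<tau>. G \<xi> \<tau>))"
    by (rule Henstock_Kurzweil_Integration.integral_mult_right)
  finally have I2: "integral (cbox (x - r *\<^sub>R One, t - r) (x + r *\<^sub>R One, t + r)) (\<lambda>(\<xi>, \<tau>). G2 \<xi> \<tau>) =
      lam * integral X (\<lambda>\<xi>. integral T (\<lambda>\<tau>. G \<xi> \<tau>))" .
  have "integral (cbox (x - r *\<^sub>R One, t - r) (x + r *\<^sub>R One, t + r)) (\<lambda>p. G1 (fst p) (snd p) + G2 (fst p) (snd p)) = 0"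
    using I1 I2 cont_pair(2,3)
    by (subst Henstock_Kurzweil_Integration.integral_add)
      (auto simp: case_prod_unfold intro!: integrable_continuous)
  then show ?thesis
    unfolding cbox split[unfolded d_def] by (simp add: d_def)
qed

text \<open>With \<open>q\<close> the squared distance and \<open>n\<close> the dimension, the
  Laplacian of the test function is \<open>cutoff 2 (q / s\<^sup>2) * 4 * q / s ^ 4 + cutoff 1 (q /
  s\<^sup>2) * 2 * n / s\<^sup>2\<close>. The chain and product rules on the left give the same two
  terms, in the same proportion.\<close>

lemma DERIV_scaled_bump:
  fixes y p :: "'a::euclidean_space"
  assumes "s > 0"
  shows "((\<lambda>s. bump ((1 / s) *\<^sub>R (y - p)) / s ^ DIM('a)) has_real_derivative
    - (1 / 2) * (s / s ^ DIM('a)) * (\<Sum>b\<in>Basis. radial_test'' 0 (1 / s\<^sup>2) p b y)) (at s within A)"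
proof -
  define q where "q = (y - p) \<bullet> (y - p)"
  obtain n where n: "DIM('a) = Suc n"
    using DIM_positive[where 'a='a] gr0_implies_Suc by blast
  have 1: "((\<lambda>s. q / s\<^sup>2) has_real_derivative - 2 * q / s ^ 3) (at s within A)"
    using assms by (auto intro!: derivative_eq_intros simp: field_simps eval_nat_numeral)
  have 2: "((\<lambda>s. inverse (s ^ Suc n)) has_real_derivative - (real (Suc n) * s ^ n) / (s ^ Suc n)\<^sup>2) (at s within A)"
    by (rule DERIV_cong[OF DERIV_inverse'[OF DERIV_pow]])
      (use assms in \<open>simp_all add: divide_inverse power2_eq_square mult_ac\<close>)
  have "(\<Sum>b\<in>Basis. radial_test'' 0 (1 / s\<^sup>2) p b y) =
      cutoff 2 (q / s\<^sup>2) * (4 / s ^ 4) * (\<Sum>b\<in>Basis. ((y - p) \<bullet> b)\<^sup>2) + cutoff 1 (q / s\<^sup>2) * (2 / s\<^sup>2) * DIM('a)"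
    by (simp add: radial_test''_def q_def sum.distrib power_mult_distrib power_divide sum_distrib_left mult.assoc)
  also have "(\<Sum>b\<in>Basis. ((y - p) \<bullet> b)\<^sup>2) = q"
    unfolding q_def power2_eq_square by (rule euclidean_inner[symmetric])
  finally have lap: "(\<Sum>b\<in>Basis. radial_test'' 0 (1 / s\<^sup>2) p b y) =
      cutoff 2 (q / s\<^sup>2) * (4 / s ^ 4) * q + cutoff 1 (q / s\<^sup>2) * (2 / s\<^sup>2) * DIM('a)" .
  \<comment> \<open>Replacing \<open>s ^ n\<close> by a positive \<open>a\<close> turns the
    comparison into an identity of rational functions.\<close>
  have alg: "c2 * (- 2 * q / s ^ 3) * inverse (s * a) + (- (N * a) / (s * a)\<^sup>2) * c1 =
      - (1 / 2) * (s / (s * a)) * (c2 * (4 / s ^ 4) * q + c1 * (2 / s\<^sup>2) * N)" if "0 < a" for a c1 c2 N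
    using assms that by (simp add: divide_simps) (simp add: algebra_simps eval_nat_numeral)
  have "((\<lambda>s. cutoff 1 (q / s\<^sup>2) * inverse (s ^ Suc n)) has_real_derivative
      cutoff (Suc 1) (q / s\<^sup>2) * (- 2 * q / s ^ 3) * inverse (s ^ Suc n) +
      (- (real (Suc n) * s ^ n) / (s ^ Suc n)\<^sup>2) * cutoff 1 (q / s\<^sup>2)) (at s within A)"
    by (rule DERIV_mult[OF DERIV_chain2[OF DERIV_cutoff 1] 2])
  moreover have "cutoff (Suc 1) (q / s\<^sup>2) * (- 2 * q / s ^ 3) * inverse (s ^ Suc n) +
      (- (real (Suc n) * s ^ n) / (s ^ Suc n)\<^sup>2) * cutoff 1 (q / s\<^sup>2) =
      - (1 / 2) * (s / s ^ DIM('a)) * (\<Sum>b\<in>Basis. radial_test'' 0 (1 / s\<^sup>2) p b y)"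
    unfolding lap n power_Suc using alg[of "s ^ n"] assms by (simp only: zero_less_power One_nat_def numeral_2_eq_2)
  moreover have "(\<lambda>s. cutoff 1 (q / s\<^sup>2) * inverse (s ^ Suc n)) = (\<lambda>s. bump ((1 / s) *\<^sub>R (y - p)) / s ^ DIM('a))"
    by (simp add: fun_eq_iff bump_def q_def n divide_inverse power2_eq_square mult_ac)
  ultimately show ?thesis by simp
qed

text \<open>As a function of the radius the average has derivative zero on the open interval and is
  continuous on the closed one; at radius 0 it is \<open>V p\<close> times the mass.\<close>

lemma avg_bump_const:
  fixes V :: "'a::euclidean_space \<Rightarrow> real"
  assumes V: "continuous_on UNIV V" and "r > 0"
    and harm: "\<And>s. 0 < s \<Longrightarrow> s < r \<Longrightarrow> integral (cbox (p - r *\<^sub>R One) (p + r *\<^sub>R One))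
        (\<lambda>y. V y * (\<Sum>b\<in>Basis. radial_test'' 0 (1 / s\<^sup>2) p b y)) = 0"
  shows "avg bump V p r = V p * bump_mass TYPE('a)"
proof -
  define Q where "Q = cbox (p - r *\<^sub>R One) (p + r *\<^sub>R One)"
  \<comment> \<open>Substituting \<open>y = p + s *\<^sub>R z\<close> moves the radius from
    \<open>V\<close>, which is only continuous, into the kernel, over a box independent of
    \<open>s\<close>.\<close>
  define K where "K s y = V y * (bump ((1 / s) *\<^sub>R (y - p)) / s ^ DIM('a))" for s y
  have K_cont: "continuous_on UNIV (K s)" for s
  proof (cases "s = 0")
    case True
    then have "K s = (\<lambda>_. 0)" by (simp add: K_def fun_eq_iff)
    then show ?thesis by simp
  next
    case False
    then show ?thesis
      unfolding K_def bump_def by (intro continuous_intros continuous_on_compose2[OF V]) auto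
  qed
  have avg_eq: "avg bump V p s = integral Q (K s)" if s: "0 < s" "s < r" for s
  proof -
    have "K s y = 0" if "y \<notin> Q" for y
    proof -
      have "y - p \<notin> cball 0 r"
        using that cball_subset_cbox_One[of r, where 'a='a] \<open>r > 0\<close>
        by (force simp: Q_def subset_iff mem_box algebra_simps)
      moreover have "norm ((1 / s) *\<^sub>R (y - p)) = norm (y - p) / s"
        using s by (simp only: norm_scaleR) simp
      ultimately have "1 \<le> norm ((1 / s) *\<^sub>R (y - p))" using s by simp
      then show ?thesis using ball_kernel_bump[where 'a='a] by (simp add: K_def ball_kernel_def)
    qed
    then have "integral Q (K s) = (LINT y|lborel. K s y)"
      unfolding Q_def by (rule lborel_integral_eq_integral_cbox(2)[OF K_cont, symmetric])
    also have "\<dots> = s ^ DIM('a) * (LINT z|lborel. K s (p + s *\<^sub>R z))"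
      using lborel_integral_affine_euclidean[OF borel_measurable_continuous_onI[OF K_cont], where r = s and c = p] s
      by simp
    also have "\<dots> = (LINT z|lborel. s ^ DIM('a) * K s (p + s *\<^sub>R z))" by simp
    also have "(\<lambda>z. s ^ DIM('a) * K s (p + s *\<^sub>R z)) = (\<lambda>z. V (p + s *\<^sub>R z) * bump z)"
      using s by (simp add: K_def fun_eq_iff)
    finally show ?thesis by (simp add: avg_lborel[OF V ball_kernel_bump])
  qed
  have avg_cont: "continuous_on {0..r} (\<lambda>s. avg bump V p s)"
  proof -
    have "continuous_on {0..r} (\<lambda>s::real. (p, s))" by (intro continuous_intros)
    from continuous_on_compose2[OF continuous_on_avg[OF V ball_kernel_bump] this] show ?thesis by simp
  qed
  have "((\<lambda>s. avg bump V p s) has_real_derivative 0) (at s)" if s: "0 < s" "s < r" for s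
  proof -
    have "((\<lambda>s. integral Q (K s)) has_real_derivative
        integral Q (\<lambda>y. V y * (- (1 / 2) * (s / s ^ DIM('a)) * (\<Sum>b\<in>Basis. radial_test'' 0 (1 / s\<^sup>2) p b y))))
        (at s within {0<..<r})"
      unfolding Q_def
    proof (rule leibniz_rule_field_derivative)
      show "((\<lambda>s. K s y) has_real_derivative
          V y * (- (1 / 2) * (s / s ^ DIM('a)) * (\<Sum>b\<in>Basis. radial_test'' 0 (1 / s\<^sup>2) p b y))) (at s within {0<..<r})"
        if "s \<in> {0<..<r}" for s y
        unfolding K_def using that by (intro DERIV_cmult DERIV_scaled_bump) auto
      show "K s integrable_on cbox (p - r *\<^sub>R One) (p + r *\<^sub>R One)" for s
        by (intro integrable_continuous continuous_on_subset[OF K_cont]) auto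
      show "continuous_on ({0<..<r} \<times> cbox (p - r *\<^sub>R One) (p + r *\<^sub>R One))
          (\<lambda>(s, y). V y * (- (1 / 2) * (s / s ^ DIM('a)) * (\<Sum>b\<in>Basis. radial_test'' 0 (1 / s\<^sup>2) p b y)))"
        unfolding case_prod_unfold radial_test''_def
        by (intro continuous_intros continuous_on_compose2[OF V]) auto
    qed (use s in auto)
    also have "integral Q (\<lambda>y. V y * (- (1 / 2) * (s / s ^ DIM('a)) * (\<Sum>b\<in>Basis. radial_test'' 0 (1 / s\<^sup>2) p b y))) =
        - (1 / 2) * (s / s ^ DIM('a)) * integral Q (\<lambda>y. V y * (\<Sum>b\<in>Basis. radial_test'' 0 (1 / s\<^sup>2) p b y))"
      by (subst Henstock_Kurzweil_Integration.integral_mult_right[symmetric]) (simp only: mult_ac)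
    also have "integral Q (\<lambda>y. V y * (\<Sum>b\<in>Basis. radial_test'' 0 (1 / s\<^sup>2) p b y)) = 0"
      unfolding Q_def by (rule harm[OF s])
    finally have "((\<lambda>s. integral Q (K s)) has_real_derivative 0) (at s)"
      using s by (simp add: at_within_open[of s "{0<..<r}"])
    moreover have ev: "\<forall>\<^sub>F s in nhds s. avg bump V p s = integral Q (K s)"
    proof -
      have "\<forall>\<^sub>F s in nhds s. s \<in> {0<..<r}" using s by (intro eventually_nhds_in_open) auto
      then show ?thesis by eventually_elim (auto intro: avg_eq)
    qed
    ultimately show ?thesis by (simp only: DERIV_cong_ev[OF refl ev refl])
  qed
  then have "avg bump V p r = avg bump V p 0"
    by (rule DERIV_isconst_end[OF \<open>r > 0\<close> avg_cont])
  also have "\<dots> = V p * bump_mass TYPE('a)"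
    by (simp add: avg_def bump_mass_def)
  finally show ?thesis .
qed

lemma mean_value_on_lift:
  fixes g :: "'a::euclidean_space \<Rightarrow> real"
  assumes g: "continuous_on UNIV g"
    and wh: "\<And>x r. 0 < r \<Longrightarrow> cball x r \<subseteq> U \<Longrightarrow> weak_helmholtz_at lam g x r"
    and e: "\<And>t. (e has_real_derivative e' t) (at t)" "\<And>t. (e' has_real_derivative lam * e t) (at t)"
  shows "mean_value_on (U \<times> UNIV) (\<lambda>p. g (fst p) * e (snd p))"
proof -
  have e_cont: "continuous_on UNIV e"
    by (intro continuous_at_imp_continuous_on ballI DERIV_isCont[OF e(1)])
  have cont: "continuous_on UNIV (\<lambda>p. g (fst p) * e (snd p))"
    by (intro continuous_intros continuous_on_compose2[OF g] continuous_on_compose2[OF e_cont]) auto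
  show ?thesis
    unfolding mean_value_on_def
  proof (intro conjI allI impI)
    show "continuous_on (U \<times> UNIV) (\<lambda>p. g (fst p) * e (snd p))"
      using cont by (rule continuous_on_subset) simp
    fix p :: "'a \<times> real" and r :: real assume r: "0 < r" "cball p r \<subseteq> U \<times> UNIV"
    obtain x t where p: "p = (x, t)" by (cases p)
    have "cball x r \<subseteq> U"
    proof
      fix y assume "y \<in> cball x r"
      then have "(y, t) \<in> cball p r" by (simp add: p dist_prod_def)
      with r(2) show "y \<in> U" by auto
    qed
    with r(1) have "weak_helmholtz_at lam g x r" by (rule wh)
    then show "avg bump (\<lambda>p. g (fst p) * e (snd p)) p r = g (fst p) * e (snd p) * bump_mass TYPE('a \<times> real)"
      unfolding p using weak_harmonic_lift[OF g _ e] by (intro avg_bump_const[OF cont r(1)]) auto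
  qed
qed

text \<open>The sign of \<open>lam\<close> is left open: an exponential serves for
  \<open>lam \<ge> 0\<close>, a cosine otherwise.\<close>

lemma ex_second_order_exp:
  obtains e e' :: "real \<Rightarrow> real" where "e 0 = 1" "\<And>t. (e has_real_derivative e' t) (at t)"
    "\<And>t. (e' has_real_derivative lam * e t) (at t)"
proof (cases "lam \<ge> 0")
  case True
  show thesis
    by (rule that[of "\<lambda>t. exp (sqrt lam * t)" "\<lambda>t. sqrt lam * exp (sqrt lam * t)"])
      (use True in \<open>auto intro!: derivative_eq_intros simp: mult.assoc[symmetric]\<close>)
next
  case False
  then have sq: "sqrt (- lam) * sqrt (- lam) = - lam" by simp
  show thesis
    by (rule that[of "\<lambda>t. cos (sqrt (- lam) * t)" "\<lambda>t. - sqrt (- lam) * sin (sqrt (- lam) * t)"])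
      (use False in \<open>auto intro!: derivative_eq_intros simp: mult.assoc sq abs_if\<close>)
qed

lemma has_power_series_at_helmholtz:
  fixes g :: "'a::euclidean_space \<Rightarrow> real"
  assumes g: "continuous_on UNIV g" and "open U"
    and wh: "\<And>x r. 0 < r \<Longrightarrow> cball x r \<subseteq> U \<Longrightarrow> weak_helmholtz_at lam g x r" and "a \<in> U"
  shows "has_power_series_at g a"
proof -
  obtain e e' :: "real \<Rightarrow> real" where e0: "e 0 = 1" and e: "\<And>t. (e has_real_derivative e' t) (at t)"
    "\<And>t. (e' has_real_derivative lam * e t) (at t)"
    using ex_second_order_exp by blast
  have "has_power_series_at (\<lambda>p. g (fst p) * e (snd p)) (a, 0)"
    using \<open>open U\<close> \<open>a \<in> U\<close>
    by (intro mean_value_on_has_power_series_at[OF _ mean_value_on_lift[OF g wh e]]) (auto intro: open_Times)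
  then have "has_power_series_at (\<lambda>x. (\<lambda>p. g (fst p) * e (snd p)) (0 + (x, 0))) a"
  \<comment> \<open>The added coordinate of \<open>(x, 0)\<close> is 0 times any coordinate of
    \<open>x\<close>, so \<open>\<gamma>\<close> is 0 there and \<open>\<sigma>\<close> picks an
    arbitrary basis vector.\<close>
  proof (intro has_power_series_at_subst[where \<gamma> = "\<lambda>b. if snd b = 0 then 1 else 0"
        and \<sigma> = "\<lambda>b. if snd b = 0 then fst b else (SOME b. b \<in> Basis)"])
    show "bounded_linear (\<lambda>x::'a. (x, 0::real))"
      by (intro bounded_linear_Pair bounded_linear_ident bounded_linear_zero)
  qed (auto simp: Basis_prod_def some_in_eq)
  then show ?thesis by (simp add: e0)
qed

section \<open>Neumann eigenfunctions\<close>

lemma L2_fun_mult_integrable: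
  assumes "L2_fun M f" "L2_fun M g"
  shows "integrable M (\<lambda>x. f x * g x)"
proof (rule Bochner_Integration.integrable_bound)
  show "integrable M (\<lambda>x. (f x)\<^sup>2 + (g x)\<^sup>2)" "(\<lambda>x. f x * g x) \<in> borel_measurable M"
    using assms by (auto simp: L2_fun_def)
  show "AE x in M. norm (f x * g x) \<le> norm ((f x)\<^sup>2 + (g x)\<^sup>2)"
  proof (rule AE_I2)
    fix x
    have "2 * (\<bar>f x\<bar> * \<bar>g x\<bar>) \<le> (f x)\<^sup>2 + (g x)\<^sup>2"
      using sum_squares_bound[of "\<bar>f x\<bar>" "\<bar>g x\<bar>"] by (simp add: mult.assoc)
    moreover have "0 \<le> \<bar>f x\<bar> * \<bar>g x\<bar>" by simp
    ultimately have "\<bar>f x\<bar> * \<bar>g x\<bar> \<le> (f x)\<^sup>2 + (g x)\<^sup>2" by linarith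
    then show "norm (f x * g x) \<le> norm ((f x)\<^sup>2 + (g x)\<^sup>2)" by (simp add: abs_mult)
  qed
qed

text \<open>Links the Lebesgue integrals over \<Omega> of the weak formulation with the integrals
  over boxes used for averages.\<close>

lemma compact_support_lebesgue_on:
  fixes f :: "'a::euclidean_space \<Rightarrow> real"
  assumes f: "continuous_on UNIV f" "\<And>y. y \<notin> cbox a b \<Longrightarrow> f y = 0" "\<And>y. y \<notin> \<Omega> \<Longrightarrow> f y = 0"
    and "\<Omega> \<in> sets lebesgue"
  shows "integrable (lebesgue_on \<Omega>) f" "(LINT y|lebesgue_on \<Omega>. f y) = integral (cbox a b) f"
proof -
  have m: "f \<in> lborel \<rightarrow>\<^sub>M borel"
    using borel_measurable_continuous_onI[OF f(1)] by simp
  have eq: "(\<lambda>y. indicator \<Omega> y *\<^sub>R f y) = f" using f(3) by (auto simp: fun_eq_iff indicator_def)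
  show "integrable (lebesgue_on \<Omega>) f"
  proof (subst integrable_restrict_space)
    show "integrable lebesgue (\<lambda>y. indicator \<Omega> y *\<^sub>R f y)"
      unfolding eq integrable_completion[OF m] by (rule lborel_integral_eq_integral_cbox(1)[OF f(1,2)])
  qed (use assms(4) in simp)
  have "(LINT y|lebesgue_on \<Omega>. f y) = (LINT y|lebesgue. f y)"
    by (subst integral_restrict_space) (use assms(4) in \<open>simp_all only: eq, simp\<close>)
  also have "\<dots> = (LINT y|lborel. f y)" using m by (rule integral_completion)
  also have "\<dots> = integral (cbox a b) f" by (rule lborel_integral_eq_integral_cbox(2)[OF f(1,2)])
  finally show "(LINT y|lebesgue_on \<Omega>. f y) = integral (cbox a b) f" .
qed

text \<open>All test functions involved vanish outside \<open>cball x r\<close>, so \<open>u\<close>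
  can be exchanged for its continuous extension \<open>g\<close>, and the weak derivatives up to
  order two turn the eigenvalue equation into the required identity.\<close>

lemma neumann_eigenfunction_weak_helmholtz:
  assumes "open \<Omega>" and eig: "neumann_eigenfunction \<Omega> \<kappa> \<mu> u" and "\<kappa> > 0"
    and g: "continuous_on UNIV g" "\<And>y. y \<in> cball x r \<Longrightarrow> g y = u y"
    and r: "0 < r" "cball x r \<subseteq> \<Omega>"
  shows "weak_helmholtz_at (\<mu> / \<kappa>) g x r"
  unfolding weak_helmholtz_at_def
proof (intro allI impI)
  fix c s :: real assume c: "0 \<le> c" and s: "0 < s" "s \<le> r"
  let ?L = "lebesgue_on \<Omega>" and ?Q = "cbox (x - r *\<^sub>R One) (x + r *\<^sub>R One)" and ?d = "1 / s\<^sup>2"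
  let ?\<psi> = "radial_test c ?d x"
  obtain gr h where H2: "H2_fun \<Omega> u gr h"
    and ae: "AE y in ?L. - (\<mu> * u y) = \<kappa> * (\<Sum>b\<in>Basis. h b b y)"
    using eig unfolding neumann_eigenfunction_def neumann_operator_def by blast
  have \<Omega>: "\<Omega> \<in> sets lebesgue" using \<open>open \<Omega>\<close> by simp
  have Q: "cball x r \<subseteq> ?Q"
  proof
    fix y assume "y \<in> cball x r"
    then have "y - x \<in> cball 0 r" by (simp add: dist_norm norm_minus_commute)
    then have "y - x \<in> cbox (- r *\<^sub>R One) (r *\<^sub>R One)"
      by (rule subsetD[OF cball_subset_cbox_One[OF less_imp_le[OF r(1)]]])
    then show "y \<in> ?Q" by (simp add: mem_box algebra_simps)
  qed
  have sub: "cball x s \<subseteq> \<Omega>" using s r by (auto intro: order_trans[OF subset_cball])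
  note test = test_function_radial_test[OF c s(1) sub]
  have zero: "?\<psi> y = 0" "radial_test'' c ?d x b y = 0" if "y \<notin> cball x r" for y b
    using that s radial_test_eq_0[OF c s(1), of y x] by (auto simp: dist_norm norm_minus_commute)
  have conv: "integrable ?L (\<lambda>y. u y * f y)" "(LINT y|?L. u y * f y) = integral ?Q (\<lambda>y. g y * f y)"
    if "continuous_on UNIV f" "\<And>y. y \<notin> cball x r \<Longrightarrow> f y = 0" for f
  proof -
    have eq: "(\<lambda>y. u y * f y) = (\<lambda>y. g y * f y)" using that(2) g(2) by (fastforce simp: fun_eq_iff)
    have "continuous_on UNIV (\<lambda>y. g y * f y)" by (intro continuous_intros g that)
    moreover have "g y * f y = 0" if "y \<notin> ?Q \<or> y \<notin> \<Omega>" for y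
    proof -
      have "y \<notin> cball x r" using that Q r(2) by blast
      with \<open>\<And>y. y \<notin> cball x r \<Longrightarrow> f y = 0\<close> show ?thesis by simp
    qed
    ultimately show "integrable ?L (\<lambda>y. u y * f y)" "(LINT y|?L. u y * f y) = integral ?Q (\<lambda>y. g y * f y)"
      unfolding eq by (intro compact_support_lebesgue_on[where a = "x - r *\<^sub>R One" and b = "x + r *\<^sub>R One"] \<Omega>; simp)+
  qed
  have \<psi>: "continuous_on UNIV ?\<psi>" "continuous_on UNIV (radial_test'' c ?d x b)" for b
    by (intro continuous_on_radial_test continuous_on_const continuous_on_id)+
  \<comment> \<open>The entries of the Hessian are only square-integrable, so the test function must
    be too before the sum over the basis can leave the integral.\<close>
  have "integrable ?L (\<lambda>y. (?\<psi> y)\<^sup>2)"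
  proof (rule compact_support_lebesgue_on[OF _ _ _ \<Omega>])
    show "continuous_on UNIV (\<lambda>y. (?\<psi> y)\<^sup>2)" by (intro continuous_intros \<psi>)
    show "(?\<psi> y)\<^sup>2 = 0" if "y \<notin> ?Q" for y using zero(1)[of y] subsetD[OF Q] that by force
    show "(?\<psi> y)\<^sup>2 = 0" if "y \<notin> \<Omega>" for y using zero(1)[of y] subsetD[OF r(2)] that by force
  qed
  moreover have "?\<psi> \<in> borel_measurable ?L"
  proof (rule borel_measurable_integrable, rule compact_support_lebesgue_on[OF \<psi>(1) _ _ \<Omega>])
    show "?\<psi> y = 0" if "y \<notin> ?Q" for y using zero(1)[of y] subsetD[OF Q] that by force
    show "?\<psi> y = 0" if "y \<notin> \<Omega>" for y using zero(1)[of y] subsetD[OF r(2)] that by force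
  qed
  ultimately have L2\<psi>: "L2_fun ?L ?\<psi>" by (simp add: L2_fun_def)
  \<comment> \<open>First \<open>u\<close> is tested with \<open>radial_test'\<close>, then its weak
    gradient with \<open>radial_test\<close>; the two minus signs cancel.\<close>
  have by_parts: "(LINT y|?L. u y * radial_test'' c ?d x b y) = (LINT y|?L. h b b y * ?\<psi> y)"
    and L2h: "L2_fun ?L (h b b)" if "b \<in> Basis" for b
  proof -
    have "L2_weak_deriv \<Omega> b u (gr b)" and hb: "L2_weak_deriv \<Omega> b (gr b) (h b b)"
      using H2 that by (auto simp: H2_fun_def H1_fun_def)
    then have "(LINT y|?L. u y * frechet_derivative (radial_test' c ?d x b) (at y) b) =
        (LINT y|?L. gr b y * frechet_derivative ?\<psi> (at y) b) * -1"
      using test(2)[of b] by (simp add: L2_weak_deriv_def frechet_derivative_radial_test)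
    also have "\<dots> = (LINT y|?L. h b b y * ?\<psi> y)"
      using hb test(1) by (simp add: L2_weak_deriv_def)
    finally show "(LINT y|?L. u y * radial_test'' c ?d x b y) = (LINT y|?L. h b b y * ?\<psi> y)"
      by (simp add: frechet_derivative_radial_test')
    show "L2_fun ?L (h b b)" using hb by (simp add: L2_weak_deriv_def)
  qed
  have "integral ?Q (\<lambda>y. g y * (\<Sum>b\<in>Basis. radial_test'' c ?d x b y)) =
      (LINT y|?L. u y * (\<Sum>b\<in>Basis. radial_test'' c ?d x b y))"
    using \<psi>(2) zero(2) by (intro conv(2)[symmetric] continuous_on_sum) auto
  also have "\<dots> = (\<Sum>b\<in>Basis. LINT y|?L. u y * radial_test'' c ?d x b y)"
    unfolding sum_distrib_left using conv(1)[OF \<psi>(2) zero(2)] by (intro Bochner_Integration.integral_sum)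
  also have "\<dots> = (\<Sum>b\<in>Basis. LINT y|?L. h b b y * ?\<psi> y)"
    using by_parts by simp
  also have "\<dots> = (LINT y|?L. (\<Sum>b\<in>Basis. h b b y * ?\<psi> y))"
    using L2_fun_mult_integrable[OF L2h L2\<psi>] by (intro Bochner_Integration.integral_sum[symmetric])
  also have "\<dots> = (LINT y|?L. - (\<mu> / \<kappa>) * (u y * ?\<psi> y))"
  proof (rule integral_cong_AE)
    show "AE y in ?L. (\<Sum>b\<in>Basis. h b b y * ?\<psi> y) = - (\<mu> / \<kappa>) * (u y * ?\<psi> y)"
      using ae
    proof eventually_elim
      fix y assume *: "- (\<mu> * u y) = \<kappa> * (\<Sum>b\<in>Basis. h b b y)"
      have "(\<Sum>b\<in>Basis. h b b y) = - (\<mu> / \<kappa>) * u y"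
        using * \<open>\<kappa> > 0\<close> by (simp add: field_simps)
      then show "(\<Sum>b\<in>Basis. h b b y * ?\<psi> y) = - (\<mu> / \<kappa>) * (u y * ?\<psi> y)"
        by (simp flip: sum_distrib_right)
    qed
    show "(\<lambda>y. \<Sum>b\<in>Basis. h b b y * ?\<psi> y) \<in> borel_measurable ?L"
      using L2h L2\<psi> unfolding L2_fun_def by (intro borel_measurable_sum borel_measurable_times) auto
    show "(\<lambda>y. - (\<mu> / \<kappa>) * (u y * ?\<psi> y)) \<in> borel_measurable ?L"
      using borel_measurable_integrable[OF conv(1)[OF \<psi>(1) zero(1)]] by measurable
  qed
  also have "\<dots> = - (\<mu> / \<kappa>) * (LINT y|?L. u y * ?\<psi> y)" by simp
  also have "(LINT y|?L. u y * ?\<psi> y) = integral ?Q (\<lambda>y. g y * ?\<psi> y)"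
    by (rule conv(2)[OF \<psi>(1) zero(1)])
  finally show "integral ?Q (\<lambda>y. g y * (\<Sum>b\<in>Basis. radial_test'' c ?d x b y)) =
      - (\<mu> / \<kappa>) * integral ?Q (\<lambda>y. g y * ?\<psi> y)" .
qed

lemma neumann_eigenfunction_has_power_series_at:
  assumes "open \<Omega>" "neumann_eigenfunction \<Omega> \<kappa> \<mu> u" "\<kappa> > 0" "continuous_on \<Omega> u" "a \<in> \<Omega>"
  shows "has_power_series_at u a"
proof -
  obtain R where R: "R > 0" "cball a R \<subseteq> \<Omega>"
    using assms(1,5) open_contains_cball by blast
  obtain g where g: "continuous_on UNIV g" "\<And>y. y \<in> cball a R \<Longrightarrow> g y = u y"
    using continuous_extension_cball[OF assms(4) R(2)] by blast
  have "has_power_series_at g a"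
  proof (rule has_power_series_at_helmholtz[OF g(1) open_ball])
    show "a \<in> ball a R" using R(1) by simp
    fix x r assume r: "0 < r" "cball x r \<subseteq> ball a R"
    then have "cball x r \<subseteq> cball a R" using ball_subset_cball by blast
    with r(1) g R(2) show "weak_helmholtz_at (\<mu> / \<kappa>) g x r"
      by (intro neumann_eigenfunction_weak_helmholtz[OF assms(1-3)]) auto
  qed
  moreover have "\<forall>\<^sub>F x in nhds a. g x = u x"
  proof -
    have "\<forall>\<^sub>F x in nhds a. x \<in> ball a R" using R(1) by (intro eventually_nhds_in_open) auto
    then show ?thesis by eventually_elim (simp add: g(2))
  qed
  ultimately show ?thesis by (rule has_power_series_at_cong)
qed

section \<open>The determinant\<close>

lemma open_config_set: "open \<Omega> \<Longrightarrow> open (config_set \<Omega> :: (real^3^'m::finite) set)"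
proof -
  assume "open \<Omega>"
  have "config_set \<Omega> = (\<Inter>j. (\<lambda>x. x $ j) -` \<Omega>)" by (auto simp: config_set_def)
  also have "open \<dots>"
    using \<open>open \<Omega>\<close> by (intro open_INT finite ballI continuous_open_vimage continuous_intros) auto
  finally show ?thesis .
qed

text \<open>Paths can be combined coordinate by coordinate, and the open connected \<Omega> is
  path-connected.\<close>

lemma connected_config_set:
  assumes "open \<Omega>" "connected \<Omega>"
  shows "connected (config_set \<Omega> :: (real^3^'m::finite) set)"
proof (rule path_connected_imp_connected)
  have pc: "path_connected \<Omega>" using assms by (rule connected_open_path_connected)
  show "path_connected (config_set \<Omega> :: (real^3^'m) set)"
    unfolding path_connected_def
  proof (intro ballI)
    fix x y :: "real^3^'m" assume "x \<in> config_set \<Omega>" "y \<in> config_set \<Omega>"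
    then have "\<exists>g. path g \<and> path_image g \<subseteq> \<Omega> \<and> pathstart g = x $ j \<and> pathfinish g = y $ j" for j
      using pc by (auto simp: config_set_def path_connected_def)
    then obtain g where g: "\<And>j. path (g j)" "\<And>j. path_image (g j) \<subseteq> \<Omega>"
        "\<And>j. pathstart (g j) = x $ j" "\<And>j. pathfinish (g j) = y $ j"
      by metis
    have "path (\<lambda>t. \<chi> j. g j t)"
      using g(1) unfolding path_def by (intro continuous_on_vec_lambda)
    moreover have "path_image (\<lambda>t. \<chi> j. g j t) \<subseteq> config_set \<Omega>"
      using g(2) by (fastforce simp: path_image_def config_set_def)
    ultimately show "\<exists>g. path g \<and> path_image g \<subseteq> config_set \<Omega> \<and> pathstart g = x \<and> pathfinish g = y"
      using g(3,4) by (intro exI[of _ "\<lambda>t. \<chi> j. g j t"]) (auto simp: pathstart_def pathfinish_def vec_eq_iff)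
  qed
qed

lemma eval_det_eq:
  "eval_det \<phi> e x = (\<Sum>p | p permutes UNIV. of_int (sign p) * (\<Prod>i\<in>UNIV. \<phi> (e (p i)) (x $ i)))"
  by (simp add: eval_det_def det_def)

lemma eval_det_has_power_series_at:
  fixes x :: "real^3^'m::finite"
  assumes "\<And>k i. has_power_series_at (\<phi> (e k)) (x $ i)"
  shows "has_power_series_at (eval_det \<phi> e) x"
proof -
  have "has_power_series_at (\<lambda>x. \<phi> (e k) (0 + x $ i)) x" for k i
  proof (rule has_power_series_at_subst[where L = "\<lambda>x. x $ i" and \<gamma> = "\<lambda>_. 1" and \<sigma> = "axis i"])
    show "bounded_linear (\<lambda>x :: real^3^'m. x $ i)" by (rule bounded_linear_vec_nth)
    show "axis i b \<in> (Basis :: (real^3^'m) set)" if "b \<in> Basis" for b :: "real^3"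
      using that by (auto simp: Basis_vec_def)
  qed (use assms in \<open>auto simp: inner_axis\<close>)
  then have "has_power_series_at (\<lambda>x. \<phi> (e k) (x $ i)) x" for k i
    by simp
  then show ?thesis
    unfolding eval_det_eq[abs_def]
    by (intro has_power_series_at_sum has_power_series_at_mult has_power_series_at_prod has_power_series_at_const)
qed

lemma continuous_on_eval_det:
  assumes "\<And>k. continuous_on \<Omega> (\<phi> (e k))"
  shows "continuous_on (config_set \<Omega>) (eval_det \<phi> e)"
proof -
  have "continuous_on (config_set \<Omega>) (\<lambda>x. \<phi> (e k) (x $ i))" for k i
    by (rule continuous_on_compose2[OF assms]) (auto simp: config_set_def intro!: continuous_intros)
  then show ?thesis
    unfolding eval_det_eq[abs_def]
    by (intro continuous_on_sum continuous_on_mult continuous_on_prod continuous_on_const)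
qed

text \<open>If all determinants vanish, the vectors \<open>(\<phi> (e k) x)\<^sub>k\<close> lie in a hyperplane, which is a
  linear relation between the basis functions.\<close>

lemma ex_eval_det_nonzero:
  fixes e :: "'m::finite \<Rightarrow> nat"
  assumes orth: "L2_orthonormal_basis (lebesgue_on \<Omega>) \<phi>" and e: "bij_betw e UNIV {1..CARD('m)}"
    and "\<Omega> \<in> sets lebesgue"
  shows "\<exists>x\<in>config_set \<Omega>. eval_det \<phi> e x \<noteq> 0"
proof -
  let ?L = "lebesgue_on \<Omega>"
  have e1: "1 \<le> e k" for k using e by (auto simp: bij_betw_def)
  define \<Phi> where "\<Phi> x = (\<chi> k. \<phi> (e k) x)" for x
  have span: "span (\<Phi> ` \<Omega>) = (UNIV :: (real^'m) set)"
  proof (rule ccontr)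
    assume "\<not> ?thesis"
    then obtain c where "c \<noteq> 0" and c: "\<And>v. v \<in> span (\<Phi> ` \<Omega>) \<Longrightarrow> c \<bullet> v = 0"
      using span_not_UNIV_orthogonal by blast
    have rel: "(\<Sum>k\<in>UNIV. c $ k * \<phi> (e k) x) = 0" if "x \<in> \<Omega>" for x
      using c[OF span_base, of "\<Phi> x"] that by (simp add: inner_vec_def \<Phi>_def)
    \<comment> \<open>Integrating the relation against \<open>\<phi> (e l)\<close> isolates this
      coefficient by orthonormality.\<close>
    have "c $ l = 0" for l
    proof -
      have int: "integrable ?L (\<lambda>x. \<phi> (e k) x * \<phi> (e l) x)" for k
        using orth e1 unfolding L2_orthonormal_basis_def by (intro L2_fun_mult_integrable) auto
      have "0 = (LINT x|?L. (\<Sum>k\<in>UNIV. c $ k * \<phi> (e k) x) * \<phi> (e l) x)"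
        using rel by (subst Bochner_Integration.integral_cong[where g = "\<lambda>_. 0"]) (auto simp: space_restrict_space)
      also have "\<dots> = (LINT x|?L. (\<Sum>k\<in>UNIV. c $ k * (\<phi> (e k) x * \<phi> (e l) x)))"
        by (simp add: sum_distrib_right mult.assoc)
      also have "\<dots> = (\<Sum>k\<in>UNIV. c $ k * L2_inner ?L (\<phi> (e k)) (\<phi> (e l)))"
        using int by (subst Bochner_Integration.integral_sum) (auto simp: L2_inner_def)
      also have "\<dots> = (\<Sum>k\<in>UNIV. c $ k * (if k = l then 1 else 0))"
        using orth e1 e unfolding L2_orthonormal_basis_def
        by (intro sum.cong) (auto simp: bij_betw_def inj_eq)
      also have "\<dots> = c $ l" by (simp add: if_distrib sum.delta cong: if_cong)
      finally show ?thesis by simp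
    qed
    with \<open>c \<noteq> 0\<close> show False by (simp add: vec_eq_iff)
  qed
  \<comment> \<open>A basis chosen among the spanning vectors consists of values of
    \<open>\<Phi>\<close>; the points of \<Omega> behind them form the configuration, and the basis
    vectors are the rows of its matrix.\<close>
  obtain B where B: "B \<subseteq> \<Phi> ` \<Omega>" "independent B" "\<Phi> ` \<Omega> \<subseteq> span B" "card B = dim (\<Phi> ` \<Omega>)"
    using basis_exists by blast
  have "dim (\<Phi> ` \<Omega>) = CARD('m)"
    using span by (metis dim_UNIV dim_span DIM_cart DIM_real mult.right_neutral)
  with B have "finite B" "card B = CARD('m)" using independent_imp_finite by auto
  then obtain f where f: "bij_betw f (UNIV :: 'm set) B"
    using finite_same_card_bij[of "UNIV :: 'm set" B] by auto
  then have "\<forall>j. \<exists>y\<in>\<Omega>. f j = \<Phi> y" using B(1) by (auto simp: bij_betw_def)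
  then obtain y where y: "\<And>j. y j \<in> \<Omega>" "\<And>j. f j = \<Phi> (y j)" by metis
  define x :: "real^3^'m" where "x = (\<chi> j. y j)"
  have "rows (\<chi> j k. \<phi> (e k) (x $ j)) = B"
    using f y(2) by (auto simp: rows_def row_def bij_betw_def x_def \<Phi>_def image_def)
  then have "rank (\<chi> j k. \<phi> (e k) (x $ j)) = CARD('m)"
    using B(2) \<open>card B = CARD('m)\<close> by (simp add: row_rank_def dim_eq_card_independent)
  then have "eval_det \<phi> e x \<noteq> 0"
    unfolding eval_det_def by (simp add: det_eq_0_rank)
  moreover have "x \<in> config_set \<Omega>" using y by (simp add: config_set_def x_def)
  ultimately show ?thesis by blast
qed

section \<open>From the determinant to the ranks of the rectangular matrices\<close>

lemma dim_image_interval_le: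
  fixes V :: "nat \<Rightarrow> 'a::euclidean_space"
  shows "dim (V ` {1..N + d}) \<le> dim (V ` {1..N}) + d"
proof (induction d)
  case (Suc d)
  have "V ` {1..N + Suc d} = insert (V (N + Suc d)) (V ` {1..N + d})"
    by (simp add: atLeastAtMostSuc_conv)
  then show ?case using Suc by (simp add: dim_insert)
qed simp

text \<open>Each removed row lowers the dimension of the row space by at most 1, so dropping
  \<open>CARD('m) - N\<close> rows of a matrix of full rank leaves dimension at least
  \<open>N\<close>.\<close>

lemma eval_rank_full:
  fixes x :: "real^3^'m::finite"
  assumes "eval_det \<phi> e x \<noteq> 0" and e: "bij_betw e UNIV {1..CARD('m)}" and "N \<le> CARD('m)"
  shows "eval_rank \<phi> x N = N"
proof -
  define A :: "real^'m^'m" where "A = (\<chi> j k. \<phi> (e k) (x $ j))"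
  have "rank A = CARD('m)"
    using assms(1) rank_bound[of A] by (simp add: eval_det_def A_def det_eq_0_rank)
  \<comment> \<open>In \<open>A\<close> the points index the rows, so the rows of the evaluation
    matrix are the columns of \<open>A\<close>.\<close>
  moreover have "columns A = eval_row \<phi> x ` {1..CARD('m)}"
  proof -
    have "columns A = eval_row \<phi> x ` range e"
      by (auto simp: columns_def column_def A_def eval_row_def)
    with e show ?thesis by (simp add: bij_betw_def)
  qed
  ultimately have "dim (eval_row \<phi> x ` {1..N + (CARD('m) - N)}) = CARD('m)"
    using \<open>N \<le> CARD('m)\<close> by (simp add: column_rank_def)
  then have "CARD('m) \<le> dim (eval_row \<phi> x ` {1..N}) + (CARD('m) - N)"
    using dim_image_interval_le[of "eval_row \<phi> x" N "CARD('m) - N"] by simp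
  then have "N \<le> dim (eval_row \<phi> x ` {1..N})" using \<open>N \<le> CARD('m)\<close> by linarith
  moreover have "dim (eval_row \<phi> x ` {1..N}) \<le> N"
    using dim_le_card'[of "eval_row \<phi> x ` {1..N}"] card_image_le[of "{1..N}" "eval_row \<phi> x"] by simp
  ultimately show ?thesis by (simp add: eval_rank_def)
qed

theorem proposition10p1:
  fixes \<Omega> :: "(real^3) set"
    and \<kappa> :: real
    and \<mu> :: "nat \<Rightarrow> real"
    and \<phi> :: "nat \<Rightarrow> real^3 \<Rightarrow> real"
    and e :: "'m::finite \<Rightarrow> nat"
  assumes "C2_domain \<Omega>" and "bounded \<Omega>"
    and "\<kappa> > 0"
    and "neumann_eigenbasis \<Omega> \<kappa> \<mu> \<phi>"
    and "bij_betw e UNIV {1..CARD('m)}"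
  shows "real_analytic_on (eval_det \<phi> e) (config_set \<Omega>)
    \<and> (\<exists>x\<in>config_set \<Omega>. eval_det \<phi> e x \<noteq> 0)
    \<and> {x \<in> config_set \<Omega>. eval_det \<phi> e x = 0} \<in> null_sets lebesgue
    \<and> (AE x in lebesgue_on (config_set \<Omega> :: (real^3^'m) set).
          \<forall>N\<le>CARD('m). eval_rank \<phi> x N = N)"
proof -
  have \<Omega>: "open \<Omega>" "connected \<Omega>" using \<open>C2_domain \<Omega>\<close> by (auto simp: C2_domain_def)
  have e1: "1 \<le> e k" for k using assms(5) by (auto simp: bij_betw_def)
  have \<phi>: "neumann_eigenfunction \<Omega> \<kappa> (\<mu> (e k)) (\<phi> (e k))" "continuous_on \<Omega> (\<phi> (e k))" for k
    using assms(4) e1 by (auto simp: neumann_eigenbasis_def)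
  have C: "open (config_set \<Omega> :: (real^3^'m) set)" "connected (config_set \<Omega> :: (real^3^'m) set)"
    using \<Omega> by (auto intro: open_config_set connected_config_set)
  have ps: "has_power_series_at (eval_det \<phi> e) x" if "x \<in> config_set \<Omega>" for x
    using that
    by (intro eval_det_has_power_series_at
        neumann_eigenfunction_has_power_series_at[OF \<Omega>(1) \<phi>(1) \<open>\<kappa> > 0\<close> \<phi>(2)])
      (auto simp: config_set_def)
  have "\<exists>x\<in>config_set \<Omega>. eval_det \<phi> e x \<noteq> 0"
    using assms(4,5) \<Omega>(1) by (intro ex_eval_det_nonzero) (auto simp: neumann_eigenbasis_def)
  then obtain p where p: "p \<in> config_set \<Omega>" "eval_det \<phi> e p \<noteq> 0" by blast
  have "negligible {x \<in> config_set \<Omega>. eval_det \<phi> e x = 0}"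
    by (rule negligible_zeros[OF C continuous_on_eval_det[where \<phi> = \<phi> and e = e, OF \<phi>(2)] ps p])
  then have null: "{x \<in> config_set \<Omega>. eval_det \<phi> e x = 0} \<in> null_sets lebesgue"
    by (simp add: negligible_iff_null_sets)
  \<comment> \<open>The zero set of the full determinant is one exceptional set for all
    \<open>N\<close> at once.\<close>
  have "AE x in lebesgue. x \<in> (config_set \<Omega> :: (real^3^'m) set) \<longrightarrow> (\<forall>N\<le>CARD('m). eval_rank \<phi> x N = N)"
    by (rule AE_I'[OF null]) (use eval_rank_full[OF _ assms(5)] in blast)
  then have "AE x in lebesgue_on (config_set \<Omega> :: (real^3^'m) set). \<forall>N\<le>CARD('m). eval_rank \<phi> x N = N"
    using C(1) by (subst AE_restrict_space_iff) auto
  moreover have "real_analytic_on (eval_det \<phi> e) (config_set \<Omega>)"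
    using C(1) ps by (simp add: real_analytic_on_iff)
  ultimately show ?thesis using p null by blast
qed

end
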